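(* Let $\mathbb{P}$ be an admissible measure on $\Omega$ and let $D$ be the effective diffusion tensor. Then: (1) $D$ is strictly positive definite. (2) For all $e\in\mathbb{R}^d$, $$e\cdot De=\frac1Z\inf_{V\in L^2_{pot}(\mathbb{P})}\int_\Omega(e+V(h))\cdot g^{-1}(h)(e+V(h))\sqrt{|g|(h)}\,\mathbb{P}(dh),$$ and $V=\mathbb{D}\chi^e$ is the unique minimiser of this functional over $L^2_{pot}(\mathbb{P})$. (3) For all $e\in\mathbb{R}^d$, $e\cdot D_*e\le e\cdot De\le e\cdot D^*e$, where $$D^*=\frac1Z\int_\Omega g^{-1}(h)\sqrt{|g|(h)}\,\mathbb{P}(dh),\qquad D_*=\frac1Z\left(\int_\Omega\frac{g(h)}{\sqrt{|g|(h)}}\,\mathbb{P}(dh)\right)^{-1}.$$ (4) For all unit vectors $e\in\mathbb{R}^d$, $\frac{1}{Z^2}\le e\cdot De\le1$.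
   Context: Setting. Let $d\ge1$ and let $\Omega=C^3(\mathbb{R}^d;\mathbb{R})$ with the Fréchet metric generated by the seminorms $\|f\|_N=\sup_{|x|\le N}\sum_{k\le3}|\nabla^kf(x)|$, $N\in\mathbb{N}$ (a Polish space). For $x\in\mathbb{R}^d$ let $\tau_x:\Omega\to\Omega$, $\tau_xh=h(\cdot+x)$. A Borel probability measure $\mathbb{P}$ on $\Omega$ is called admissible if: (stationarity) $\mathbb{P}(\tau_x^{-1}(B))=\mathbb{P}(B)$ for all Borel $B$ and all $x$; (ergodicity) if $B$ is Borel and $\tau_x(B)=B$ for all $x$, then $\mathbb{P}(B)\in\{0,1\}$; (stochastic continuity) for all $\delta>0$, the $\mathbb{P}$-probability that the distance between $\tau_xh$ and $h$ exceeds $\delta$ tends to $0$ as $x\to0$; (boundedness) there is a constant $K>0$ such that for $\mathbb{P}$-a.e. $h$, $|\nabla h(x)|+|\nabla\nabla h(x)|\le K$ for all $x\in\mathbb{R}^d$. Coefficients. For $h\in\Omega$: $g(x,h)=I+\nabla h(x)\otimes\nabla h(x)$, $|g|=\det g$, $F(x,h)=\frac{1}{\sqrt{|g|(x,h)}}\nabla_x\cdot\big(\sqrt{|g|(x,h)}\,g^{-1}(x,h)\big)$ (row-wise divergence). Write $g(h)=g(0,h)$, $F(h)=F(0,h)$. Set $Z=\int_\Omega\sqrt{|g|(h)}\,\mathbb{P}(dh)$ and $\pi(dh)=\frac{\sqrt{|g|(h)}}{Z}\mathbb{P}(dh)$. Stochastic derivatives. $D_i$ denotes the $L^2(\mathbb{P})$-generator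 of translations in direction $e_i$: $D_iV(h)=\frac{d}{d\lambda}V(\tau_{\lambda e_i}h)|_{\lambda=0}$ in $L^2(\mathbb{P})$. $\mathbb{D}V=(D_iV)_{i=1}^d$ for $V\in H^1:=\bigcap_i\mathcal{D}(D_i)$ and $\mathbb{D}\cdot\mathbf V=\sum_iD_iV_i$. $L^2_{pot}(\mathbb{P})$ is the closure in $(L^2(\mathbb{P}))^d$ of the range $\{\mathbb{D}V:V\in H^1\}$. $C^k_b(\Omega)$ is the space of bounded measurable $f:\Omega\to\mathbb{R}$ such that $x\mapsto f(\tau_xh)$ is $C^k$ with derivatives up to order $k$ bounded by deterministic constants. $\mathcal{L}$ is the unique self-adjoint extension in $L^2(\pi)$ of $\hat{\mathcal L}f=\frac{1}{\sqrt{|g|(h)}}\mathbb{D}\cdot(\sqrt{|g|(h)}g^{-1}(h)\mathbb{D}f)$, $f\in C_b^2(\Omega)$. Space $\mathcal{H}_1$. $\mathcal{H}_1$ is the completion of $\{\phi\in C_b^2(\Omega):\int\phi\,d\pi=0\}$ under $\|\phi\|_1^2=\langle(-\mathcal L)\phi,\phi\rangle_{L^2(\pi)}=\frac1Z\int_\Omega\mathbb{D}\phi\cdot g^{-1}\mathbb{D}\phi\sqrt{|g|}\,d\mathbb{P}$. Since $g$ is uniformly elliptic and bounded, $\mathbb{D}$ extends continuously to $\mathbb{D}:\mathcal{H}_1\to(L^2(\mathbb{P}))^d$. Correctors and effective tensor. For $e\in\mathbb{R}^d$ put $F^e=F\cdot e$, and for $\lambda>0$ let $\chi^e_\lambda\in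 L^2(\pi)$ solve $(\lambda I-\mathcal L)\chi^e_\lambda=F^e$. It is known that $\chi^e_\lambda$ converges in $\mathcal{H}_1$ as $\lambda\to0$; the limit is denoted $\chi^e$. $\chi=(\chi^{e_i})_{i=1}^d$, $(\mathbb{D}\chi)_{ij}=D_j\chi^{e_i}$, and the effective diffusion tensor is $$D=\frac1Z\int_\Omega(I+\mathbb{D}\chi(h))\,g^{-1}(h)\,(I+\mathbb{D}\chi(h))^\top\sqrt{|g|(h)}\,\mathbb{P}(dh).$$ *)

theory Defs
  imports "HOL-Probability.Probability"
begin

section \<open>Functions of class \<open>C\<^sup>k\<close> and the norms of their derivatives\<close>

definition pd :: "'n \<Rightarrow> (real^'n::finite \<Rightarrow> real) \<Rightarrow> real^'n \<Rightarrow> real" where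
  "pd i f x = frechet_derivative f (at x) (axis i 1)"

primrec Ck :: "nat \<Rightarrow> (real^'n::finite \<Rightarrow> real) \<Rightarrow> bool" where
  "Ck 0 f \<longleftrightarrow> continuous_on UNIV f"
| "Ck (Suc k) f \<longleftrightarrow> (\<forall>x. f differentiable (at x)) \<and> (\<forall>i. Ck k (pd i f))"

text \<open>\<open>dnorm k f x\<close> is the Euclidean (Frobenius) norm of the tensor of all partial derivatives
  of order \<open>k\<close> of \<open>f\<close> at \<open>x\<close>; unfolding the recursion gives the square root of
  the sum of the squares of the iterated partial derivatives over all \<open>k\<close>-tuples of indices.\<close>

primrec dnorm :: "nat \<Rightarrow> (real^'n::finite \<Rightarrow> real) \<Rightarrow> real^'n \<Rightarrow> real" where
  "dnorm 0 f x = \<bar>f x\<bar>"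
| "dnorm (Suc k) f x = L2_set (\<lambda>i. dnorm k (pd i f) x) UNIV"

definition C3_seminorm :: "nat \<Rightarrow> (real^'n::finite \<Rightarrow> real) \<Rightarrow> real" where
  "C3_seminorm N f = (SUP x\<in>cball 0 (real N). \<Sum>k\<le>3. dnorm k f x)"

lemma pd_diff:
  assumes "f differentiable (at x)" "g differentiable (at x)"
  shows "pd i (\<lambda>x. f x - g x) x = pd i f x - pd i g x"
proof -
  have "((\<lambda>x. f x - g x) has_derivative
      (\<lambda>v. frechet_derivative f (at x) v - frechet_derivative g (at x) v)) (at x)"
    using assms by (intro has_derivative_diff) (simp_all flip: frechet_derivative_works)
  from frechet_derivative_at[OF this] show ?thesis
    unfolding pd_def by metis
qed

lemma pd_diff_fun:
  assumes "\<And>x. f differentiable (at x)" "\<And>x. g differentiable (at x)"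
  shows "pd i (\<lambda>x. f x - g x) = (\<lambda>x. pd i f x - pd i g x)"
  using assms by (auto simp: pd_diff)

lemma Ck_diff: "Ck k f \<Longrightarrow> Ck k g \<Longrightarrow> Ck k (\<lambda>x. f x - g x)"
  by (induction k arbitrary: f g) (auto intro: continuous_intros simp: pd_diff_fun)

lemma dnorm_nonneg: "0 \<le> dnorm k f x"
  by (induction k arbitrary: f) auto

lemma dnorm_triangle:
  "Ck k f \<Longrightarrow> Ck k g \<Longrightarrow> Ck k h \<Longrightarrow>
   dnorm k (\<lambda>x. f x - h x) x \<le> dnorm k (\<lambda>x. f x - g x) x + dnorm k (\<lambda>x. g x - h x) x"
proof (induction k arbitrary: f g h)
  case 0
  then show ?case by simp
next
  case (Suc k)
  have "L2_set (\<lambda>i. dnorm k (\<lambda>x. pd i f x - pd i h x) x) UNIV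
     \<le> L2_set (\<lambda>i. dnorm k (\<lambda>x. pd i f x - pd i g x) x + dnorm k (\<lambda>x. pd i g x - pd i h x) x) UNIV"
    using Suc by (intro L2_set_mono) (auto simp: dnorm_nonneg)
  also have "\<dots> \<le> L2_set (\<lambda>i. dnorm k (\<lambda>x. pd i f x - pd i g x) x) UNIV
      + L2_set (\<lambda>i. dnorm k (\<lambda>x. pd i g x - pd i h x) x) UNIV"
    by (rule L2_set_triangle_ineq)
  finally show ?case using Suc.prems by (simp add: pd_diff_fun)
qed

lemma dnorm_minus_commute:
  "Ck k f \<Longrightarrow> Ck k g \<Longrightarrow> dnorm k (\<lambda>x. f x - g x) x = dnorm k (\<lambda>x. g x - f x) x"
proof (induction k arbitrary: f g)
  case 0
  then show ?case by simp
next
  case (Suc k)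
  have "dnorm k (\<lambda>x. pd i f x - pd i g x) x = dnorm k (\<lambda>x. pd i g x - pd i f x) x" for i
    using Suc.prems by (intro Suc.IH) auto
  then show ?case using Suc.prems by (simp add: pd_diff_fun)
qed

lemma continuous_on_dnorm: "Ck k f \<Longrightarrow> continuous_on UNIV (dnorm k f)"
proof (induction k arbitrary: f)
  case 0
  then show ?case by (auto intro: continuous_intros)
next
  case (Suc k)
  then show ?case unfolding dnorm.simps(2)[abs_def] L2_set_def
    by (intro continuous_intros) auto
qed

lemma Ck_imp_continuous: "Ck k f \<Longrightarrow> continuous_on UNIV f"
  by (cases k)
    (auto simp: continuous_on_eq_continuous_at dest: differentiable_imp_continuous_within)

lemma Ck_SucD: "Ck (Suc k) f \<Longrightarrow> Ck k f"
proof (induction k arbitrary: f)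
  case 0
  then show ?case using Ck_imp_continuous[of "Suc 0" f] by simp
next
  case (Suc k)
  then show ?case by simp
qed

lemma Ck_mono: "Ck k f \<Longrightarrow> j \<le> k \<Longrightarrow> Ck j f"
  by (induction k) (auto simp: le_Suc_eq simp del: Ck.simps dest: Ck_SucD)

lemma bdd_above_C3:
  assumes "Ck 3 f"
  shows "bdd_above ((\<lambda>x. \<Sum>k\<le>3. dnorm k f x) ` cball 0 (real N))"
proof -
  have "continuous_on (cball 0 (real N)) (\<lambda>x. \<Sum>k\<le>3. dnorm k f x)"
    using assms by (intro continuous_intros continuous_on_subset[OF continuous_on_dnorm])
      (auto intro: Ck_mono)
  then show ?thesis
    by (intro bounded_imp_bdd_above compact_imp_bounded compact_continuous_image compact_cball)
qed

lemma C3_seminorm_upper: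
  assumes "Ck 3 f" "norm x \<le> real N"
  shows "(\<Sum>k\<le>3. dnorm k f x) \<le> C3_seminorm N f"
  unfolding C3_seminorm_def using assms by (intro cSUP_upper bdd_above_C3) auto

lemma C3_seminorm_nonneg: "Ck 3 f \<Longrightarrow> 0 \<le> C3_seminorm N f"
  by (rule order_trans[OF _ C3_seminorm_upper[where x = 0]]) (auto intro: sum_nonneg dnorm_nonneg)

lemma C3_seminorm_triangle:
  assumes "Ck 3 f" "Ck 3 g" "Ck 3 h"
  shows "C3_seminorm N (\<lambda>x. f x - h x)
    \<le> C3_seminorm N (\<lambda>x. f x - g x) + C3_seminorm N (\<lambda>x. g x - h x)"
  unfolding C3_seminorm_def[of N "\<lambda>x. f x - h x"]
proof (rule cSUP_least)
  fix x :: "real^'a" assume x: "x \<in> cball 0 (real N)"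
  have "(\<Sum>k\<le>3. dnorm k (\<lambda>x. f x - h x) x)
     \<le> (\<Sum>k\<le>3. dnorm k (\<lambda>x. f x - g x) x + dnorm k (\<lambda>x. g x - h x) x)"
    using assms by (intro sum_mono dnorm_triangle) (auto intro: Ck_mono)
  also have "\<dots> = (\<Sum>k\<le>3. dnorm k (\<lambda>x. f x - g x) x) + (\<Sum>k\<le>3. dnorm k (\<lambda>x. g x - h x) x)"
    by (rule sum.distrib)
  also have "\<dots> \<le> C3_seminorm N (\<lambda>x. f x - g x) + C3_seminorm N (\<lambda>x. g x - h x)"
    using assms x by (intro add_mono C3_seminorm_upper Ck_diff) auto
  finally show "(\<Sum>k\<le>3. dnorm k (\<lambda>x. f x - h x) x)
    \<le> C3_seminorm N (\<lambda>x. f x - g x) + C3_seminorm N (\<lambda>x. g x - h x)" .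
qed simp

lemma C3_seminorm_commute:
  assumes "Ck 3 f" "Ck 3 g"
  shows "C3_seminorm N (\<lambda>x. f x - g x) = C3_seminorm N (\<lambda>x. g x - f x)"
proof -
  have "(\<Sum>k\<le>3. dnorm k (\<lambda>x. f x - g x) x) = (\<Sum>k\<le>3. dnorm k (\<lambda>x. g x - f x) x)" for x
    using assms by (intro sum.cong dnorm_minus_commute) (auto intro: Ck_mono)
  then show ?thesis unfolding C3_seminorm_def by simp
qed

lemma frechet_derivative_shift:
  assumes "f differentiable (at (x + a))"
  shows "frechet_derivative (\<lambda>y. f (y + a)) (at x) = frechet_derivative f (at (x + a))"
    and "(\<lambda>y. f (y + a)) differentiable (at x)"
proof -
  have "(f has_derivative frechet_derivative f (at (x + a))) (at (x + a))"
    using assms frechet_derivative_works by blast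
  then have "((\<lambda>y. f (y + a)) has_derivative frechet_derivative f (at (x + a))) (at x)"
    by (intro has_derivative_compose[of "\<lambda>y. y + a" "\<lambda>y. y" x UNIV f, simplified])
      (auto intro!: derivative_eq_intros)
  then show "frechet_derivative (\<lambda>y. f (y + a)) (at x) = frechet_derivative f (at (x + a))"
    and "(\<lambda>y. f (y + a)) differentiable (at x)"
    using frechet_derivative_at differentiable_def by (metis, blast)
qed

lemma Ck_shift: "Ck k f \<Longrightarrow> Ck k (\<lambda>y. f (y + a))"
proof (induction k arbitrary: f)
  case 0
  then show ?case by (auto intro!: continuous_intros continuous_on_compose2[of UNIV f])
next
  case (Suc k)
  then have "pd i (\<lambda>y. f (y + a)) = (\<lambda>y. pd i f (y + a))" for i
    by (auto simp: pd_def frechet_derivative_shift)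
  then show ?case using Suc by (auto intro: frechet_derivative_shift)
qed

section \<open>The space \<open>\<Omega>\<close>\<close>

typedef ('n::finite) C3 = "{h :: real^'n \<Rightarrow> real. Ck 3 h}"
  morphisms app C3_of
proof -
  have "Ck k (\<lambda>x::real^'n. 0)" for k
  proof (induction k)
    case (Suc k)
    have "pd i (\<lambda>x::real^'n. 0) = (\<lambda>x. 0)" for i by (auto simp: pd_def)
    then show ?case using Suc by simp
  qed simp
  then show ?thesis by blast
qed

setup_lifting type_definition_C3

lemma Ck_app: "Ck 3 (app h)"
  using app by blast

instantiation C3 :: (finite) metric_space
begin

definition dist_C3 :: "'a C3 \<Rightarrow> 'a C3 \<Rightarrow> real" where
  "dist_C3 f g = (\<Sum>N. (1/2)^N * min 1 (C3_seminorm N (\<lambda>x. app f x - app g x)))"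

definition uniformity_C3 :: "('a C3 \<times> 'a C3) filter" where
  "uniformity_C3 = (INF e\<in>{0<..}. principal {(x, y). dist x y < e})"

definition open_C3 :: "'a C3 set \<Rightarrow> bool" where
  "open_C3 U \<longleftrightarrow> (\<forall>x\<in>U. \<forall>\<^sub>F (x', y) in uniformity. x' = x \<longrightarrow> y \<in> U)"

instance
proof
  have nn: "0 \<le> C3_seminorm N (\<lambda>x. app f x - app g x)" for N and f g :: "'a C3"
    by (intro C3_seminorm_nonneg Ck_diff Ck_app)
  have summ: "summable (\<lambda>N. (1/2)^N * min 1 (C3_seminorm N (\<lambda>x. app f x - app g x)))"
    for f g :: "'a C3"
    by (rule summable_comparison_test'[of "\<lambda>N. (1/2::real)^N" 0])
      (auto simp: summable_geometric nn)
  fix f g h :: "'a C3"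
  show "dist f g = 0 \<longleftrightarrow> f = g"
  proof
    assume "dist f g = 0"
    then have *: "(1/2)^N * min 1 (C3_seminorm N (\<lambda>x. app f x - app g x)) = 0" for N
      using suminf_eq_zero_iff[OF summ[of f g]] nn unfolding dist_C3_def by simp
    have "app f x = app g x" for x
    proof -
      obtain N where N: "norm x \<le> real N" using real_arch_simple by blast
      have "\<bar>app f x - app g x\<bar> = dnorm 0 (\<lambda>x. app f x - app g x) x" by simp
      also have "\<dots> \<le> (\<Sum>k\<le>3. dnorm k (\<lambda>x. app f x - app g x) x)"
        by (rule member_le_sum) (auto simp: dnorm_nonneg simp del: dnorm.simps)
      also have "\<dots> \<le> C3_seminorm N (\<lambda>x. app f x - app g x)"
        using N by (intro C3_seminorm_upper Ck_diff Ck_app)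
      also have "\<dots> = 0" using *[of N] by (auto simp: min_def split: if_splits)
      finally show ?thesis by simp
    qed
    then show "f = g" by (metis app_inject ext)
  next
    assume "f = g"
    moreover have "C3_seminorm N (\<lambda>x. app g x - app g x) = 0" for N
    proof -
      have "dnorm k (\<lambda>x::real^'a. 0) x = 0" for k x
      proof (induction k)
        case (Suc k)
        have "pd i (\<lambda>x::real^'a. 0) = (\<lambda>x. 0)" for i by (auto simp: pd_def)
        then show ?case using Suc by (simp add: L2_set_def)
      qed simp
      then show ?thesis unfolding C3_seminorm_def by simp
    qed
    ultimately show "dist f g = 0" unfolding dist_C3_def by simp
  qed
  show "dist f g \<le> dist f h + dist g h"
  proof -
    have le: "min 1 (C3_seminorm N (\<lambda>x. app f x - app g x))
      \<le> min 1 (C3_seminorm N (\<lambda>x. app f x - app h x))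
        + min 1 (C3_seminorm N (\<lambda>x. app g x - app h x))" for N
      using C3_seminorm_triangle[OF Ck_app Ck_app Ck_app, of N f g h]
        C3_seminorm_commute[OF Ck_app Ck_app, of N g h] nn[of N f h] nn[of N g h]
      by (auto simp: min_def)
    have "dist f g \<le> (\<Sum>N. (1/2)^N * min 1 (C3_seminorm N (\<lambda>x. app f x - app h x))
        + (1/2)^N * min 1 (C3_seminorm N (\<lambda>x. app g x - app h x)))"
      unfolding dist_C3_def
      using le by (intro suminf_le summ summable_add) (simp flip: distrib_left)
    also have "\<dots> = dist f h + dist g h"
      unfolding dist_C3_def by (rule suminf_add[OF summ summ, symmetric])
    finally show ?thesis .
  qed
qed (simp_all add: uniformity_C3_def open_C3_def)

end

lift_definition shift :: "real^'n::finite \<Rightarrow> 'n C3 \<Rightarrow> 'n C3" is "\<lambda>x h y. h (y + x)"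
  by (rule Ck_shift)

definition admissible :: "('n::finite) C3 measure \<Rightarrow> bool" where
  "admissible P \<longleftrightarrow>
     prob_space P \<and> sets P = sets borel
   \<and> (\<forall>x. \<forall>B\<in>sets borel. measure P (shift x -` B) = measure P B)
   \<and> (\<forall>B\<in>sets borel. (\<forall>x. shift x ` B = B) \<longrightarrow> measure P B \<in> {0, 1})
   \<and> (\<forall>\<delta>>0. ((\<lambda>x. measure P {h. dist (shift x h) h > \<delta>}) \<longlongrightarrow> 0) (at 0))
   \<and> (\<exists>K>0. AE h in P. \<forall>x. dnorm 1 (app h) x + dnorm 2 (app h) x \<le> K)"

section \<open>Coefficients\<close>

definition metric_g :: "real^'n \<Rightarrow> 'n C3 \<Rightarrow> real^'n^'n::finite" where
  "metric_g x h = mat 1 + (\<chi> i j. pd i (app h) x * pd j (app h) x)"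

definition vol :: "real^'n \<Rightarrow> ('n::finite) C3 \<Rightarrow> real" where
  "vol x h = sqrt (det (metric_g x h))"

definition ginv :: "real^'n \<Rightarrow> 'n C3 \<Rightarrow> real^'n^'n::finite" where
  "ginv x h = matrix_inv (metric_g x h)"

definition drift :: "real^'n \<Rightarrow> 'n C3 \<Rightarrow> real^'n::finite" where
  "drift x h = (\<chi> i. (\<Sum>j\<in>UNIV. pd j (\<lambda>y. vol y h * ginv y h $ i $ j) x) / vol x h)"

definition Znorm :: "('n::finite) C3 measure \<Rightarrow> real" where
  "Znorm P = (\<integral>h. vol 0 h \<partial>P)"

definition piM :: "('n::finite) C3 measure \<Rightarrow> 'n C3 measure" where
  "piM P = density P (\<lambda>h. ennreal (vol 0 h / Znorm P))"

section \<open>\<open>L\<^sup>2\<close> spaces and self-adjoint operators\<close>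

text \<open>Elements of \<open>L\<^sup>2\<close> are represented by functions; equality in \<open>L\<^sup>2\<close> is almost everywhere
  equality.\<close>

definition L2 :: "'a measure \<Rightarrow> ('a \<Rightarrow> 'b::euclidean_space) set" where
  "L2 M = {f \<in> borel_measurable M. integrable M (\<lambda>x. (norm (f x))\<^sup>2)}"

definition L2_dist :: "'a measure \<Rightarrow> ('a \<Rightarrow> 'b::euclidean_space) \<Rightarrow> ('a \<Rightarrow> 'b) \<Rightarrow> real" where
  "L2_dist M f g = sqrt (\<integral>x. (norm (f x - g x))\<^sup>2 \<partial>M)"

text \<open>Operators in \<open>L\<^sup>2(M)\<close> are given by their graphs. If the domain of \<open>T\<close> is dense then
  \<open>adjoint_graph M T\<close> is the graph of a linear operator (single-valued up to null sets and closed
  under changes on null sets), so that \<open>T = adjoint_graph M T\<close> makes \<open>T\<close> one as well.\<close>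

definition adjoint_graph ::
  "'a measure \<Rightarrow> (('a \<Rightarrow> real) \<times> ('a \<Rightarrow> real)) set \<Rightarrow> (('a \<Rightarrow> real) \<times> ('a \<Rightarrow> real)) set" where
  "adjoint_graph M T = {(u, v). u \<in> L2 M \<and> v \<in> L2 M \<and>
     (\<forall>(f, k)\<in>T. (\<integral>x. u x * k x \<partial>M) = (\<integral>x. v x * f x \<partial>M))}"

definition self_adjoint :: "'a measure \<Rightarrow> (('a \<Rightarrow> real) \<times> ('a \<Rightarrow> real)) set \<Rightarrow> bool" where
  "self_adjoint M T \<longleftrightarrow>
     (\<forall>f\<in>L2 M. \<forall>\<epsilon>>0. \<exists>u\<in>Domain T. u \<in> L2 M \<and> L2_dist M u f < \<epsilon>) \<and> T = adjoint_graph M T"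

section \<open>Stochastic derivatives\<close>

definition has_stoch_deriv ::
  "('n::finite) C3 measure \<Rightarrow> 'n \<Rightarrow> ('n C3 \<Rightarrow> real) \<Rightarrow> ('n C3 \<Rightarrow> real) \<Rightarrow> bool" where
  "has_stoch_deriv P i V W \<longleftrightarrow> V \<in> L2 P \<and> W \<in> L2 P \<and>
     ((\<lambda>t. L2_dist P (\<lambda>h. (V (shift (t *\<^sub>R axis i 1) h) - V h) / t) W) \<longlongrightarrow> 0) (at 0)"

text \<open>The derivative is unique up to null sets; an arbitrary representative is chosen.\<close>

definition stoch_D :: "('n::finite) C3 measure \<Rightarrow> 'n \<Rightarrow> ('n C3 \<Rightarrow> real) \<Rightarrow> 'n C3 \<Rightarrow> real" where
  "stoch_D P i V = (SOME W. has_stoch_deriv P i V W)"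

definition sob1 :: "('n::finite) C3 measure \<Rightarrow> ('n C3 \<Rightarrow> real) set" where
  "sob1 P = {V. \<forall>i. \<exists>W. has_stoch_deriv P i V W}"

definition grad_D :: "('n::finite) C3 measure \<Rightarrow> ('n C3 \<Rightarrow> real) \<Rightarrow> 'n C3 \<Rightarrow> real^'n" where
  "grad_D P V h = (\<chi> i. stoch_D P i V h)"

definition div_D :: "('n::finite) C3 measure \<Rightarrow> ('n C3 \<Rightarrow> real^'n) \<Rightarrow> 'n C3 \<Rightarrow> real" where
  "div_D P V h = (\<Sum>i\<in>UNIV. stoch_D P i (\<lambda>h'. V h' $ i) h)"

definition L2pot :: "('n::finite) C3 measure \<Rightarrow> ('n C3 \<Rightarrow> real^'n) set" where
  "L2pot P = {V \<in> L2 P. \<forall>\<epsilon>>0. \<exists>U\<in>sob1 P. L2_dist P (grad_D P U) V < \<epsilon>}"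

definition Cb :: "nat \<Rightarrow> (('n::finite) C3 \<Rightarrow> real) set" where
  "Cb k = {f \<in> borel_measurable borel. bounded (range f) \<and>
     (\<forall>h. Ck k (\<lambda>x. f (shift x h))) \<and>
     (\<exists>C. \<forall>h x. \<forall>j\<le>k. dnorm j (\<lambda>y. f (shift y h)) x \<le> C)}"

definition Lhat :: "('n::finite) C3 measure \<Rightarrow> ('n C3 \<Rightarrow> real) \<Rightarrow> 'n C3 \<Rightarrow> real" where
  "Lhat P f h = div_D P (\<lambda>h'. vol 0 h' *\<^sub>R (ginv 0 h' *v grad_D P f h')) h / vol 0 h"

definition self_adjoint_ext ::
  "('n::finite) C3 measure \<Rightarrow> (('n C3 \<Rightarrow> real) \<times> ('n C3 \<Rightarrow> real)) set \<Rightarrow> bool" where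
  "self_adjoint_ext P L \<longleftrightarrow> self_adjoint (piM P) L \<and> (\<forall>f\<in>Cb 2. (f, Lhat P f) \<in> L)"

section \<open>The space \<open>\<H>\<^sub>1\<close>\<close>

text \<open>The completion is realised as the set of equivalence classes of Cauchy sequences.\<close>

definition pre_H1 :: "('n::finite) C3 measure \<Rightarrow> ('n C3 \<Rightarrow> real) set" where
  "pre_H1 P = {\<phi> \<in> Cb 2. (\<integral>h. \<phi> h \<partial>piM P) = 0}"

definition norm1 :: "('n::finite) C3 measure \<Rightarrow> ('n C3 \<Rightarrow> real) \<Rightarrow> real" where
  "norm1 P \<phi> =
     sqrt ((\<integral>h. (grad_D P \<phi> h \<bullet> (ginv 0 h *v grad_D P \<phi> h)) * vol 0 h \<partial>P) / Znorm P)"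

definition cauchy1 :: "('n::finite) C3 measure \<Rightarrow> (nat \<Rightarrow> 'n C3 \<Rightarrow> real) \<Rightarrow> bool" where
  "cauchy1 P u \<longleftrightarrow> range u \<subseteq> pre_H1 P \<and>
     (\<forall>\<epsilon>>0. \<exists>N. \<forall>m\<ge>N. \<forall>n\<ge>N. norm1 P (\<lambda>h. u m h - u n h) < \<epsilon>)"

definition rel1 ::
  "('n::finite) C3 measure \<Rightarrow> ((nat \<Rightarrow> 'n C3 \<Rightarrow> real) \<times> (nat \<Rightarrow> 'n C3 \<Rightarrow> real)) set" where
  "rel1 P = {(u, v). cauchy1 P u \<and> cauchy1 P v \<and>
     (\<lambda>n. norm1 P (\<lambda>h. u n h - v n h)) \<longlonglongrightarrow> 0}"

definition H1 :: "('n::finite) C3 measure \<Rightarrow> (nat \<Rightarrow> 'n C3 \<Rightarrow> real) set set" where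
  "H1 P = Collect (cauchy1 P) // rel1 P"

definition dist1 ::
  "('n::finite) C3 measure \<Rightarrow> (nat \<Rightarrow> 'n C3 \<Rightarrow> real) set \<Rightarrow> (nat \<Rightarrow> 'n C3 \<Rightarrow> real) set \<Rightarrow> real"
  where "dist1 P a b =
     (THE r. \<exists>u\<in>a. \<exists>v\<in>b. (\<lambda>n. norm1 P (\<lambda>h. u n h - v n h)) \<longlonglongrightarrow> r)"

text \<open>The continuous extension of \<open>grad_D\<close> to \<open>\<H>\<^sub>1\<close>; again a representative is chosen.\<close>

definition grad_H1 ::
  "('n::finite) C3 measure \<Rightarrow> (nat \<Rightarrow> 'n C3 \<Rightarrow> real) set \<Rightarrow> 'n C3 \<Rightarrow> real^'n" where
  "grad_H1 P a =
     (SOME W. W \<in> L2 P \<and> (\<exists>u\<in>a. (\<lambda>n. L2_dist P (grad_D P (u n)) W) \<longlonglongrightarrow> 0))"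

text \<open>A function \<open>f \<in> L\<^sup>2(\<pi>)\<close> is identified with the element \<open>a\<close> of \<open>\<H>\<^sub>1\<close> if some sequence
  representing \<open>a\<close> converges to \<open>f\<close> in \<open>L\<^sup>2(\<pi>)\<close>.\<close>

definition represents1 ::
  "('n::finite) C3 measure \<Rightarrow> ('n C3 \<Rightarrow> real) \<Rightarrow> (nat \<Rightarrow> 'n C3 \<Rightarrow> real) set \<Rightarrow> bool" where
  "represents1 P f a \<longleftrightarrow> f \<in> L2 (piM P) \<and> a \<in> H1 P \<and>
     (\<exists>u\<in>a. (\<lambda>n. L2_dist (piM P) (u n) f) \<longlonglongrightarrow> 0)"

definition converges1 ::
  "('n::finite) C3 measure \<Rightarrow> (real \<Rightarrow> 'n C3 \<Rightarrow> real) \<Rightarrow> (nat \<Rightarrow> 'n C3 \<Rightarrow> real) set \<Rightarrow> bool" where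
  "converges1 P f a \<longleftrightarrow> a \<in> H1 P \<and>
     (\<exists>X. (\<forall>l>0. represents1 P (f l) (X l)) \<and> ((\<lambda>l. dist1 P (X l) a) \<longlongrightarrow> 0) (at_right 0))"

section \<open>Correctors and effective diffusion tensor\<close>

definition solves_resolvent ::
  "('n::finite) C3 measure \<Rightarrow> (('n C3 \<Rightarrow> real) \<times> ('n C3 \<Rightarrow> real)) set \<Rightarrow> real \<Rightarrow> real^'n
    \<Rightarrow> ('n C3 \<Rightarrow> real) \<Rightarrow> bool" where
  "solves_resolvent P L l e f \<longleftrightarrow>
     (\<exists>k. (f, k) \<in> L \<and> (AE h in piM P. l * f h - k h = drift 0 h \<bullet> e))"

definition grad_chi ::
  "('n::finite) C3 measure \<Rightarrow> (real^'n \<Rightarrow> (nat \<Rightarrow> 'n C3 \<Rightarrow> real) set) \<Rightarrow> 'n C3 \<Rightarrow> real^'n^'n" where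
  "grad_chi P \<chi>' h = (\<chi> i j. grad_H1 P (\<chi>' (axis i 1)) h $ j)"

definition eff_tensor ::
  "('n::finite) C3 measure \<Rightarrow> (real^'n \<Rightarrow> (nat \<Rightarrow> 'n C3 \<Rightarrow> real) set) \<Rightarrow> real^'n^'n" where
  "eff_tensor P \<chi>' = (1 / Znorm P) *\<^sub>R
     (\<integral>h. vol 0 h *\<^sub>R ((mat 1 + grad_chi P \<chi>' h) ** ginv 0 h
            ** transpose (mat 1 + grad_chi P \<chi>' h)) \<partial>P)"

definition energy ::
  "('n::finite) C3 measure \<Rightarrow> real^'n \<Rightarrow> ('n C3 \<Rightarrow> real^'n) \<Rightarrow> real" where
  "energy P e V = (\<integral>h. ((e + V h) \<bullet> (ginv 0 h *v (e + V h))) * vol 0 h \<partial>P)"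

definition D_upper :: "('n::finite) C3 measure \<Rightarrow> real^'n^'n" where
  "D_upper P = (1 / Znorm P) *\<^sub>R (\<integral>h. vol 0 h *\<^sub>R ginv 0 h \<partial>P)"

definition D_lower :: "('n::finite) C3 measure \<Rightarrow> real^'n^'n" where
  "D_lower P = (1 / Znorm P) *\<^sub>R matrix_inv (\<integral>h. (1 / vol 0 h) *\<^sub>R metric_g 0 h \<partial>P)"

definition pos_def :: "real^'n^'n::finite \<Rightarrow> bool" where
  "pos_def A \<longleftrightarrow> transpose A = A \<and> (\<forall>x. x \<noteq> 0 \<longrightarrow> x \<bullet> (A *v x) > 0)"

end

theory Submission
  imports Defs
begin

text \<open>Testing the resolvent equation with smooth functions and with \<open>\<chi>\<^sub>\<lambda>\<close> itself shows that \<open>\<lambda> \<chi>\<^sub>\<lambda>\<close>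
  tends to zero in \<open>L\<^sup>2\<close>, so in the limit \<open>\<D>\<chi>\<close> satisfies the Euler-Lagrange equation of the energy
  against gradients of \<open>C\<^sub>b\<close> functions; mollifying along the orbits of the translations extends
  this to all potential fields. Since the energy is a strictly convex quadratic functional, the
  equation characterises its unique minimiser, and uniqueness makes \<open>\<D>\<chi>\<close> linear in \<open>e\<close>. The upper
  bounds come from the competitor \<open>V = 0\<close>; the lower bounds come from Legendre duality and the fact
  that potential fields have mean zero.\<close>

section \<open>Square-integrable functions\<close>

text \<open>The corrector equation is available only against gradients of \<open>Cb 2\<close>
  functions, while \<open>L2pot\<close> is the closure of all \<open>sob1\<close> gradients.
  Approximating a \<open>sob1\<close> gradient strongly would call for vector-valued convolutions in
  L^2; instead everything is read off the real functions y \<mapsto> \<integral> W (U o tau_y) dP on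
  R^d, through their continuity and integration by parts in y. The coefficients are bounded only
  almost surely, so they lie outside \<open>Cb\<close>, and the calculus is carried by a class with
  almost sure bounds. The constants come from the rank-one structure of g = I + p p^T, which has no
  eigenvalue other than 1 and |g|: sqrt|g| g^{-1} \<le> sqrt|g| I gives the upper bound 1, and g /
  sqrt|g| \<le> sqrt|g| I, whose mean is Z, gives 1 / Z after duality and 1 / Z^2 after
  normalisation. At lambda > 0 the Euler-Lagrange equation has an error of order sqrt lambda,
  because lambda ||chi_lambda||^2 stays bounded.\<close>

definition L2_norm :: "'a measure \<Rightarrow> ('a \<Rightarrow> 'b::euclidean_space) \<Rightarrow> real" where
  "L2_norm M f = sqrt (\<integral>x. (norm (f x))\<^sup>2 \<partial>M)"

lemma L2_dist_eq_norm: "L2_dist M f g = L2_norm M (\<lambda>x. f x - g x)"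
  by (simp add: L2_dist_def L2_norm_def)

lemma L2I: "f \<in> borel_measurable M \<Longrightarrow> integrable M (\<lambda>x. (norm (f x))\<^sup>2) \<Longrightarrow> f \<in> L2 M"
  by (simp add: L2_def)

lemma L2_measurable: "f \<in> L2 M \<Longrightarrow> f \<in> borel_measurable M"
  by (simp add: L2_def)

lemma L2_integrable_sq: "f \<in> L2 M \<Longrightarrow> integrable M (\<lambda>x. (norm (f x))\<^sup>2)"
  by (simp add: L2_def)

lemma L2_norm_nonneg [simp]: "0 \<le> L2_norm M f"
  by (simp add: L2_norm_def)

lemma L2_dist_nonneg [simp]: "0 \<le> L2_dist M f g"
  by (simp add: L2_dist_def)

lemma L2_norm_sq: "(L2_norm M f)\<^sup>2 = (\<integral>x. f x \<bullet> f x \<partial>M)"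
  by (simp add: L2_norm_def flip: power2_norm_eq_inner)

text \<open>Source of nearly all later membership claims and operator bounds. The sign condition
  comes with the norm estimate, whose square root turns C^2 into |C|.\<close>

lemma L2_dominated:
  fixes f :: "'a \<Rightarrow> 'b::euclidean_space" and g :: "'a \<Rightarrow> 'c::euclidean_space"
  assumes "f \<in> borel_measurable M" "g \<in> L2 M" "AE x in M. norm (f x) \<le> C * norm (g x)"
  shows "f \<in> L2 M" "0 \<le> C \<Longrightarrow> L2_norm M f \<le> C * L2_norm M g"
proof -
  have le: "AE x in M. (norm (f x))\<^sup>2 \<le> C\<^sup>2 * (norm (g x))\<^sup>2"
    using assms(3) by eventually_elim (metis norm_ge_zero power_mono power_mult_distrib)
  have int: "integrable M (\<lambda>x. C\<^sup>2 * (norm (g x))\<^sup>2)"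
    using assms(2) by (auto intro: L2_integrable_sq)
  show L: "f \<in> L2 M"
    using le assms(1) by (intro L2I Bochner_Integration.integrable_bound[OF int]) auto
  have "(\<integral>x. (norm (f x))\<^sup>2 \<partial>M) \<le> (\<integral>x. C\<^sup>2 * (norm (g x))\<^sup>2 \<partial>M)"
    by (intro integral_mono_AE L2_integrable_sq L int le)
  then show "L2_norm M f \<le> C * L2_norm M g" if "0 \<le> C"
    unfolding L2_norm_def using that
    by (metis integral_mult_right_zero real_sqrt_abs real_sqrt_le_mono real_sqrt_mult abs_of_nonneg)
qed

lemma L2_zero [simp]: "(\<lambda>_. 0) \<in> L2 M"
  by (simp add: L2_def)

lemma L2_scaleR: "f \<in> L2 M \<Longrightarrow> (\<lambda>x. c *\<^sub>R f x) \<in> L2 M"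
  by (rule L2_dominated(1)[where g = f and C = "\<bar>c\<bar>"]) (auto dest: L2_measurable)

lemma L2_mult_const: "f \<in> L2 M \<Longrightarrow> (\<lambda>x. c * f x) \<in> L2 M" for f :: "'a \<Rightarrow> real"
  using L2_scaleR[of f M c] by simp

lemma L2_add:
  assumes "f \<in> L2 M" "g \<in> L2 M"
  shows "(\<lambda>x. f x + g x) \<in> L2 M"
proof (rule L2I)
  note [measurable] = assms[THEN L2_measurable]
  show "(\<lambda>x. f x + g x) \<in> borel_measurable M" by simp
  show "integrable M (\<lambda>x. (norm (f x + g x))\<^sup>2)"
  proof (rule Bochner_Integration.integrable_bound)
    show "integrable M (\<lambda>x. 2 * (norm (f x))\<^sup>2 + 2 * (norm (g x))\<^sup>2)"
      by (intro Bochner_Integration.integrable_add integrable_mult_right L2_integrable_sq assms)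
    have "(norm (f x + g x))\<^sup>2 \<le> 2 * (norm (f x))\<^sup>2 + 2 * (norm (g x))\<^sup>2" for x
    proof -
      have "(norm (f x + g x))\<^sup>2 \<le> (norm (f x) + norm (g x))\<^sup>2"
        by (intro power_mono norm_triangle_ineq) auto
      also have "\<dots> \<le> 2 * (norm (f x))\<^sup>2 + 2 * (norm (g x))\<^sup>2"
        using sum_squares_bound[of "norm (f x)" "norm (g x)"]
        by (simp add: power2_sum)
      finally show ?thesis .
    qed
    then show "AE x in M. norm ((norm (f x + g x))\<^sup>2)
        \<le> norm (2 * (norm (f x))\<^sup>2 + 2 * (norm (g x))\<^sup>2)" by simp
  qed simp
qed

lemma L2_minus: "f \<in> L2 M \<Longrightarrow> (\<lambda>x. - f x) \<in> L2 M"
  using L2_scaleR[of f M "-1"] by simp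

lemma L2_diff: "f \<in> L2 M \<Longrightarrow> g \<in> L2 M \<Longrightarrow> (\<lambda>x. f x - g x) \<in> L2 M"
  using L2_add[of f M "\<lambda>x. - g x"] L2_minus[of g M] by simp

lemma L2_sum: "(\<And>i. i \<in> I \<Longrightarrow> f i \<in> L2 M) \<Longrightarrow> (\<lambda>x. \<Sum>i\<in>I. f i x) \<in> L2 M"
  by (induction I rule: infinite_finite_induct) (auto intro: L2_add)

lemma (in finite_measure) L2_const [simp]: "(\<lambda>_. c) \<in> L2 M"
  by (simp add: L2_def)

lemma (in finite_measure) L2_bounded:
  assumes "f \<in> borel_measurable M" "AE x in M. norm (f x) \<le> C"
  shows "f \<in> L2 M"
  by (rule L2_dominated(1)[where g = "\<lambda>_. 1::real" and C = C]) (use assms in auto)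

lemma L2_norm_minus: "L2_norm M (\<lambda>x. - f x) = L2_norm M f"
  by (simp add: L2_norm_def)

lemma L2_dist_commute: "L2_dist M f g = L2_dist M g f"
  by (simp add: L2_dist_def norm_minus_commute)

lemma L2_integrable_inner:
  assumes "f \<in> L2 M" "g \<in> L2 M"
  shows "integrable M (\<lambda>x. f x \<bullet> g x)"
proof (rule Bochner_Integration.integrable_bound)
  note [measurable] = assms[THEN L2_measurable]
  show "integrable M (\<lambda>x. (norm (f x))\<^sup>2 + (norm (g x))\<^sup>2)"
    by (intro Bochner_Integration.integrable_add L2_integrable_sq assms)
  have "\<bar>f x \<bullet> g x\<bar> \<le> (norm (f x))\<^sup>2 + (norm (g x))\<^sup>2" for x
  proof -
    have "\<bar>f x \<bullet> g x\<bar> \<le> norm (f x) * norm (g x)" by (rule Cauchy_Schwarz_ineq2)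
    also have "\<dots> \<le> 2 * norm (f x) * norm (g x)" by simp
    also have "\<dots> \<le> (norm (f x))\<^sup>2 + (norm (g x))\<^sup>2" by (rule sum_squares_bound)
    finally show ?thesis .
  qed
  then show "AE x in M. norm (f x \<bullet> g x) \<le> norm ((norm (f x))\<^sup>2 + (norm (g x))\<^sup>2)" by simp
  show "(\<lambda>x. f x \<bullet> g x) \<in> borel_measurable M" by simp
qed

lemma L2_integrable_mult:
  fixes f g :: "'a \<Rightarrow> real"
  shows "f \<in> L2 M \<Longrightarrow> g \<in> L2 M \<Longrightarrow> integrable M (\<lambda>x. f x * g x)"
  using L2_integrable_inner[of f M g] by simp

lemma L2_norm_fun:
  assumes "f \<in> L2 M"
  shows "(\<lambda>x. norm (f x)) \<in> L2 M"
  using L2_measurable[OF assms] by (intro L2_dominated(1)[OF _ assms, where C = 1]) auto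

lemma (in finite_measure) L2_integrable: "f \<in> L2 M \<Longrightarrow> integrable M f"
proof (rule integrable_norm_cancel)
  assume "f \<in> L2 M"
  then have "(\<lambda>x. norm (f x)) \<in> L2 M" by (rule L2_norm_fun)
  from L2_integrable_mult[OF this L2_const[of 1]] show "integrable M (\<lambda>x. norm (f x))" by simp
qed (rule L2_measurable)

text \<open>The quadratic t \<mapsto> ||f - t g||^2 is never negative, which is a condition on its
  discriminant.\<close>

lemma L2_Cauchy_Schwarz:
  assumes "f \<in> L2 M" "g \<in> L2 M"
  shows "\<bar>\<integral>x. f x \<bullet> g x \<partial>M\<bar> \<le> L2_norm M f * L2_norm M g"
proof -
  define a b c where "a = (\<integral>x. f x \<bullet> f x \<partial>M)" and "b = (\<integral>x. f x \<bullet> g x \<partial>M)"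
    and "c = (\<integral>x. g x \<bullet> g x \<partial>M)"
  note int = L2_integrable_inner[OF assms(1,1)] L2_integrable_inner[OF assms(1,2)]
    L2_integrable_inner[OF assms(2,2)]
  have a: "0 \<le> a" and c: "0 \<le> c" unfolding a_def c_def by simp_all
  have q: "0 \<le> a - 2 * t * b + t\<^sup>2 * c" for t
  proof -
    have "0 \<le> (\<integral>x. (f x - t *\<^sub>R g x) \<bullet> (f x - t *\<^sub>R g x) \<partial>M)" by simp
    also have "\<dots> = (\<integral>x. f x \<bullet> f x - (2 * t) * (f x \<bullet> g x) + t\<^sup>2 * (g x \<bullet> g x) \<partial>M)"
      by (intro Bochner_Integration.integral_cong refl)
        (simp add: inner_diff_left inner_diff_right power2_eq_square inner_commute)
    also have "\<dots> = a - 2 * t * b + t\<^sup>2 * c"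
      unfolding a_def b_def c_def using int by simp
    finally show ?thesis .
  qed
  have "b\<^sup>2 \<le> a * c"
  proof (cases "c = 0")
    case True
    have "b = 0"
    proof (rule ccontr)
      assume "b \<noteq> 0"
      \<comment> \<open>With c = 0 the quadratic is affine in t, and this t gives it the value
        -1.\<close>
      with q[of "(a + 1) / (2 * b)"] True show False by (simp add: field_simps)
    qed
    then show ?thesis using True by simp
  next
    case False
    with c have "c > 0" by simp
    \<comment> \<open>The minimiser of the quadratic.\<close>
    with q[of "b / c"] show ?thesis by (simp add: field_simps power2_eq_square)
  qed
  then have "\<bar>b\<bar> \<le> sqrt (a * c)" using real_sqrt_le_mono by fastforce
  then show ?thesis
    by (simp add: L2_norm_def a_def b_def c_def real_sqrt_mult power2_norm_eq_inner)
qed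

lemma L2_norm_triangle:
  assumes "f \<in> L2 M" "g \<in> L2 M"
  shows "L2_norm M (\<lambda>x. f x + g x) \<le> L2_norm M f + L2_norm M g"
proof (rule power2_le_imp_le)
  note int = L2_integrable_inner[OF assms(1,1)] L2_integrable_inner[OF assms(1,2)]
    L2_integrable_inner[OF assms(2,2)]
  have "(L2_norm M (\<lambda>x. f x + g x))\<^sup>2
      = (\<integral>x. f x \<bullet> f x + 2 * (f x \<bullet> g x) + g x \<bullet> g x \<partial>M)"
    unfolding L2_norm_sq by (intro Bochner_Integration.integral_cong refl)
      (simp add: inner_add_left inner_add_right inner_commute)
  also have "\<dots> = (L2_norm M f)\<^sup>2 + 2 * (\<integral>x. f x \<bullet> g x \<partial>M) + (L2_norm M g)\<^sup>2"
    unfolding L2_norm_sq using int by simp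
  also have "\<dots> \<le> (L2_norm M f)\<^sup>2 + 2 * (L2_norm M f * L2_norm M g) + (L2_norm M g)\<^sup>2"
    using L2_Cauchy_Schwarz[OF assms] by linarith
  finally show "(L2_norm M (\<lambda>x. f x + g x))\<^sup>2 \<le> (L2_norm M f + L2_norm M g)\<^sup>2"
    by (simp add: power2_sum)
qed simp

lemma L2_dist_triangle:
  assumes "f \<in> L2 M" "g \<in> L2 M" "h \<in> L2 M"
  shows "L2_dist M f h \<le> L2_dist M f g + L2_dist M g h"
  using L2_norm_triangle[of "\<lambda>x. f x - g x" M "\<lambda>x. g x - h x"] assms
  by (simp add: L2_dist_eq_norm L2_diff)

lemma L2_dist_add:
  assumes "f \<in> L2 M" "g \<in> L2 M" "f' \<in> L2 M" "g' \<in> L2 M"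
  shows "L2_dist M (\<lambda>x. f x + g x) (\<lambda>x. f' x + g' x) \<le> L2_dist M f f' + L2_dist M g g'"
  using L2_norm_triangle[of "\<lambda>x. f x - f' x" M "\<lambda>x. g x - g' x"] assms
  by (simp add: L2_dist_eq_norm L2_diff algebra_simps)

lemma L2_dist_scaleR: "L2_dist M (\<lambda>x. c *\<^sub>R f x) (\<lambda>x. c *\<^sub>R g x) = \<bar>c\<bar> * L2_dist M f g"
  by (simp add: L2_dist_def power_mult_distrib real_sqrt_mult flip: scaleR_diff_right)

lemma L2_dist_0_iff:
  assumes "f \<in> L2 M" "g \<in> L2 M"
  shows "L2_dist M f g = 0 \<longleftrightarrow> (AE x in M. f x = g x)"
proof -
  have "L2_dist M f g = 0 \<longleftrightarrow> (\<integral>x. (norm (f x - g x))\<^sup>2 \<partial>M) = 0"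
    by (simp add: L2_dist_def)
  also have "\<dots> \<longleftrightarrow> (AE x in M. (norm (f x - g x))\<^sup>2 = 0)"
    by (rule integral_nonneg_eq_0_iff_AE[OF L2_integrable_sq[OF L2_diff[OF assms]]]) simp
  finally show ?thesis by simp
qed

lemma L2_dist_cong_AE:
  assumes "f \<in> borel_measurable M" "f' \<in> borel_measurable M"
    "g \<in> borel_measurable M" "g' \<in> borel_measurable M"
    "AE x in M. f x = f' x" "AE x in M. g x = g' x"
  shows "L2_dist M f g = L2_dist M f' g'"
proof -
  have "AE x in M. (norm (f x - g x))\<^sup>2 = (norm (f' x - g' x))\<^sup>2"
    using assms(5,6) by eventually_elim simp
  then show ?thesis
    unfolding L2_dist_def using assms(1-4)
    by (intro arg_cong[where f = sqrt] integral_cong_AE) simp_all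
qed

lemma L2_cong_AE:
  assumes "f \<in> L2 M" "g \<in> borel_measurable M" "AE x in M. f x = g x"
  shows "g \<in> L2 M"
  by (rule L2_dominated(1)[where g = f and C = 1]) (use assms in auto)

lemma L2_limit_unique:
  assumes "F \<noteq> bot" "\<And>n. f n \<in> L2 M" "g \<in> L2 M" "g' \<in> L2 M"
    "((\<lambda>n. L2_dist M (f n) g) \<longlongrightarrow> 0) F" "((\<lambda>n. L2_dist M (f n) g') \<longlongrightarrow> 0) F"
  shows "AE x in M. g x = g' x"
proof -
  have lim: "((\<lambda>n. L2_dist M (f n) g + L2_dist M (f n) g') \<longlongrightarrow> 0 + 0) F"
    by (intro tendsto_add assms)
  have le: "L2_dist M g g' \<le> L2_dist M (f n) g + L2_dist M (f n) g'" for n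
    using L2_dist_triangle[OF assms(3) assms(2)[of n] assms(4)] by (simp add: L2_dist_commute)
  have "L2_dist M g g' \<le> 0 + 0"
    by (rule tendsto_lowerbound[OF lim always_eventually assms(1)]) (simp add: le)
  then have "L2_dist M g g' = 0" using L2_dist_nonneg[of M g g'] by simp
  then show ?thesis using L2_dist_0_iff assms(3,4) by blast
qed

text \<open>The difference of products splits as (f_n - f0) . g_n + f0 . (g_n - g0). The filter is
  arbitrary because the limit is taken both along sequences and along increments t -> 0.\<close>

lemma L2_tendsto_inner:
  assumes f: "\<And>n. f n \<in> L2 M" "f0 \<in> L2 M" "((\<lambda>n. L2_dist M (f n) f0) \<longlongrightarrow> 0) F"
    and g: "\<And>n. g n \<in> L2 M" "g0 \<in> L2 M" "((\<lambda>n. L2_dist M (g n) g0) \<longlongrightarrow> 0) F"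
  shows "((\<lambda>n. \<integral>x. f n x \<bullet> g n x \<partial>M) \<longlongrightarrow> (\<integral>x. f0 x \<bullet> g0 x \<partial>M)) F"
proof -
  have "\<bar>(\<integral>x. f n x \<bullet> g n x \<partial>M) - (\<integral>x. f0 x \<bullet> g0 x \<partial>M)\<bar>
      \<le> L2_dist M (f n) f0 * (L2_dist M (g n) g0 + L2_norm M g0)
        + L2_norm M f0 * L2_dist M (g n) g0" for n
  proof -
    have d: "(\<lambda>x. f n x - f0 x) \<in> L2 M" "(\<lambda>x. g n x - g0 x) \<in> L2 M"
      using f g by (auto intro: L2_diff)
    note int = L2_integrable_inner[OF f(1)[of n] g(1)[of n]] L2_integrable_inner[OF f(2) g(2)]
      L2_integrable_inner[OF d(1) g(1)[of n]] L2_integrable_inner[OF f(2) d(2)]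
    have "(\<integral>x. f n x \<bullet> g n x \<partial>M) - (\<integral>x. f0 x \<bullet> g0 x \<partial>M)
        = (\<integral>x. f n x \<bullet> g n x - f0 x \<bullet> g0 x \<partial>M)" using int by simp
    also have "\<dots> = (\<integral>x. (f n x - f0 x) \<bullet> g n x + f0 x \<bullet> (g n x - g0 x) \<partial>M)"
      by (intro Bochner_Integration.integral_cong refl) (simp add: inner_diff_left inner_diff_right)
    also have "\<dots> = (\<integral>x. (f n x - f0 x) \<bullet> g n x \<partial>M) + (\<integral>x. f0 x \<bullet> (g n x - g0 x) \<partial>M)"
      using int by simp
    finally have "\<bar>(\<integral>x. f n x \<bullet> g n x \<partial>M) - (\<integral>x. f0 x \<bullet> g0 x \<partial>M)\<bar>
        \<le> L2_dist M (f n) f0 * L2_norm M (g n) + L2_norm M f0 * L2_dist M (g n) g0"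
      using L2_Cauchy_Schwarz[OF d(1) g(1)[of n]] L2_Cauchy_Schwarz[OF f(2) d(2)]
      unfolding L2_dist_eq_norm by linarith
    moreover have "L2_norm M (g n) \<le> L2_dist M (g n) g0 + L2_norm M g0"
      using L2_norm_triangle[OF d(2) g(2)] by (simp add: L2_dist_eq_norm)
    then have "L2_dist M (f n) f0 * L2_norm M (g n)
        \<le> L2_dist M (f n) f0 * (L2_dist M (g n) g0 + L2_norm M g0)"
      by (rule mult_left_mono) simp
    ultimately show ?thesis by linarith
  qed
  note le = this
  have "((\<lambda>n. L2_dist M (f n) f0 * (L2_dist M (g n) g0 + L2_norm M g0)
        + L2_norm M f0 * L2_dist M (g n) g0) \<longlongrightarrow> 0 * (0 + L2_norm M g0) + L2_norm M f0 * 0) F"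
    by (intro tendsto_add tendsto_mult tendsto_const f(3) g(3))
  then have lim: "((\<lambda>n. L2_dist M (f n) f0 * (L2_dist M (g n) g0 + L2_norm M g0)
        + L2_norm M f0 * L2_dist M (g n) g0) \<longlongrightarrow> 0) F" by simp
  have "((\<lambda>n. (\<integral>x. f n x \<bullet> g n x \<partial>M) - (\<integral>x. f0 x \<bullet> g0 x \<partial>M)) \<longlongrightarrow> 0) F"
    by (rule Lim_null_comparison[OF always_eventually lim]) (simp only: real_norm_def le simp_thms)
  then show ?thesis by (rule LIM_zero_cancel)
qed

lemma L2_tendsto_inner_left:
  assumes "\<And>n. f n \<in> L2 M" "f0 \<in> L2 M" "((\<lambda>n. L2_dist M (f n) f0) \<longlongrightarrow> 0) F" "g \<in> L2 M"
  shows "((\<lambda>n. \<integral>x. f n x \<bullet> g x \<partial>M) \<longlongrightarrow> (\<integral>x. f0 x \<bullet> g x \<partial>M)) F"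
  by (rule L2_tendsto_inner[OF assms(1-3), where g = "\<lambda>_. g"])
    (use assms(4) in \<open>simp_all add: L2_dist_def\<close>)

text \<open>Riesz-Fischer. On a finite measure space an L^2 Cauchy sequence is L^1 Cauchy, which
  yields an almost everywhere convergent subsequence; Fatou's lemma then makes its limit the L^2
  limit of the whole sequence.\<close>

lemma (in finite_measure) L2_complete:
  fixes s :: "nat \<Rightarrow> 'a \<Rightarrow> 'b::euclidean_space"
  assumes s: "\<And>n. s n \<in> L2 M"
    and cauchy: "\<And>e. e > 0 \<Longrightarrow> \<exists>N. \<forall>i\<ge>N. \<forall>j\<ge>N. L2_dist M (s i) (s j) < e"
  shows "\<exists>f\<in>L2 M. (\<lambda>n. L2_dist M (s n) f) \<longlonglongrightarrow> 0"
proof -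
  note [measurable] = s[THEN L2_measurable]
  have L1: "(\<integral>x. norm (f x) \<partial>M) \<le> L2_norm M f * L2_norm M (\<lambda>_. 1::real)"
    if "f \<in> L2 M" for f :: "'a \<Rightarrow> 'b"
  proof -
    have nf: "(\<lambda>x. norm (f x)) \<in> L2 M" by (rule L2_norm_fun[OF that])
    show ?thesis using L2_Cauchy_Schwarz[OF nf L2_const[of 1]] by (simp add: L2_norm_def)
  qed
  \<comment> \<open>Adding 1 keeps the divisor positive even when M is the zero measure.\<close>
  define K where "K = L2_norm M (\<lambda>_. 1::real) + 1"
  have K: "K > 0" "L2_norm M (\<lambda>_. 1::real) \<le> K" unfolding K_def
    by (simp_all add: add_nonneg_pos)
  obtain r where r: "strict_mono r" "AE x in M. Cauchy (\<lambda>i. s (r i) x)"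
  proof (rule cauchy_L1_AE_cauchy_subseq)
    show "integrable M (s n)" for n by (rule L2_integrable[OF s])
    fix e :: real assume "e > 0"
    then obtain N where N: "\<forall>i\<ge>N. \<forall>j\<ge>N. L2_dist M (s i) (s j) < e / K"
      using cauchy[of "e / K"] K by auto
    have "(\<integral>x. norm (s i x - s j x) \<partial>M) < e" if "i \<ge> N" "j \<ge> N" for i j
    proof -
      have "(\<integral>x. norm (s i x - s j x) \<partial>M) \<le> L2_dist M (s i) (s j) * L2_norm M (\<lambda>_. 1::real)"
        unfolding L2_dist_eq_norm by (rule L1[OF L2_diff[OF s s]])
      also have "\<dots> \<le> L2_dist M (s i) (s j) * K"
        by (intro mult_left_mono K) simp
      also have "\<dots> < e" using N that K by (simp add: pos_less_divide_eq)
      finally show ?thesis .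
    qed
    then show "\<exists>N. \<forall>i\<ge>N. \<forall>j\<ge>N. (\<integral>x. norm (s i x - s j x) \<partial>M) < e" by blast
  qed blast
  define f where "f x = lim (\<lambda>i. s (r i) x)" for x
  have [measurable]: "f \<in> borel_measurable M"
    unfolding f_def by (rule borel_measurable_lim_metric) simp
  have lim: "AE x in M. (\<lambda>i. s (r i) x) \<longlonglongrightarrow> f x"
    using r(2) unfolding f_def by eventually_elim (simp add: Cauchy_convergent_iff convergent_LIMSEQ_iff)
  \<comment> \<open>Fatou is applied along the subsequence in the second argument only. As r k \<ge>
    N once k \<ge> N, the estimate holds for every n \<ge> N of the full sequence.\<close>
  have bound: "integrable M (\<lambda>x. (norm (s n x - f x))\<^sup>2) \<and> L2_dist M (s n) f \<le> e"
    if "e > 0" and N: "\<forall>i\<ge>N. \<forall>j\<ge>N. L2_dist M (s i) (s j) < e" and "n \<ge> N" for e N n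
  proof -
    have "(\<integral>\<^sup>+x. ennreal ((norm (s n x - f x))\<^sup>2) \<partial>M)
        = (\<integral>\<^sup>+x. liminf (\<lambda>k. ennreal ((norm (s n x - s (r k) x))\<^sup>2)) \<partial>M)"
    proof (rule nn_integral_cong_AE)
      show "AE x in M. ennreal ((norm (s n x - f x))\<^sup>2)
          = liminf (\<lambda>k. ennreal ((norm (s n x - s (r k) x))\<^sup>2))"
        using lim
      proof eventually_elim
        case (elim x)
        have "(\<lambda>k. ennreal ((norm (s n x - s (r k) x))\<^sup>2)) \<longlonglongrightarrow> ennreal ((norm (s n x - f x))\<^sup>2)"
          by (intro tendsto_intros tendsto_ennrealI elim)
        then show ?case by (rule lim_imp_Liminf[OF trivial_limit_sequentially, symmetric])
      qed
    qed
    also have "\<dots> \<le> liminf (\<lambda>k. \<integral>\<^sup>+x. ennreal ((norm (s n x - s (r k) x))\<^sup>2) \<partial>M)"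
      by (rule nn_integral_liminf) simp
    also have "\<dots> \<le> liminf (\<lambda>k::nat. ennreal (e\<^sup>2))"
    proof (rule Liminf_mono, rule eventually_sequentiallyI)
      fix k assume "k \<ge> N"
      then have "r k \<ge> N" using seq_suble[OF r(1), of k] by linarith
      then have *: "L2_dist M (s n) (s (r k)) < e" using N \<open>n \<ge> N\<close> by blast
      have "(\<integral>\<^sup>+x. ennreal ((norm (s n x - s (r k) x))\<^sup>2) \<partial>M)
          = ennreal (\<integral>x. (norm (s n x - s (r k) x))\<^sup>2 \<partial>M)"
        by (intro nn_integral_eq_integral L2_integrable_sq L2_diff s) simp
      also have "(\<integral>x. (norm (s n x - s (r k) x))\<^sup>2 \<partial>M) = (L2_dist M (s n) (s (r k)))\<^sup>2"
        by (simp add: L2_dist_def)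
      also have "ennreal \<dots> \<le> ennreal (e\<^sup>2)"
        using * by (intro ennreal_leI power_mono) auto
      finally show "(\<integral>\<^sup>+x. ennreal ((norm (s n x - s (r k) x))\<^sup>2) \<partial>M) \<le> ennreal (e\<^sup>2)" .
    qed
    also have "\<dots> = ennreal (e\<^sup>2)" by (simp add: Liminf_const)
    finally have le: "(\<integral>\<^sup>+x. ennreal ((norm (s n x - f x))\<^sup>2) \<partial>M) \<le> ennreal (e\<^sup>2)" .
    have int: "integrable M (\<lambda>x. (norm (s n x - f x))\<^sup>2)"
      using le by (intro integrableI_bounded) (auto simp: order_le_less_trans)
    moreover have "(\<integral>x. (norm (s n x - f x))\<^sup>2 \<partial>M) \<le> e\<^sup>2"
      using le nn_integral_eq_integral[OF int] by (simp add: ennreal_le_iff)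
    then have "L2_dist M (s n) f \<le> e" unfolding L2_dist_def
      using \<open>e > 0\<close> real_le_lsqrt by fastforce
    ultimately show ?thesis by blast
  qed
  show ?thesis
  proof (rule bexI)
    obtain N where N: "\<forall>i\<ge>N. \<forall>j\<ge>N. L2_dist M (s i) (s j) < 1" using cauchy[of 1] by auto
    \<comment> \<open>f is recovered as s N minus the square-integrable difference s N - f.\<close>
    have "(\<lambda>x. s N x - f x) \<in> L2 M" using bound[OF _ N, of N] by (auto intro!: L2I)
    from L2_diff[OF s[of N] this] show "f \<in> L2 M" by simp
    show "(\<lambda>n. L2_dist M (s n) f) \<longlonglongrightarrow> 0"
    proof (rule LIMSEQ_I)
      fix e :: real assume e: "e > 0"
      then obtain N where N: "\<forall>i\<ge>N. \<forall>j\<ge>N. L2_dist M (s i) (s j) < e / 2"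
        using cauchy[of "e / 2"] by auto
      have "norm (L2_dist M (s n) f - 0) < e" if "n \<ge> N" for n
        using bound[OF _ N that] e by simp
      then show "\<exists>N. \<forall>n\<ge>N. norm (L2_dist M (s n) f - 0) < e" by blast
    qed
  qed
qed

section \<open>Approximation by bounded functions\<close>

definition trunc :: "nat \<Rightarrow> real \<Rightarrow> real" where
  "trunc n r = max (- real n) (min (real n) r)"

lemma trunc_bound: "\<bar>trunc n r\<bar> \<le> real n" "\<bar>trunc n r - r\<bar> \<le> \<bar>r\<bar>"
  by (auto simp: trunc_def)

lemma trunc_measurable [measurable]: "trunc n \<in> borel_measurable borel"
  unfolding trunc_def[abs_def] by simp

text \<open>Supplies bounded substitutes in two places: for W in the continuity of correlations, and
  for U before mollification. At each point the clamped value eventually equals f x, and |f|^2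
  dominates the squared error.\<close>

lemma trunc_L2:
  assumes f: "f \<in> L2 M"
  shows "(\<lambda>x. trunc n (f x)) \<in> L2 M" "(\<lambda>n. L2_dist M (\<lambda>x. trunc n (f x)) f) \<longlonglongrightarrow> 0"
proof -
  note [measurable] = L2_measurable[OF f]
  show "(\<lambda>x. trunc n (f x)) \<in> L2 M"
    by (rule L2_dominated(1)[OF _ f, where C = 1]) (auto simp: trunc_def)
  have "(\<lambda>n. \<integral>x. (norm (trunc n (f x) - f x))\<^sup>2 \<partial>M) \<longlonglongrightarrow> (\<integral>x. 0 \<partial>M)"
  proof (rule integral_dominated_convergence[where w = "\<lambda>x. (norm (f x))\<^sup>2"])
    show "integrable M (\<lambda>x. (norm (f x))\<^sup>2)" by (rule L2_integrable_sq[OF f])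
    have "(\<lambda>n. (norm (trunc n (f x) - f x))\<^sup>2) \<longlonglongrightarrow> 0" for x
    proof (rule tendsto_eventually)
      obtain N where "\<bar>f x\<bar> \<le> real N" using real_arch_simple by blast
      then have "(norm (trunc n (f x) - f x))\<^sup>2 = 0" if "n \<ge> N" for n
        using that by (auto simp: trunc_def)
      then show "\<forall>\<^sub>F n in sequentially. (norm (trunc n (f x) - f x))\<^sup>2 = 0"
        by (rule eventually_sequentiallyI)
    qed
    then show "AE x in M. (\<lambda>n. (norm (trunc n (f x) - f x))\<^sup>2) \<longlonglongrightarrow> 0" by simp
    show "AE x in M. norm ((norm (trunc n (f x) - f x))\<^sup>2) \<le> (norm (f x))\<^sup>2" for n
      using trunc_bound(2)[of n] by (auto simp flip: abs_le_square_iff)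
  qed auto
  then show "(\<lambda>n. L2_dist M (\<lambda>x. trunc n (f x)) f) \<longlonglongrightarrow> 0"
    unfolding L2_dist_def using tendsto_real_sqrt by fastforce
qed

section \<open>Translations of \<open>\<Omega>\<close>\<close>

lemma app_shift: "app (shift x h) = (\<lambda>y. app h (y + x))"
  by transfer simp

lemma shift_shift: "shift x (shift y h) = shift (x + y) h"
  by (simp add: app_shift add.assoc flip: app_inject)

lemma shift_0 [simp]: "shift 0 h = h"
  by (simp add: app_shift flip: app_inject)

lemma pd_shift:
  assumes "f differentiable (at (x + a))"
  shows "pd i (\<lambda>y. f (y + a)) x = pd i f (x + a)"
  using assms by (simp add: pd_def frechet_derivative_shift)

lemma Ck_differentiable: "Ck k f \<Longrightarrow> 1 \<le> k \<Longrightarrow> f differentiable (at x)"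
  by (cases k) auto

lemma dnorm_translate: "Ck k f \<Longrightarrow> dnorm k (\<lambda>y. f (y + a)) x = dnorm k f (x + a)"
proof (induction k arbitrary: f)
  case (Suc k)
  have "pd i (\<lambda>y. f (y + a)) = (\<lambda>y. pd i f (y + a))" for i
    using Suc.prems by (auto simp: pd_shift)
  then show ?case using Suc by simp
qed simp

lemma C3_seminorm_translate:
  assumes "Ck 3 f" "real N + norm a \<le> real M"
  shows "C3_seminorm N (\<lambda>y. f (y + a)) \<le> C3_seminorm M f"
  unfolding C3_seminorm_def[of N]
proof (rule cSUP_least)
  fix x :: "real^'a" assume "x \<in> cball 0 (real N)"
  then have "norm (x + a) \<le> real M" using assms(2) norm_triangle_ineq[of x a] by simp
  from C3_seminorm_upper[OF assms(1) this]
  show "(\<Sum>k\<le>3. dnorm k (\<lambda>y. f (y + a)) x) \<le> C3_seminorm M f"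
    using assms(1) by (simp add: dnorm_translate Ck_mono)
qed simp

text \<open>The weights bound a single term by the distance in one direction; in the other they
  dominate the series uniformly in t, so that limit and sum may be exchanged (Tannery's theorem).
  Continuity on Omega is later reduced to seminorms by this equivalence.\<close>

lemma tendsto_C3_iff:
  fixes f :: "'b \<Rightarrow> ('n::finite) C3"
  assumes "F \<noteq> bot"
  shows "(f \<longlongrightarrow> g) F \<longleftrightarrow> (\<forall>N. ((\<lambda>t. C3_seminorm N (\<lambda>x. app (f t) x - app g x)) \<longlongrightarrow> 0) F)"
proof
  have nn: "0 \<le> C3_seminorm N (\<lambda>x. app (f t) x - app g x)" for N t
    by (intro C3_seminorm_nonneg Ck_diff Ck_app)
  have summ: "summable (\<lambda>N. (1/2)^N * min 1 (C3_seminorm N (\<lambda>x. app (f t) x - app g x)))" for t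
    by (rule summable_comparison_test'[of "\<lambda>N. (1/2::real)^N" 0])
      (auto simp: summable_geometric nn)
  {
    assume *: "(f \<longlongrightarrow> g) F"
    show "\<forall>N. ((\<lambda>t. C3_seminorm N (\<lambda>x. app (f t) x - app g x)) \<longlongrightarrow> 0) F"
    proof
      fix N
      have le: "(1/2)^N * min 1 (C3_seminorm N (\<lambda>x. app (f t) x - app g x)) \<le> dist (f t) g" for t
      proof -
        have "(\<Sum>N\<in>{N}. (1/2)^N * min 1 (C3_seminorm N (\<lambda>x. app (f t) x - app g x))) \<le> dist (f t) g"
          unfolding dist_C3_def by (rule sum_le_suminf[OF summ]) (auto simp: nn)
        then show ?thesis by simp
      qed
      show "((\<lambda>t. C3_seminorm N (\<lambda>x. app (f t) x - app g x)) \<longlongrightarrow> 0) F"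
      proof (rule tendstoI)
        fix e :: real assume e: "e > 0"
        \<comment> \<open>This radius undoes both the weight and the truncation at 1 in the N-th
          term of the metric.\<close>
        have "\<forall>\<^sub>F t in F. dist (f t) g < (1/2)^N * min 1 e"
          using * e by (intro tendstoD) auto
        then show "\<forall>\<^sub>F t in F. dist (C3_seminorm N (\<lambda>x. app (f t) x - app g x)) 0 < e"
        proof eventually_elim
          case (elim t)
          with le[of t] have "(1/2)^N * min 1 (C3_seminorm N (\<lambda>x. app (f t) x - app g x))
              < (1/2)^N * min 1 e" by linarith
          then have "min 1 (C3_seminorm N (\<lambda>x. app (f t) x - app g x)) < min 1 e" by simp
          then show ?case using nn[of N t] by auto
        qed
      qed
    qed
  next
    assume *: "\<forall>N. ((\<lambda>t. C3_seminorm N (\<lambda>x. app (f t) x - app g x)) \<longlongrightarrow> 0) F"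
    have "((\<lambda>t. \<Sum>N. (1/2)^N * min 1 (C3_seminorm N (\<lambda>x. app (f t) x - app g x))) \<longlongrightarrow> (\<Sum>N. 0)) F"
    proof (rule conjunct2[OF conjunct2[OF tannerys_theorem[where M = "\<lambda>N. (1/2)^N"]]])
      show "((\<lambda>t. (1/2)^N * min 1 (C3_seminorm N (\<lambda>x. app (f t) x - app g x))) \<longlongrightarrow> 0) F" for N
      proof -
        have "((\<lambda>t. (1/2)^N * min 1 (C3_seminorm N (\<lambda>x. app (f t) x - app g x)))
            \<longlongrightarrow> (1/2)^N * min 1 0) F"
          using * by (intro tendsto_mult tendsto_min tendsto_const) auto
        then show ?thesis by simp
      qed
      show "\<forall>\<^sub>F (N, t) in at_top \<times>\<^sub>F F.
          norm ((1/2)^N * min 1 (C3_seminorm N (\<lambda>x. app (f t) x - app g x))) \<le> (1/2)^N"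
        by (rule always_eventually) (auto simp: nn abs_mult)
    qed (auto simp: summable_geometric assms)
    then show "(f \<longlongrightarrow> g) F"
      by (subst tendsto_dist_iff) (simp add: dist_C3_def)
  }
qed

lemma isCont_shift: "isCont (shift x) (h :: ('n::finite) C3)"
  unfolding isCont_def
\<comment> \<open>\<open>tendsto_C3_iff\<close> needs a proper filter; where \<open>at h\<close> is
  trivial every limit holds.\<close>
proof (cases "at h = bot")
  case False
  have lim: "((\<lambda>g. C3_seminorm N (\<lambda>x. app g x - app h x)) \<longlongrightarrow> 0) (at h)" for N
    using iffD1[OF tendsto_C3_iff[OF False] tendsto_ident_at] by blast
  show "shift x \<midarrow>h\<rightarrow> shift x h"
    unfolding tendsto_C3_iff[OF False]
  proof
    fix N
    obtain M where M: "real N + norm x \<le> real M" using real_arch_simple by blast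
    have "C3_seminorm N (\<lambda>y. app (shift x g) y - app (shift x h) y)
        \<le> C3_seminorm M (\<lambda>y. app g y - app h y)" for g
      unfolding app_shift using C3_seminorm_translate[OF Ck_diff[OF Ck_app Ck_app] M] by auto
    moreover have "0 \<le> C3_seminorm N (\<lambda>y. app (shift x g) y - app (shift x h) y)" for g
      by (intro C3_seminorm_nonneg Ck_diff Ck_app)
    ultimately show "((\<lambda>g. C3_seminorm N (\<lambda>y. app (shift x g) y - app (shift x h) y)) \<longlongrightarrow> 0) (at h)"
      by (intro tendsto_sandwich[OF _ _ tendsto_const lim[of M]] always_eventually) auto
  qed
qed simp

lemma shift_measurable [measurable]: "shift x \<in> borel_measurable borel"
  by (intro borel_measurable_continuous_onI continuous_at_imp_continuous_on ballI isCont_shift)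

text \<open>Derivatives of top order are uniformly continuous on compact sets. The induction only
  descends to the partial derivatives, so the analysis sits in the case k = 0.\<close>

lemma dnorm_increment_small:
  fixes f :: "real^'n::finite \<Rightarrow> real"
  assumes "Ck k f" "e > 0"
  shows "\<exists>d>0. \<forall>a. norm a < d \<longrightarrow> (\<forall>x\<in>cball 0 R. dnorm k (\<lambda>y. f (y + a) - f y) x < e)"
  using assms
proof (induction k arbitrary: f e)
  case 0
  \<comment> \<open>The margin 1 keeps x + a inside the ball when norm a < 1.\<close>
  have "uniformly_continuous_on (cball 0 (R + 1)) f"
    using 0 continuous_on_subset[of UNIV f] by (intro compact_uniformly_continuous) auto
  then obtain d where d: "d > 0"
    "\<And>x x'. x \<in> cball 0 (R + 1) \<Longrightarrow> x' \<in> cball 0 (R + 1) \<Longrightarrow> dist x' x < d \<Longrightarrow> dist (f x') (f x) < e"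
    using uniformly_continuous_onE[OF _ \<open>e > 0\<close>] by metis
  show ?case
  proof (intro exI[of _ "min d 1"] conjI allI impI ballI)
    fix a x :: "real^'n" assume a: "norm a < min d 1" and x: "x \<in> cball 0 R"
    have "x + a \<in> cball 0 (R + 1)" using a x norm_triangle_ineq[of x a] by simp
    from d(2)[OF _ this, of x] show "dnorm 0 (\<lambda>y. f (y + a) - f y) x < e"
      using a x by (simp add: dist_norm)
  qed (use d in auto)
next
  case (Suc k)
  \<comment> \<open>The Euclidean norm over the coordinates is bounded by the sum, hence an equal
    share of e for each coordinate.\<close>
  have "\<forall>i. \<exists>d. d > 0 \<and> (\<forall>a. norm a < d \<longrightarrow>
      (\<forall>x\<in>cball 0 R. dnorm k (\<lambda>y. pd i f (y + a) - pd i f y) x < e / CARD('n)))"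
  proof
    fix i
    have "Ck k (pd i f)" "e / CARD('n) > 0" using Suc.prems by simp_all
    from Suc.IH[OF this] show "\<exists>d. d > 0 \<and> (\<forall>a. norm a < d \<longrightarrow>
      (\<forall>x\<in>cball 0 R. dnorm k (\<lambda>y. pd i f (y + a) - pd i f y) x < e / CARD('n)))" .
  qed
  from choice[OF this] obtain d where d: "\<And>i. d i > 0" "\<And>i a x. norm a < d i \<Longrightarrow> x \<in> cball 0 R \<Longrightarrow>
      dnorm k (\<lambda>y. pd i f (y + a) - pd i f y) x < e / CARD('n)" by blast
  show ?case
  proof (intro exI[of _ "Min (range d)"] conjI allI impI ballI)
    show "0 < Min (range d)" using d(1) by simp
    fix a x :: "real^'n" assume a: "norm a < Min (range d)" and x: "x \<in> cball 0 R"
    have eq: "pd i (\<lambda>y. f (y + a) - f y) = (\<lambda>y. pd i f (y + a) - pd i f y)" for i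
    proof
      fix y
      have "f differentiable (at z)" for z using Suc.prems(1) by simp
      note this frechet_derivative_shift(2)[OF this]
      from pd_diff[OF this(2,1)] pd_shift[OF this(1)]
      show "pd i (\<lambda>y. f (y + a) - f y) y = pd i f (y + a) - pd i f y" by simp
    qed
    have "dnorm (Suc k) (\<lambda>y. f (y + a) - f y) x
        \<le> (\<Sum>i\<in>UNIV. dnorm k (\<lambda>y. pd i f (y + a) - pd i f y) x)"
      by (simp add: eq L2_set_le_sum dnorm_nonneg)
    also have "\<dots> < (\<Sum>i\<in>(UNIV :: 'n set). e / CARD('n))"
      using a by (intro sum_strict_mono d(2) x) auto
    also have "\<dots> = e" by simp
    finally show "dnorm (Suc k) (\<lambda>y. f (y + a) - f y) x < e" .
  qed
qed

lemma tendsto_shift_0: "((\<lambda>y. shift y h) \<longlongrightarrow> h) (at 0)" for h :: "('n::finite) C3"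
  unfolding tendsto_C3_iff[OF at_neq_bot]
proof (intro allI tendstoI)
  fix N and e :: real assume e: "e > 0"
  \<comment> \<open>The four orders k = 0, ..., 3 contribute e/8 each. The total e/2 leaves room
    because a supremum preserves only the weak inequality.\<close>
  have "\<forall>k. \<exists>d. k \<le> 3 \<longrightarrow> d > 0 \<and> (\<forall>a. norm a < d \<longrightarrow>
      (\<forall>x\<in>cball 0 (real N). dnorm k (\<lambda>y. app h (y + a) - app h y) x < e / 8))"
    using dnorm_increment_small[OF Ck_mono[OF Ck_app], of _ "e / 8" "real N" h] e by simp
  from choice[OF this] obtain d where d: "\<And>k. k \<le> 3 \<Longrightarrow> d k > 0"
    "\<And>k a x. k \<le> 3 \<Longrightarrow> norm a < d k \<Longrightarrow> x \<in> cball 0 (real N) \<Longrightarrow>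
        dnorm k (\<lambda>y. app h (y + a) - app h y) x < e / 8" by blast
  define D where "D = Min (d ` {..3})"
  have "D > 0" unfolding D_def using d(1) by simp
  moreover have "C3_seminorm N (\<lambda>y. app (shift a h) y - app h y) < e" if "norm a < D" for a
  proof -
    have "C3_seminorm N (\<lambda>y. app (shift a h) y - app h y) \<le> (\<Sum>k\<le>3::nat. e / 8)"
      unfolding C3_seminorm_def
    proof (rule cSUP_least)
      fix x :: "real^'n" assume x: "x \<in> cball 0 (real N)"
      have "norm a < d k" if "k \<le> 3" for k
        using \<open>norm a < D\<close> that unfolding D_def by simp
      then show "(\<Sum>k\<le>3. dnorm k (\<lambda>y. app (shift a h) y - app h y) x) \<le> (\<Sum>k\<le>3::nat. e / 8)"
        unfolding app_shift using d(2)[OF _ _ x] by (intro sum_mono less_imp_le) auto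
    qed simp
    also have "\<dots> < e" using e by simp
    finally show ?thesis .
  qed
  moreover have "0 \<le> C3_seminorm N (\<lambda>y. app (shift a h) y - app h y)" for a
    by (intro C3_seminorm_nonneg Ck_diff Ck_app)
  ultimately show "\<forall>\<^sub>F a in at 0. dist (C3_seminorm N (\<lambda>y. app (shift a h) y - app h y)) 0 < e"
    unfolding eventually_at by (auto simp: dist_norm)
qed

lemma isCont_shift_left: "isCont (\<lambda>y. shift y h) y" for h :: "('n::finite) C3"
proof -
  have "((\<lambda>a. shift a (shift y h)) \<longlongrightarrow> shift y h) (at 0)" by (rule tendsto_shift_0)
  then show ?thesis unfolding isCont_def by (subst LIM_offset_zero_iff) (auto simp: shift_shift add.commute)
qed

text \<open>A Caratheodory argument: the map is continuous in y and measurable in h, so inserting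
  simple functions s i for y gives finitely many measurable pieces, and the pointwise limit stays
  measurable. This avoids comparing the product sigma-algebra with the Borel sets of the product
  space.\<close>

lemma shift_measurable_pair:
  "(\<lambda>(y, h). shift y h) \<in> borel \<Otimes>\<^sub>M (borel :: ('n::finite) C3 measure) \<rightarrow>\<^sub>M borel"
proof -
  obtain s :: "nat \<Rightarrow> real^'n \<Rightarrow> real^'n" where s: "\<And>i. simple_function borel (s i)"
    "\<And>x. (\<lambda>i. s i x) \<longlonglongrightarrow> x"
    using borel_measurable_implies_sequence_metric[of "\<lambda>x::real^'n. x" borel 0] by auto
  have "(\<lambda>p. shift (s i (fst p)) (snd p)) \<in> borel_measurable (borel \<Otimes>\<^sub>M (borel :: 'n C3 measure))" for i
  proof (rule measurable_compose_countable'[where f = "\<lambda>y p. shift y (snd p)" and I = "range (s i)"])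
    show "countable (range (s i))"
      using simple_functionD(1)[OF s(1)[of i]] by (simp add: countable_finite)
    have "s i \<in> measurable borel (count_space (range (s i)))"
      using s(1)[of i] by (simp add: simple_function_def measurable_count_space_eq2 vimage_def Int_def)
    then show "(\<lambda>p. s i (fst p)) \<in> measurable (borel \<Otimes>\<^sub>M (borel :: 'n C3 measure)) (count_space (range (s i)))"
      by measurable
  qed measurable
  moreover have "(\<lambda>i. shift (s i (fst p)) (snd p)) \<longlonglongrightarrow> shift (fst p) (snd p)" for p :: "(real^'n) \<times> 'n C3"
    by (rule isCont_tendsto_compose[OF isCont_shift_left s(2)])
  ultimately have "(\<lambda>p. shift (fst p) (snd p)) \<in> borel_measurable (borel \<Otimes>\<^sub>M (borel :: 'n C3 measure))"
    by (rule borel_measurable_LIMSEQ_metric)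
  then show ?thesis by (simp add: case_prod_beta')
qed

text \<open>The ball of radius 0 is the origin, so \<open>C3_seminorm 0\<close> dominates the first
  partial derivatives there. This is where the measurability of the slope, and with it of all
  coefficients, comes from.\<close>

lemma isCont_pd: "isCont (\<lambda>h. pd i (app h) 0) h" for h :: "('n::finite) C3"
proof (cases "at h = bot")
  case False
  have le: "\<bar>pd i (app g) 0 - pd i (app h) 0\<bar> \<le> C3_seminorm 0 (\<lambda>x. app g x - app h x)" for g
  proof -
    have "\<bar>pd i (app g) 0 - pd i (app h) 0\<bar> = \<bar>pd i (\<lambda>x. app g x - app h x) 0\<bar>"
      by (subst pd_diff) (auto intro: Ck_differentiable[OF Ck_app])
    also have "\<dots> \<le> dnorm 1 (\<lambda>x. app g x - app h x) 0"
      using member_le_L2_set[of UNIV i "\<lambda>i. \<bar>pd i (\<lambda>x. app g x - app h x) 0\<bar>"] by simp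
    also have "\<dots> \<le> (\<Sum>k\<le>3. dnorm k (\<lambda>x. app g x - app h x) 0)"
      by (rule member_le_sum) (auto simp: dnorm_nonneg simp del: dnorm.simps)
    also have "\<dots> \<le> C3_seminorm 0 (\<lambda>x. app g x - app h x)"
      by (intro C3_seminorm_upper Ck_diff Ck_app) simp
    finally show ?thesis .
  qed
  have "((\<lambda>g. C3_seminorm 0 (\<lambda>x. app g x - app h x)) \<longlongrightarrow> 0) (at h)"
    using iffD1[OF tendsto_C3_iff[OF False] tendsto_ident_at] by blast
  then have "((\<lambda>g. pd i (app g) 0 - pd i (app h) 0) \<longlongrightarrow> 0) (at h)"
    by (rule Lim_null_comparison[rotated]) (simp add: le)
  then show ?thesis unfolding isCont_def by (rule LIM_zero_cancel)
qed (simp add: isCont_def)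

section \<open>Translations in \<open>L\<^sup>2(\<P>)\<close>\<close>

locale admissible_measure =
  fixes P :: "('n::finite) C3 measure"
  assumes admissible: "admissible P"
begin

sublocale prob_space P
  using admissible unfolding admissible_def by (elim conjE)

lemma sets_P [measurable_cong]: "sets P = sets borel"
  using admissible unfolding admissible_def by (elim conjE)

lemma stationary: "B \<in> sets borel \<Longrightarrow> measure P (shift x -` B) = measure P B"
  using admissible unfolding admissible_def by (elim conjE) blast

lemma space_P [simp]: "space P = UNIV"
  using sets_eq_imp_space_eq[OF sets_P] by simp

lemma measurable_P [simp]: "f \<in> borel_measurable P \<longleftrightarrow> f \<in> borel_measurable borel"
  using measurable_cong_sets[OF sets_P refl] by auto

text \<open>Stationarity in the form that gives change of variables for integrals, integrability and
  null sets.\<close>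

lemma distr_shift: "distr P P (shift x) = P"
proof (rule measure_eqI)
  fix A assume "A \<in> sets (distr P P (shift x))"
  then have A: "A \<in> sets P" by simp
  have "measure P (shift x -` A) = measure P A"
    using A stationary by (simp add: sets_P)
  moreover have "shift x \<in> measurable P P"
    using shift_measurable measurable_cong_sets[OF sets_P sets_P] by blast
  ultimately show "emeasure (distr P P (shift x)) A = emeasure P A"
    using A by (simp add: emeasure_distr emeasure_eq_measure)
qed simp

lemma shift_measurable_P [measurable]: "shift x \<in> measurable P P"
  using shift_measurable measurable_cong_sets[OF sets_P sets_P] by blast

lemma measurable_comp_shift: "f \<in> borel_measurable borel \<Longrightarrow> (\<lambda>h. f (shift x h)) \<in> borel_measurable borel"
  by (rule measurable_compose[OF shift_measurable])

lemma integral_shift: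
  fixes f :: "'n C3 \<Rightarrow> 'b::{banach, second_countable_topology}"
  assumes "f \<in> borel_measurable borel"
  shows "(\<integral>h. f (shift x h) \<partial>P) = (\<integral>h. f h \<partial>P)"
  using integral_distr[OF shift_measurable_P[of x], of f] assms by (simp add: distr_shift)

lemma integrable_shift:
  fixes f :: "'n C3 \<Rightarrow> 'b::{banach, second_countable_topology}"
  assumes "integrable P f"
  shows "integrable P (\<lambda>h. f (shift x h))"
  using integrable_distr[OF shift_measurable_P[of x], of f] assms by (simp add: distr_shift)

lemma AE_shift:
  assumes "AE h in P. Q h"
  shows "AE h in P. Q (shift x h)"
proof -
  have "AE h in distr P P (shift x). Q h" unfolding distr_shift by (rule assms)
  from AE_distrD[OF shift_measurable_P this] show ?thesis .
qed

lemma L2_shift: "f \<in> L2 P \<Longrightarrow> (\<lambda>h. f (shift x h)) \<in> L2 P"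
  using integrable_shift[of "\<lambda>h. (norm (f h))\<^sup>2" x] by (simp add: L2_def measurable_comp_shift)

lemma L2_norm_shift: "f \<in> L2 P \<Longrightarrow> L2_norm P (\<lambda>h. f (shift x h)) = L2_norm P f"
proof -
  assume "f \<in> L2 P"
  then have [measurable]: "f \<in> borel_measurable borel" by (simp add: L2_def)
  have "(\<lambda>h. (norm (f h))\<^sup>2) \<in> borel_measurable borel" by measurable
  from integral_shift[OF this, of x] show ?thesis by (simp add: L2_norm_def)
qed

subsection \<open>Strong continuity\<close>

text \<open>Continuity of the translations at the identity, in L^1 rather than L^2: for an indicator
  it concerns the measure of a symmetric difference, which can be treated by generating the Borel
  sets from the open ones.\<close>

definition L1_cont :: "('n C3 \<Rightarrow> real) \<Rightarrow> bool" where
  "L1_cont f \<longleftrightarrow> ((\<lambda>y. \<integral>h. \<bar>f (shift y h) - f h\<bar> \<partial>P) \<longlongrightarrow> 0) (at 0)"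

text \<open>By stationarity translations are isometries of L^1, so the approximation error at the
  shifted point equals the unshifted one; three terms of size e / 4 remain.\<close>

lemma L1_cont_limit:
  assumes s: "\<And>n. integrable P (s n)" "\<And>n. L1_cont (s n)" and f: "integrable P f"
    and lim: "(\<lambda>n. \<integral>h. \<bar>s n h - f h\<bar> \<partial>P) \<longlonglongrightarrow> 0"
  shows "L1_cont f"
  unfolding L1_cont_def
proof (rule tendstoI)
  fix e :: real assume e: "e > 0"
  from order_tendstoD(2)[OF lim, of "e / 4"] e
  have "\<forall>\<^sub>F n in sequentially. (\<integral>h. \<bar>s n h - f h\<bar> \<partial>P) < e / 4" by simp
  from eventually_happens'[OF sequentially_bot this]
  obtain n where n: "(\<integral>h. \<bar>s n h - f h\<bar> \<partial>P) < e / 4" ..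
  have "\<forall>\<^sub>F y in at 0. (\<integral>h. \<bar>s n (shift y h) - s n h\<bar> \<partial>P) < e / 4"
    using s(2)[of n] e order_tendstoD(2)[of _ 0 "at 0" "e / 4"] unfolding L1_cont_def by simp
  then show "\<forall>\<^sub>F y in at 0. dist (\<integral>h. \<bar>f (shift y h) - f h\<bar> \<partial>P) 0 < e"
  proof eventually_elim
    case (elim y)
    have int: "integrable P (\<lambda>h. \<bar>s n h - f h\<bar>)" using s f by auto
    note ints = int integrable_shift[OF int, of y]
      integrable_abs[OF Bochner_Integration.integrable_diff[OF integrable_shift[OF s(1), of n y] s(1)[of n]]]
    have [measurable]: "s n \<in> borel_measurable borel" "f \<in> borel_measurable borel"
      using borel_measurable_integrable[OF s(1)[of n]] borel_measurable_integrable[OF f] by simp_all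
    have "(\<integral>h. \<bar>f (shift y h) - f h\<bar> \<partial>P)
       \<le> (\<integral>h. \<bar>s n (shift y h) - f (shift y h)\<bar> + \<bar>s n (shift y h) - s n h\<bar> + \<bar>s n h - f h\<bar> \<partial>P)"
    proof (rule integral_mono)
      show "integrable P (\<lambda>h. \<bar>f (shift y h) - f h\<bar>)"
        by (intro integrable_abs Bochner_Integration.integrable_diff integrable_shift[OF f] f)
      show "integrable P (\<lambda>h. \<bar>s n (shift y h) - f (shift y h)\<bar> + \<bar>s n (shift y h) - s n h\<bar> + \<bar>s n h - f h\<bar>)"
        by (intro Bochner_Integration.integrable_add ints)
    qed linarith
    also have "\<dots> = (\<integral>h. \<bar>s n (shift y h) - f (shift y h)\<bar> \<partial>P)
        + (\<integral>h. \<bar>s n (shift y h) - s n h\<bar> \<partial>P) + (\<integral>h. \<bar>s n h - f h\<bar> \<partial>P)"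
      using ints by simp
    also have "(\<integral>h. \<bar>s n (shift y h) - f (shift y h)\<bar> \<partial>P) = (\<integral>h. \<bar>s n h - f h\<bar> \<partial>P)"
      by (rule integral_shift) measurable
    finally show ?case using n elim e by simp
  qed
qed

lemma L1_cont_add:
  assumes "integrable P f" "integrable P g" "L1_cont f" "L1_cont g"
  shows "L1_cont (\<lambda>h. f h + g h)"
proof -
  have lim: "((\<lambda>y. (\<integral>h. \<bar>f (shift y h) - f h\<bar> \<partial>P) + (\<integral>h. \<bar>g (shift y h) - g h\<bar> \<partial>P)) \<longlongrightarrow> 0) (at 0)"
    using tendsto_add[OF assms(3,4)[unfolded L1_cont_def]] by simp
  have "(\<integral>h. \<bar>f (shift y h) + g (shift y h) - (f h + g h)\<bar> \<partial>P)
      \<le> (\<integral>h. \<bar>f (shift y h) - f h\<bar> \<partial>P) + (\<integral>h. \<bar>g (shift y h) - g h\<bar> \<partial>P)" for y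
  proof -
    have i: "integrable P (\<lambda>h. f (shift y h) - f h)" "integrable P (\<lambda>h. g (shift y h) - g h)"
      by (intro Bochner_Integration.integrable_diff integrable_shift[OF assms(1)]
          integrable_shift[OF assms(2)] assms)+
    have "(\<integral>h. \<bar>f (shift y h) + g (shift y h) - (f h + g h)\<bar> \<partial>P)
        \<le> (\<integral>h. \<bar>f (shift y h) - f h\<bar> + \<bar>g (shift y h) - g h\<bar> \<partial>P)"
    proof (rule integral_mono)
      show "integrable P (\<lambda>h. \<bar>f (shift y h) + g (shift y h) - (f h + g h)\<bar>)"
        using Bochner_Integration.integrable_add[OF i] by (auto simp: algebra_simps intro: integrable_abs)
    qed (use i in auto)
    also have "\<dots> = (\<integral>h. \<bar>f (shift y h) - f h\<bar> \<partial>P) + (\<integral>h. \<bar>g (shift y h) - g h\<bar> \<partial>P)"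
      using i by simp
    finally show ?thesis .
  qed
  then show ?thesis unfolding L1_cont_def
    by (intro tendsto_sandwich[OF always_eventually always_eventually tendsto_const lim]) auto
qed

text \<open>For open \<open>A\<close> the positive part of \<open>1\<^sub>A - 1\<^sub>A \<circ> \<tau>\<^sub>y\<close> tends to zero pointwise, and stationarity
  makes the integrals of its positive and negative parts equal.\<close>

lemma L1_cont_indicator:
  assumes "A \<in> sets borel"
  shows "L1_cont (indicator A)"
proof -
  have ind: "integrable P (indicator A :: _ \<Rightarrow> real)" if "A \<in> sets borel" for A
    using that sets_P by (simp add: emeasure_eq_measure)
  have "Int_stable {S :: 'n C3 set. open S}"
    by (auto simp: Int_stable_def)
  moreover have "{S :: 'n C3 set. open S} \<subseteq> Pow UNIV" by simp
  moreover have "A \<in> sigma_sets UNIV {S :: 'n C3 set. open S}"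
    using assms by (simp add: borel_def)
  ultimately show ?thesis
  proof (induction rule: sigma_sets_induct_disjoint)
    case (basic A)
    then have A: "open A" by simp
    then have [measurable]: "A \<in> sets borel" by simp
    have eq: "(\<integral>h. \<bar>indicat_real A (shift y h) - indicat_real A h\<bar> \<partial>P)
        = 2 * (\<integral>h. max 0 (indicat_real A h - indicat_real A (shift y h)) \<partial>P)" for y
    proof -
      have i: "integrable P (\<lambda>h. max 0 (indicat_real A h - indicat_real A (shift y h)) :: real)"
        using ind[of A] integrable_shift[OF ind[of A], of y] by (intro integrable_max) auto
      have "(\<integral>h. \<bar>indicat_real A (shift y h) - indicat_real A h\<bar> \<partial>P)
         = (\<integral>h. 2 * max 0 (indicat_real A h - indicat_real A (shift y h))
            + (indicat_real A (shift y h) - indicat_real A h) \<partial>P)"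
        by (intro Bochner_Integration.integral_cong refl) (auto simp: indicator_def max_def)
      also have "\<dots> = 2 * (\<integral>h. max 0 (indicat_real A h - indicat_real A (shift y h)) \<partial>P)
            + ((\<integral>h. indicat_real A (shift y h) \<partial>P) - (\<integral>h. indicat_real A h \<partial>P))"
        using i ind[of A] integrable_shift[OF ind[of A], of y] by simp
      also have "(\<integral>h. indicat_real A (shift y h) \<partial>P) = (\<integral>h. indicat_real A h \<partial>P :: real)"
        by (rule integral_shift) simp
      finally show ?thesis by simp
    qed
    have "((\<lambda>y. \<integral>h. max 0 (indicat_real A h - indicat_real A (shift y h)) \<partial>P) \<longlongrightarrow> (0::real)) (at 0)"
      unfolding tendsto_at_iff_sequentially
    proof (intro allI impI)
      fix X assume X: "\<forall>i. X i \<in> UNIV - {0 :: real^'n}" "X \<longlonglongrightarrow> 0"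
      have "(\<lambda>n. \<integral>h. max 0 (indicat_real A h - indicat_real A (shift (X n) h)) \<partial>P) \<longlonglongrightarrow> (\<integral>h. (0::real) \<partial>P)"
      proof (rule integral_dominated_convergence[where w = "\<lambda>_. 1"])
        have "(\<lambda>n. max 0 (indicat_real A h - indicat_real A (shift (X n) h)) ) \<longlonglongrightarrow> 0" for h
        proof (cases "h \<in> A")
          case True
          have "((\<lambda>n. shift (X n) h) \<longlongrightarrow> shift 0 h) sequentially"
            by (rule isCont_tendsto_compose[OF isCont_shift_left X(2)])
          then have "\<forall>\<^sub>F n in sequentially. shift (X n) h \<in> A"
            using topological_tendstoD[OF _ A] True by simp
          then show ?thesis
            by (intro tendsto_eventually) (auto elim!: eventually_mono simp: True indicator_def)
        next
          case False
          then have "max 0 (indicat_real A h - indicat_real A (shift (X n) h)) = 0" for n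
            by (simp add: indicator_def)
          then show ?thesis by simp
        qed
        then show "AE h in P. (\<lambda>n. max 0 (indicat_real A h - indicat_real A (shift (X n) h)) ) \<longlonglongrightarrow> 0"
          by simp
      qed (auto simp: indicator_def max_def)
      then show "((\<lambda>y. \<integral>h. max 0 (indicat_real A h - indicat_real A (shift y h)) \<partial>P) \<circ> X) \<longlonglongrightarrow> (0::real)"
        by (simp add: o_def)
    qed
    from tendsto_mult_left[OF this, of 2] show ?case
      unfolding L1_cont_def eq by simp
  next
    case empty
    then show ?case by (simp add: L1_cont_def)
  next
    case (compl A)
    have "\<bar>indicator (UNIV - A) (shift y h) - indicator (UNIV - A) h\<bar>
        = (\<bar>indicator A (shift y h) - indicator A h\<bar> :: real)" for y h
      by (auto simp: indicator_def)
    with compl show ?case by (simp add: L1_cont_def)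
  next
    case (union A)
    have A: "A i \<in> sets borel" for i
      using union.hyps(2) by (simp add: borel_def image_subset_iff)
    \<comment> \<open>Disjointness writes the indicator of a finite union as a finite sum, to which
      \<open>L1_cont_add\<close> applies.\<close>
    define s where "s n h = (\<Sum>i<n. indicator (A i) h :: real)" for n h
    have int: "integrable P (s n)" for n
      unfolding s_def using A ind by (intro Bochner_Integration.integrable_sum) auto
    have s_eq: "s n = indicator (\<Union>i<n. A i)" for n
      unfolding s_def using union.hyps(1)
      by (auto simp: fun_eq_iff indicator_UN_disjoint disjoint_family_on_def)
    have cont: "L1_cont (s n)" for n
    proof (induction n)
      case 0
      then show ?case by (simp add: L1_cont_def s_def[abs_def])
    next
      case (Suc n)
      have "L1_cont (\<lambda>h. s n h + indicator (A n) h)"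
        using Suc int ind[OF A] union.IH by (intro L1_cont_add) auto
      then show ?case by (simp add: s_def[abs_def])
    qed
    have m: "(\<Union>i. A i) \<in> sets borel" using A by auto
    show ?case
    proof (rule L1_cont_limit[OF int cont ind[OF m]])
      have "(\<lambda>n. \<integral>h. \<bar>s n h - indicator (\<Union>i. A i) h\<bar> \<partial>P) \<longlonglongrightarrow> (\<integral>h. 0 \<partial>P)"
      proof (rule integral_dominated_convergence[where w = "\<lambda>_. 1"])
        show "AE h in P. (\<lambda>n. \<bar>s n h - indicator (\<Union>i. A i) h\<bar>) \<longlonglongrightarrow> 0"
        proof (rule AE_I2)
          fix h
          have "(\<lambda>n. indicator (\<Union>i<n. A i) h :: real) \<longlonglongrightarrow> indicator (\<Union>i. A i) h"
            by (rule LIMSEQ_indicator_UN)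
          then have "(\<lambda>n. \<bar>s n h - indicator (\<Union>i. A i) h\<bar>) \<longlonglongrightarrow> \<bar>indicator (\<Union>i. A i) h - indicator (\<Union>i. A i) h :: real\<bar>"
            unfolding s_eq by (intro tendsto_intros)
          then show "(\<lambda>n. \<bar>s n h - indicator (\<Union>i. A i) h\<bar>) \<longlonglongrightarrow> 0" by simp
        qed
        show "AE h in P. norm \<bar>s n h - indicator (\<Union>i. A i) h\<bar> \<le> 1" for n
          unfolding s_eq by (auto simp: indicator_def)
        show "(\<lambda>h. \<bar>s n h - indicator (\<Union>i. A i) h\<bar>) \<in> borel_measurable P" for n
          using borel_measurable_integrable[OF int[of n]] m by simp
      qed auto
      then show "(\<lambda>n. \<integral>h. \<bar>s n h - indicator (\<Union>i. A i) h\<bar> \<partial>P) \<longlonglongrightarrow> 0" by simp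
    qed
  qed
qed

lemma L1_cont_integrable:
  fixes f :: "'n C3 \<Rightarrow> real"
  assumes "integrable P f"
  shows "L1_cont f"
  using assms
proof (induction rule: integrable_induct)
  case (base A c)
  then have "((\<lambda>y. \<integral>h. \<bar>indicator A (shift y h) - indicator A h\<bar> \<partial>P) \<longlongrightarrow> (0::real)) (at 0)"
    using L1_cont_indicator[of A] sets_P unfolding L1_cont_def by simp
  from tendsto_mult_right[OF this, of "\<bar>c\<bar>"]
  show ?case unfolding L1_cont_def
    by (simp add: abs_mult flip: left_diff_distrib)
next
  case (add f g)
  then show ?case by (intro L1_cont_add)
next
  case (lim f s)
  note [measurable] = borel_measurable_integrable[OF lim.hyps(1)] borel_measurable_integrable[OF lim.hyps(4)]
  show ?case
  proof (rule L1_cont_limit[OF lim.hyps(1) lim.IH lim.hyps(4)])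
    have "(\<lambda>n. \<integral>h. \<bar>s n h - f h\<bar> \<partial>P) \<longlonglongrightarrow> (\<integral>h. 0 \<partial>P)"
    \<comment> \<open>The approximants of the induction satisfy |s n| \<le> 2 |f|, whence the factor
      3.\<close>
    proof (rule integral_dominated_convergence[where w = "\<lambda>h. 3 * \<bar>f h\<bar>"])
      show "AE h in P. (\<lambda>n. \<bar>s n h - f h\<bar>) \<longlonglongrightarrow> 0"
      proof (rule AE_I2)
        fix h :: "'n C3" assume "h \<in> space P"
        from lim.hyps(2)[OF this] have "(\<lambda>n. \<bar>s n h - f h\<bar>) \<longlonglongrightarrow> \<bar>f h - f h\<bar>"
          by (intro tendsto_intros)
        then show "(\<lambda>n. \<bar>s n h - f h\<bar>) \<longlonglongrightarrow> 0" by simp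
      qed
      show "AE h in P. norm \<bar>s n h - f h\<bar> \<le> 3 * \<bar>f h\<bar>" for n
      proof (rule AE_I2)
        fix h :: "'n C3" assume "h \<in> space P"
        from lim.hyps(3)[OF this, of n] show "norm \<bar>s n h - f h\<bar> \<le> 3 * \<bar>f h\<bar>" by simp
      qed
      show "(\<lambda>h. \<bar>s n h - f h\<bar>) \<in> borel_measurable P" for n by measurable
      show "integrable P (\<lambda>h. 3 * \<bar>f h\<bar>)" using lim.hyps(4) by auto
    qed auto
    then show "(\<lambda>n. \<integral>h. \<bar>s n h - f h\<bar> \<partial>P) \<longlonglongrightarrow> 0" by simp
  qed
qed

text \<open>Matrix coefficients of the translation group. They carry the density argument from Omega
  to real functions on R^d.\<close>

definition corr :: "('n C3 \<Rightarrow> real) \<Rightarrow> ('n C3 \<Rightarrow> real) \<Rightarrow> real^'n \<Rightarrow> real" where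
  "corr W V y = (\<integral>h. W h * V (shift y h) \<partial>P)"

text \<open>Weak continuity from L^1 continuity: a bounded W can be paired with an increment that is
  small in L^1, and Cauchy-Schwarz absorbs the truncation error of W uniformly in y.\<close>

lemma corr_tendsto:
  assumes W: "W \<in> L2 P" and V: "V \<in> L2 P"
  shows "(corr W V \<longlongrightarrow> corr W V 0) (at 0)"
proof (rule tendstoI)
  fix e :: real assume e: "e > 0"
  \<comment> \<open>Twice the norm of V bounds every increment V o tau_y - V; the summand 1 makes
    division by K legitimate.\<close>
  define K where "K = 2 * L2_norm P V + 1"
  have K: "K > 0" by (simp add: K_def add_nonneg_pos)
  define Wn where "Wn n h = trunc n (W h)" for n h
  have Wn: "Wn n \<in> L2 P" for n unfolding Wn_def by (rule trunc_L2(1)[OF W])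
  have "(\<lambda>n. L2_dist P (Wn n) W) \<longlonglongrightarrow> 0" unfolding Wn_def by (rule trunc_L2(2)[OF W])
  from order_tendstoD(2)[OF this, of "e / (2 * K)"] K e
  have "\<forall>\<^sub>F n in sequentially. L2_dist P (Wn n) W < e / (2 * K)" by simp
  from eventually_happens'[OF sequentially_bot this]
  obtain n where n: "L2_dist P (Wn n) W < e / (2 * K)" ..
  have "((\<lambda>y. real n * (\<integral>h. \<bar>V (shift y h) - V h\<bar> \<partial>P)) \<longlongrightarrow> real n * 0) (at 0)"
    using L1_cont_integrable[OF L2_integrable[OF V]] unfolding L1_cont_def
    by (intro tendsto_mult tendsto_const)
  from order_tendstoD(2)[OF this, of "e / 2"] e
  have "\<forall>\<^sub>F y in at 0. real n * (\<integral>h. \<bar>V (shift y h) - V h\<bar> \<partial>P) < e / 2" by simp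
  then show "\<forall>\<^sub>F y in at 0. dist (corr W V y) (corr W V 0) < e"
  proof eventually_elim
    case (elim y)
    define U where "U h = V (shift y h) - V h" for h
    have U: "U \<in> L2 P" unfolding U_def by (intro L2_diff L2_shift V)
    have WW: "(\<lambda>h. W h - Wn n h) \<in> L2 P" by (intro L2_diff W Wn)
    note ints = L2_integrable_mult[OF W L2_shift[OF V, of y]] L2_integrable_mult[OF W V]
      L2_integrable_mult[OF WW U] L2_integrable_mult[OF Wn[of n] U]
    have "corr W V y - corr W V 0 = (\<integral>h. W h * V (shift y h) - W h * V h \<partial>P)"
      unfolding corr_def using ints by simp
    also have "\<dots> = (\<integral>h. (W h - Wn n h) * U h + Wn n h * U h \<partial>P)"
      by (simp add: U_def algebra_simps)
    also have "\<dots> = (\<integral>h. (W h - Wn n h) * U h \<partial>P) + (\<integral>h. Wn n h * U h \<partial>P)"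
      using ints by simp
    finally have eq: "corr W V y - corr W V 0 = \<dots>" .
    have "\<bar>\<integral>h. (W h - Wn n h) * U h \<partial>P\<bar> \<le> L2_dist P (Wn n) W * L2_norm P U"
      using L2_Cauchy_Schwarz[OF WW U]
      by (simp add: L2_dist_commute[of P "Wn n"] L2_dist_eq_norm[of P W])
    also have "\<dots> \<le> L2_dist P (Wn n) W * K"
    proof (rule mult_left_mono)
      have "L2_norm P U \<le> L2_norm P (\<lambda>h. V (shift y h)) + L2_norm P (\<lambda>h. - V h)"
        using L2_norm_triangle[OF L2_shift[OF V, of y] L2_minus[OF V]] by (simp add: U_def[abs_def])
      then show "L2_norm P U \<le> K" by (simp add: L2_norm_shift[OF V] L2_norm_minus K_def)
    qed simp
    also have "\<dots> < e / 2" using n K by (simp add: field_simps)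
    finally have 1: "\<bar>\<integral>h. (W h - Wn n h) * U h \<partial>P\<bar> < e / 2" .
    have "\<bar>\<integral>h. Wn n h * U h \<partial>P\<bar> \<le> (\<integral>h. \<bar>Wn n h * U h\<bar> \<partial>P)" by (rule integral_abs_bound)
    also have "\<dots> \<le> (\<integral>h. real n * \<bar>U h\<bar> \<partial>P)"
    proof (rule integral_mono)
      show "integrable P (\<lambda>h. \<bar>Wn n h * U h\<bar>)" by (rule integrable_abs[OF ints(4)])
      show "integrable P (\<lambda>h. real n * \<bar>U h\<bar>)"
        by (intro integrable_mult_right integrable_abs L2_integrable[OF U])
      show "\<bar>Wn n h * U h\<bar> \<le> real n * \<bar>U h\<bar>" for h
        using trunc_bound(1)[of n "W h"] by (auto simp: abs_mult Wn_def intro!: mult_right_mono)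
    qed
    also have "\<dots> < e / 2" using elim by (simp add: U_def)
    finally show ?case using 1 eq by (simp add: dist_norm)
  qed
qed

lemma corr_isCont:
  assumes W: "W \<in> L2 P" and V: "V \<in> L2 P"
  shows "isCont (corr W V) y"
proof -
  \<comment> \<open>The group law turns continuity at y into continuity at 0 for the translated
    V.\<close>
  have "(corr W (\<lambda>h. V (shift y h)) \<longlongrightarrow> corr W (\<lambda>h. V (shift y h)) 0) (at 0)"
    by (intro corr_tendsto W L2_shift V)
  then show ?thesis unfolding isCont_def
    by (subst LIM_offset_zero_iff) (auto simp: corr_def[abs_def] shift_shift)
qed

lemma corr_bound:
  assumes W: "W \<in> L2 P" and V: "V \<in> L2 P"
  shows "\<bar>corr W V y\<bar> \<le> L2_norm P W * L2_norm P V"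
  using L2_Cauchy_Schwarz[OF W L2_shift[OF V, of y]] by (simp add: corr_def L2_norm_shift[OF V])

end

section \<open>Stochastic derivatives\<close>

lemma pd_eqI: "(f has_derivative D) (at x) \<Longrightarrow> pd i f x = D (axis i 1)"
  unfolding pd_def by (drule frechet_derivative_at) simp

lemma pd_mult:
  assumes "f differentiable (at x)" "g differentiable (at x)"
  shows "pd i (\<lambda>z. f z * g z) x = f x * pd i g x + pd i f x * g x"
proof -
  have "((\<lambda>z. f z * g z) has_derivative
      (\<lambda>v. f x * frechet_derivative g (at x) v + frechet_derivative f (at x) v * g x)) (at x)"
    using assms by (intro has_derivative_mult) (simp_all flip: frechet_derivative_works)
  from pd_eqI[OF this] show ?thesis by (simp add: pd_def)
qed

lemma pd_add:
  assumes "f differentiable (at x)" "g differentiable (at x)"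
  shows "pd i (\<lambda>z. f z + g z) x = pd i f x + pd i g x"
proof -
  have "((\<lambda>z. f z + g z) has_derivative
      (\<lambda>v. frechet_derivative f (at x) v + frechet_derivative g (at x) v)) (at x)"
    using assms by (intro has_derivative_add) (simp_all flip: frechet_derivative_works)
  from pd_eqI[OF this] show ?thesis by (simp add: pd_def)
qed

lemma pd_const: "pd i (\<lambda>z. c) x = 0"
  by (simp add: pd_def)

lemma pd_compose:
  assumes f: "f differentiable (at x)" and F: "(F has_real_derivative F') (at (f x))"
  shows "(\<lambda>z. F (f z)) differentiable (at x)" "pd i (\<lambda>z. F (f z)) x = F' * pd i f x"
proof -
  have "(f has_derivative frechet_derivative f (at x)) (at x)"
    using f by (simp flip: frechet_derivative_works)
  from has_derivative_compose[OF this] F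
  have *: "((\<lambda>z. F (f z)) has_derivative (\<lambda>v. F' * frechet_derivative f (at x) v)) (at x)"
    by (simp add: has_field_derivative_def)
  then show "(\<lambda>z. F (f z)) differentiable (at x)" by (auto simp: differentiable_def)
  show "pd i (\<lambda>z. F (f z)) x = F' * pd i f x" using pd_eqI[OF *] by (simp add: pd_def)
qed

lemma pd_line:
  assumes "f differentiable (at (s *\<^sub>R axis i 1))"
  shows "((\<lambda>r. f (r *\<^sub>R axis i 1)) has_real_derivative pd i f (s *\<^sub>R axis i 1)) (at s)"
proof -
  let ?D = "frechet_derivative f (at (s *\<^sub>R axis i 1))"
  have f: "(f has_derivative ?D) (at (s *\<^sub>R axis i 1))"
    using assms by (simp flip: frechet_derivative_works)
  have "((\<lambda>r. r *\<^sub>R axis i 1) has_derivative (\<lambda>r. r *\<^sub>R axis i 1)) (at s)"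
    by (intro derivative_eq_intros) auto
  from has_derivative_compose[OF this f]
  have "((\<lambda>r. f (r *\<^sub>R axis i 1)) has_derivative (\<lambda>r. ?D (r *\<^sub>R axis i 1))) (at s)" .
  moreover have "?D (r *\<^sub>R axis i 1) = r * pd i f (s *\<^sub>R axis i 1)" for r
    using linear_scale[OF has_derivative_linear[OF f]] by (simp add: pd_def)
  ultimately show ?thesis
    by (simp add: has_field_derivative_def mult.commute[of _ "pd i f (s *\<^sub>R axis i 1)"])
qed

section \<open>Square-integrable vector fields by components\<close>

lemma L2_vecI:
  fixes V :: "'a \<Rightarrow> real^'n::finite"
  assumes "\<And>i. (\<lambda>x. V x $ i) \<in> L2 M"
  shows "V \<in> L2 M"
proof -
  have "(\<lambda>x. V x $ i *\<^sub>R axis i 1 :: real^'n) \<in> L2 M" for i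
  proof (rule L2_dominated(1)[OF _ assms[of i], where C = 1])
    show "(\<lambda>x. V x $ i *\<^sub>R axis i 1 :: real^'n) \<in> borel_measurable M"
      using L2_measurable[OF assms[of i]] by simp
  qed simp
  then have "(\<lambda>x. \<Sum>i\<in>UNIV. V x $ i *\<^sub>R axis i 1 :: real^'n) \<in> L2 M" by (intro L2_sum)
  moreover have "(\<Sum>i\<in>UNIV. v $ i *\<^sub>R axis i 1 :: real^'n) = v" for v :: "real^'n"
    by (simp add: vec_eq_iff axis_def if_distrib cong: if_cong)
  ultimately show ?thesis by simp
qed

lemma measurable_vec_nth: "V \<in> borel_measurable M \<Longrightarrow> (\<lambda>x. V x $ i) \<in> borel_measurable M"
  for V :: "'a \<Rightarrow> real^'n::finite"
  using borel_measurable_inner[of V M "\<lambda>_. axis i 1"] by (simp add: inner_axis)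

lemma L2_vecD:
  fixes V :: "'a \<Rightarrow> real^'n::finite"
  assumes "V \<in> L2 M"
  shows "(\<lambda>x. V x $ i) \<in> L2 M"
  by (rule L2_dominated(1)[OF _ assms, where C = 1])
    (auto simp: component_le_norm_cart measurable_vec_nth L2_measurable[OF assms])

lemma L2_inner_vec:
  fixes V W :: "'a \<Rightarrow> real^'n::finite"
  assumes "V \<in> L2 M" "W \<in> L2 M"
  shows "(\<integral>x. V x \<bullet> W x \<partial>M) = (\<Sum>i\<in>UNIV. \<integral>x. V x $ i * W x $ i \<partial>M)"
  unfolding inner_vec_def inner_real_def
  by (intro Bochner_Integration.integral_sum L2_integrable_mult L2_vecD assms)

context admissible_measure
begin

section \<open>Difference quotients and derivatives in L^2\<close>

definition dq :: "'n \<Rightarrow> real \<Rightarrow> ('n C3 \<Rightarrow> real) \<Rightarrow> 'n C3 \<Rightarrow> real" where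
  "dq i t V h = (V (shift (t *\<^sub>R axis i 1) h) - V h) / t"

lemma has_stoch_deriv_iff: "has_stoch_deriv P i V W \<longleftrightarrow> V \<in> L2 P \<and> W \<in> L2 P \<and>
     ((\<lambda>t. L2_dist P (dq i t V) W) \<longlongrightarrow> 0) (at 0)"
  by (simp add: has_stoch_deriv_def dq_def[abs_def])

lemma has_stoch_derivD:
  assumes "has_stoch_deriv P i V W"
  shows "V \<in> L2 P" "W \<in> L2 P" "((\<lambda>t. L2_dist P (dq i t V) W) \<longlongrightarrow> 0) (at 0)"
  using assms by (simp_all add: has_stoch_deriv_iff)

lemma dq_L2: "V \<in> L2 P \<Longrightarrow> dq i t V \<in> L2 P"
  using L2_mult_const[OF L2_diff[OF L2_shift[of V "t *\<^sub>R axis i 1"]], of V "1 / t"]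
  by (simp add: dq_def[abs_def])

lemma has_stoch_deriv_unique:
  assumes "has_stoch_deriv P i V W" "has_stoch_deriv P i V W'"
  shows "AE h in P. W h = W' h"
  using assms unfolding has_stoch_deriv_iff
  by (intro L2_limit_unique[of "at 0" "\<lambda>t. dq i t V"] dq_L2) simp_all

lemma has_stoch_deriv_stoch_D: "has_stoch_deriv P i V W \<Longrightarrow> has_stoch_deriv P i V (stoch_D P i V)"
  unfolding stoch_D_def by (rule someI[of "has_stoch_deriv P i V"])

lemma stoch_D_eq: "has_stoch_deriv P i V W \<Longrightarrow> AE h in P. stoch_D P i V h = W h"
  by (rule has_stoch_deriv_unique[OF has_stoch_deriv_stoch_D])

lemma sob1_stoch_D: "V \<in> sob1 P \<Longrightarrow> has_stoch_deriv P i V (stoch_D P i V)"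
  unfolding sob1_def using has_stoch_deriv_stoch_D by blast

lemma has_stoch_deriv_add:
  assumes "has_stoch_deriv P i V W" "has_stoch_deriv P i V' W'"
  shows "has_stoch_deriv P i (\<lambda>h. V h + V' h) (\<lambda>h. W h + W' h)"
proof -
  note D = has_stoch_derivD[OF assms(1)] and D' = has_stoch_derivD[OF assms(2)]
  have lim: "((\<lambda>t. L2_dist P (dq i t V) W + L2_dist P (dq i t V') W') \<longlongrightarrow> 0) (at 0)"
    using tendsto_add[OF D(3) D'(3)] by simp
  have eq: "dq i t (\<lambda>h. V h + V' h) = (\<lambda>h. dq i t V h + dq i t V' h)" for t
    by (simp add: dq_def fun_eq_iff add_divide_distrib diff_divide_distrib)
  have "((\<lambda>t. L2_dist P (dq i t (\<lambda>h. V h + V' h)) (\<lambda>h. W h + W' h)) \<longlongrightarrow> 0) (at 0)"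
    unfolding eq
    by (rule tendsto_sandwich[OF _ _ tendsto_const lim]; rule always_eventually)
      (simp_all add: L2_dist_add dq_L2 D D')
  then show ?thesis using D D' by (simp add: has_stoch_deriv_iff L2_add)
qed

lemma has_stoch_deriv_scale:
  assumes "has_stoch_deriv P i V W"
  shows "has_stoch_deriv P i (\<lambda>h. c * V h) (\<lambda>h. c * W h)"
proof -
  note D = has_stoch_derivD[OF assms]
  have eq: "dq i t (\<lambda>h. c * V h) = (\<lambda>h. c * dq i t V h)" for t
    by (simp add: dq_def fun_eq_iff algebra_simps)
  have "((\<lambda>t. \<bar>c\<bar> * L2_dist P (dq i t V) W) \<longlongrightarrow> \<bar>c\<bar> * 0) (at 0)"
    by (intro tendsto_mult tendsto_const D)
  then show ?thesis
    using L2_dist_scaleR[of P c _ W] D by (simp add: has_stoch_deriv_iff L2_mult_const eq)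
qed

lemma has_stoch_deriv_const: "has_stoch_deriv P i (\<lambda>h. c) (\<lambda>h. 0)"
  by (simp add: has_stoch_deriv_def L2_dist_def)

lemma has_stoch_deriv_cong:
  assumes "has_stoch_deriv P i V W" "V' \<in> borel_measurable borel" "AE h in P. V h = V' h"
  shows "has_stoch_deriv P i V' W"
proof -
  note D = has_stoch_derivD[OF assms(1)]
  have V': "V' \<in> L2 P" by (rule L2_cong_AE[OF D(1) _ assms(3)]) (simp add: assms(2))
  have "L2_dist P (dq i t V') W = L2_dist P (dq i t V) W" for t
  proof (rule L2_dist_cong_AE)
    show "AE h in P. dq i t V' h = dq i t V h"
      using assms(3) AE_shift[OF assms(3), of "t *\<^sub>R axis i 1"]
      by eventually_elim (simp add: dq_def)
  qed (use L2_measurable[OF dq_L2[OF V']] L2_measurable[OF dq_L2[OF D(1)]] L2_measurable[OF D(2)] in auto)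
  then show ?thesis using D V' by (simp add: has_stoch_deriv_iff)
qed

text \<open>Stationarity makes - \<open>dq i (- t)\<close> the adjoint of \<open>dq i t\<close>; the
  identity survives the limit t -> 0 because both quotients converge in L^2.\<close>

lemma integration_by_parts:
  assumes V: "has_stoch_deriv P i V V'" and U: "has_stoch_deriv P i U U'"
  shows "(\<integral>h. U h * V' h \<partial>P) = - (\<integral>h. V h * U' h \<partial>P)"
proof -
  note DV = has_stoch_derivD[OF V] and DU = has_stoch_derivD[OF U]
  have eq: "(\<integral>h. dq i t V h * U h \<partial>P) = - (\<integral>h. dq i (- t) U h * V h \<partial>P)" for t
  proof -
    let ?x = "t *\<^sub>R axis i 1"
    note i = L2_integrable_mult[OF DU(1) L2_shift[OF DV(1), of ?x]] L2_integrable_mult[OF DU(1) DV(1)]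
      L2_integrable_mult[OF L2_shift[OF DU(1), of "- ?x"] DV(1)]
    have [measurable]: "U \<in> borel_measurable borel" "V \<in> borel_measurable borel"
      using L2_measurable[OF DU(1)] L2_measurable[OF DV(1)] by simp_all
    have "(\<integral>h. U h * V (shift ?x h) \<partial>P)
        = (\<integral>h. U (shift (- ?x) (shift ?x h)) * V (shift ?x h) \<partial>P)"
      by (simp add: shift_shift)
    also have "\<dots> = (\<integral>h. U (shift (- ?x) h) * V h \<partial>P)"
      by (rule integral_shift[where f = "\<lambda>h. U (shift (- ?x) h) * V h"]) measurable
    finally have *: "(\<integral>h. U h * V (shift ?x h) \<partial>P) = (\<integral>h. U (shift (- ?x) h) * V h \<partial>P)" .
    have "(\<integral>h. dq i t V h * U h \<partial>P) = (\<integral>h. (U h * V (shift ?x h) - U h * V h) / t \<partial>P)"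
      by (simp add: dq_def algebra_simps diff_divide_distrib)
    also have "\<dots> = ((\<integral>h. U h * V (shift ?x h) \<partial>P) - (\<integral>h. U h * V h \<partial>P)) / t"
      using i by simp
    also have "\<dots> = ((\<integral>h. U (shift (- ?x) h) * V h \<partial>P) - (\<integral>h. U h * V h \<partial>P)) / t"
      unfolding * ..
    also have "\<dots> = (\<integral>h. (U (shift (- ?x) h) * V h - U h * V h) / t \<partial>P)"
      using i by simp
    also have "\<dots> = - (\<integral>h. dq i (- t) U h * V h \<partial>P)"
      by (simp add: dq_def algebra_simps diff_divide_distrib flip: Bochner_Integration.integral_minus)
    finally show ?thesis .
  qed
  have 1: "((\<lambda>t. \<integral>h. dq i t V h * U h \<partial>P) \<longlongrightarrow> (\<integral>h. V' h * U h \<partial>P)) (at 0)"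
    using L2_tendsto_inner_left[OF dq_L2[OF DV(1)] DV(2,3) DU(1)] by simp
  have 2: "((\<lambda>t. \<integral>h. dq i t U h * V h \<partial>P) \<longlongrightarrow> (\<integral>h. U' h * V h \<partial>P)) (at 0)"
    using L2_tendsto_inner_left[OF dq_L2[OF DU(1)] DU(2,3) DV(1)] by simp
  have "((\<lambda>t. \<integral>h. dq i (- t) U h * V h \<partial>P) \<longlongrightarrow> (\<integral>h. U' h * V h \<partial>P)) (at 0)"
  proof (rule filterlim_compose[OF 2])
    have "((\<lambda>t::real. - t) \<longlongrightarrow> - 0) (at 0)" by (intro tendsto_intros)
    then show "filterlim uminus (at 0) (at (0::real))"
      by (simp add: filterlim_at eventually_at_filter)
  qed
  from tendsto_minus[OF this]
  have "((\<lambda>t. \<integral>h. dq i t V h * U h \<partial>P) \<longlongrightarrow> - (\<integral>h. U' h * V h \<partial>P)) (at 0)"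
    by (simp add: eq)
  from tendsto_unique[OF at_neq_bot 1 this] show ?thesis by (simp add: mult.commute)
qed

lemma integral_stoch_deriv: "has_stoch_deriv P i V W \<Longrightarrow> (\<integral>h. W h \<partial>P) = 0"
  using integration_by_parts[OF _ has_stoch_deriv_const, of i V W 1] by simp

lemma grad_D_L2: "U \<in> sob1 P \<Longrightarrow> grad_D P U \<in> L2 P"
  unfolding grad_D_def by (rule L2_vecI) (simp add: has_stoch_derivD(2)[OF sob1_stoch_D])

lemma sob1_L2: "U \<in> sob1 P \<Longrightarrow> U \<in> L2 P"
  by (rule has_stoch_derivD(1)[OF sob1_stoch_D])

lemma grad_D_lincomb:
  assumes "U \<in> sob1 P" "V \<in> sob1 P"
  shows "(\<lambda>h. U h + c * V h) \<in> sob1 P"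
    "AE h in P. grad_D P (\<lambda>h. U h + c * V h) h = grad_D P U h + c *\<^sub>R grad_D P V h"
proof -
  have D: "has_stoch_deriv P i (\<lambda>h. U h + c * V h) (\<lambda>h. stoch_D P i U h + c * stoch_D P i V h)" for i
    by (intro has_stoch_deriv_add has_stoch_deriv_scale sob1_stoch_D assms)
  then show "(\<lambda>h. U h + c * V h) \<in> sob1 P" unfolding sob1_def by blast
  have "AE h in P. \<forall>i. stoch_D P i (\<lambda>h. U h + c * V h) h = stoch_D P i U h + c * stoch_D P i V h"
    using stoch_D_eq[OF D] by (simp add: AE_all_countable)
  then show "AE h in P. grad_D P (\<lambda>h. U h + c * V h) h = grad_D P U h + c *\<^sub>R grad_D P V h"
    by eventually_elim (simp add: grad_D_def vec_eq_iff)
qed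

subsection \<open>Pointwise differentiable functions\<close>

text \<open>The mean value theorem along the orbit bounds the difference quotients by C uniformly in
  t, so dominated convergence turns pointwise differentiability into a derivative in L^2. The bounds
  are almost sure in h but cover the whole orbit.\<close>

lemma has_stoch_deriv_pointwise:
  assumes V: "V \<in> borel_measurable borel" "AE h in P. \<bar>V h\<bar> \<le> C"
    and diff: "\<And>h y. (\<lambda>z. V (shift z h)) differentiable (at y)"
    and bound: "AE h in P. \<forall>y. \<bar>pd i (\<lambda>z. V (shift z h)) y\<bar> \<le> C"
  shows "has_stoch_deriv P i V (\<lambda>h. pd i (\<lambda>z. V (shift z h)) 0)"
proof -
  define W where "W h = pd i (\<lambda>z. V (shift z h)) 0" for h
  have deriv: "((\<lambda>r. V (shift (r *\<^sub>R axis i 1) h)) has_real_derivative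
      pd i (\<lambda>z. V (shift z h)) (s *\<^sub>R axis i 1)) (at s)" for h s
    by (rule pd_line[OF diff])
  have lim: "((\<lambda>t. dq i t V h) \<longlongrightarrow> W h) (at 0)" for h
    using deriv[of h 0] unfolding has_field_derivative_iff W_def dq_def by simp
  have dqm [measurable]: "dq i t V \<in> borel_measurable borel" for t
    using V(1) measurable_comp_shift[OF V(1)] unfolding dq_def[abs_def] by simp
  have "(\<lambda>n. dq i (inverse (real (Suc n))) V h) \<longlonglongrightarrow> W h" for h
    by (rule filterlim_compose[OF lim])
      (use LIMSEQ_inverse_real_of_nat in \<open>simp add: filterlim_at\<close>)
  then have Wm [measurable]: "W \<in> borel_measurable borel"
    by (intro borel_measurable_LIMSEQ_real[OF _ dqm]) auto
  have C: "AE h in P. \<bar>W h\<bar> \<le> C \<and> (\<forall>t. \<bar>dq i t V h\<bar> \<le> C)"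
    using bound
  proof eventually_elim
    case (elim h)
    have "\<bar>dq i t V h\<bar> \<le> C" for t
    \<comment> \<open>At t = 0 the quotient is a division by zero, hence 0, and the claim reduces to
      0 \<le> C.\<close>
    proof (cases "t = 0")
      case False
      have "norm (V (shift (t *\<^sub>R axis i 1) h) - V (shift (0 *\<^sub>R axis i 1) h)) \<le> C * norm (t - 0)"
        by (rule field_differentiable_bound[OF convex_UNIV deriv]) (use elim in auto)
      with False show ?thesis by (simp add: dq_def divide_le_eq abs_divide)
    qed (use elim in \<open>simp add: dq_def order_trans[OF abs_ge_zero]\<close>, use elim in \<open>meson abs_ge_zero order_trans\<close>)
    then show ?case using elim by (simp add: W_def)
  qed
  have VL: "V \<in> L2 P" by (rule L2_bounded[where C = C]) (use V in simp_all)
  have WL: "W \<in> L2 P" by (rule L2_bounded[where C = C]) (use C in auto)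
  have "((\<lambda>t. \<integral>h. (norm (dq i t V h - W h))\<^sup>2 \<partial>P) \<longlongrightarrow> 0) (at 0)"
    unfolding tendsto_at_iff_sequentially
  proof (intro allI impI)
    fix X assume X: "\<forall>n. X n \<in> UNIV - {0 :: real}" "X \<longlonglongrightarrow> 0"
    have "(\<lambda>n. \<integral>h. (norm (dq i (X n) V h - W h))\<^sup>2 \<partial>P) \<longlonglongrightarrow> (\<integral>h. (0::real) \<partial>P)"
    proof (rule integral_dominated_convergence[where w = "\<lambda>_. (2 * C)\<^sup>2"])
      show "AE h in P. (\<lambda>n. (norm (dq i (X n) V h - W h))\<^sup>2) \<longlonglongrightarrow> 0"
      proof (rule AE_I2)
        fix h
        have "(\<lambda>n. dq i (X n) V h) \<longlonglongrightarrow> W h"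
          using lim[of h] X unfolding tendsto_at_iff_sequentially by (auto simp: o_def)
        then have "(\<lambda>n. (norm (dq i (X n) V h - W h))\<^sup>2) \<longlonglongrightarrow> (norm (W h - W h))\<^sup>2"
          by (intro tendsto_intros)
        then show "(\<lambda>n. (norm (dq i (X n) V h - W h))\<^sup>2) \<longlonglongrightarrow> 0" by simp
      qed
      show "AE h in P. norm ((norm (dq i (X n) V h - W h))\<^sup>2) \<le> (2 * C)\<^sup>2" for n
        using C
      proof eventually_elim
        case (elim h)
        then have "\<bar>dq i (X n) V h\<bar> \<le> C" "\<bar>W h\<bar> \<le> C" by blast+
        then have "norm (dq i (X n) V h - W h) \<le> 2 * C"
          using abs_triangle_ineq4[of "dq i (X n) V h" "W h"] by simp
        then have "(norm (dq i (X n) V h - W h))\<^sup>2 \<le> (2 * C)\<^sup>2" by (intro power_mono) auto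
        then show ?case by simp
      qed
    qed auto
    then show "((\<lambda>t. \<integral>h. (norm (dq i t V h - W h))\<^sup>2 \<partial>P) \<circ> X) \<longlonglongrightarrow> 0" by (simp add: o_def)
  qed
  from tendsto_real_sqrt[OF this] have "((\<lambda>t. L2_dist P (dq i t V) W) \<longlongrightarrow> 0) (at 0)"
    by (simp add: L2_dist_def)
  then show ?thesis using VL WL by (simp add: has_stoch_deriv_iff W_def[abs_def])
qed

text \<open>\<open>Cb\<close> asks for deterministic bounds, which the coefficients do not have.
  Here differentiability along orbits holds for every h and the bounds almost surely. Closure under
  sums, products and composition then covers every coefficient.\<close>

definition smooth1 :: "('n C3 \<Rightarrow> real) \<Rightarrow> bool" where
  "smooth1 V \<longleftrightarrow> V \<in> borel_measurable borel \<and> (\<forall>h y. (\<lambda>z. V (shift z h)) differentiable (at y)) \<and>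
     (\<exists>C. AE h in P. \<forall>y. \<bar>V (shift y h)\<bar> \<le> C \<and> (\<forall>k. \<bar>pd k (\<lambda>z. V (shift z h)) y\<bar> \<le> C))"

lemma smooth1_deriv:
  assumes "smooth1 V"
  shows "has_stoch_deriv P i V (\<lambda>h. pd i (\<lambda>z. V (shift z h)) 0)"
proof -
  obtain C where C: "AE h in P. \<forall>y. \<bar>V (shift y h)\<bar> \<le> C \<and> (\<forall>k. \<bar>pd k (\<lambda>z. V (shift z h)) y\<bar> \<le> C)"
    using assms unfolding smooth1_def by blast
  show ?thesis
  proof (rule has_stoch_deriv_pointwise[where C = C])
    show "AE h in P. \<bar>V h\<bar> \<le> C"
      using C by eventually_elim (metis shift_0)
    show "AE h in P. \<forall>y. \<bar>pd i (\<lambda>z. V (shift z h)) y\<bar> \<le> C"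
      using C by eventually_elim blast
  qed (use assms in \<open>auto simp: smooth1_def\<close>)
qed

lemma smooth1_sob1: "smooth1 V \<Longrightarrow> V \<in> sob1 P"
  unfolding sob1_def using smooth1_deriv by blast

lemma smooth1_bounded:
  assumes "smooth1 V"
  obtains C where "AE h in P. \<bar>V h\<bar> \<le> C"
proof -
  obtain C where "AE h in P. \<forall>y. \<bar>V (shift y h)\<bar> \<le> C \<and> (\<forall>k. \<bar>pd k (\<lambda>z. V (shift z h)) y\<bar> \<le> C)"
    using assms unfolding smooth1_def by blast
  then have "AE h in P. \<bar>V h\<bar> \<le> C" by eventually_elim (metis shift_0)
  then show ?thesis by (rule that)
qed

lemma smooth1_const: "smooth1 (\<lambda>h. c)"
  unfolding smooth1_def by (auto simp: pd_const intro!: exI[of _ "\<bar>c\<bar>"])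

lemma smooth1_add:
  assumes U: "smooth1 U" and V: "smooth1 V"
  shows "smooth1 (\<lambda>h. U h + V h)"
proof -
  obtain C where C: "AE h in P. \<forall>y. \<bar>U (shift y h)\<bar> \<le> C \<and> (\<forall>k. \<bar>pd k (\<lambda>z. U (shift z h)) y\<bar> \<le> C)"
    using U unfolding smooth1_def by blast
  obtain D where D: "AE h in P. \<forall>y. \<bar>V (shift y h)\<bar> \<le> D \<and> (\<forall>k. \<bar>pd k (\<lambda>z. V (shift z h)) y\<bar> \<le> D)"
    using V unfolding smooth1_def by blast
  have d: "(\<lambda>z. U (shift z h)) differentiable (at y)" "(\<lambda>z. V (shift z h)) differentiable (at y)" for h y
    using U V unfolding smooth1_def by blast+
  have "AE h in P. \<forall>y. \<bar>U (shift y h) + V (shift y h)\<bar> \<le> C + D \<and>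
      (\<forall>k. \<bar>pd k (\<lambda>z. U (shift z h) + V (shift z h)) y\<bar> \<le> C + D)"
    using C D
  proof eventually_elim
    case (elim h)
    show ?case
    proof (intro allI conjI)
      show "\<bar>U (shift y h) + V (shift y h)\<bar> \<le> C + D" for y
        using elim by (meson abs_triangle_ineq add_mono order_trans)
      show "\<bar>pd k (\<lambda>z. U (shift z h) + V (shift z h)) y\<bar> \<le> C + D" for y k
        unfolding pd_add[OF d] using elim by (meson abs_triangle_ineq add_mono order_trans)
    qed
  qed
  then show ?thesis using U V d unfolding smooth1_def by (intro conjI allI differentiable_add) auto
qed

lemma smooth1_mult:
  assumes U: "smooth1 U" and V: "smooth1 V"
  shows "smooth1 (\<lambda>h. U h * V h)"
proof -
  obtain C where C: "AE h in P. \<forall>y. \<bar>U (shift y h)\<bar> \<le> C \<and> (\<forall>k. \<bar>pd k (\<lambda>z. U (shift z h)) y\<bar> \<le> C)"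
    using U unfolding smooth1_def by blast
  obtain D where D: "AE h in P. \<forall>y. \<bar>V (shift y h)\<bar> \<le> D \<and> (\<forall>k. \<bar>pd k (\<lambda>z. V (shift z h)) y\<bar> \<le> D)"
    using V unfolding smooth1_def by blast
  have d: "(\<lambda>z. U (shift z h)) differentiable (at y)" "(\<lambda>z. V (shift z h)) differentiable (at y)" for h y
    using U V unfolding smooth1_def by blast+
  have "AE h in P. \<forall>y. \<bar>U (shift y h) * V (shift y h)\<bar> \<le> 2 * (C * D) \<and>
      (\<forall>k. \<bar>pd k (\<lambda>z. U (shift z h) * V (shift z h)) y\<bar> \<le> 2 * (C * D))"
    using C D
  proof eventually_elim
    case (elim h)
    have C0: "0 \<le> C" and D0: "0 \<le> D" using elim by (meson abs_ge_zero order_trans)+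
    have m: "\<bar>a * b\<bar> \<le> C * D" if "\<bar>a\<bar> \<le> C" "\<bar>b\<bar> \<le> D" for a b
      unfolding abs_mult using that C0 by (intro mult_mono) auto
    show ?case
    proof (intro allI conjI)
      show "\<bar>U (shift y h) * V (shift y h)\<bar> \<le> 2 * (C * D)" for y
        using m[of "U (shift y h)" "V (shift y h)"] elim mult_nonneg_nonneg[OF C0 D0] by fastforce
      show "\<bar>pd k (\<lambda>z. U (shift z h) * V (shift z h)) y\<bar> \<le> 2 * (C * D)" for y k
      proof -
        have "\<bar>U (shift y h) * pd k (\<lambda>z. V (shift z h)) y\<bar> \<le> C * D"
          "\<bar>pd k (\<lambda>z. U (shift z h)) y * V (shift y h)\<bar> \<le> C * D"
          using elim by (auto intro!: m)
        then show ?thesis unfolding pd_mult[OF d] by linarith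
      qed
    qed
  qed
  then show ?thesis using U V d unfolding smooth1_def by (intro conjI allI differentiable_mult) auto
qed

lemma smooth1_sum: "(\<And>j. j \<in> I \<Longrightarrow> smooth1 (V j)) \<Longrightarrow> smooth1 (\<lambda>h. \<Sum>j\<in>I. V j h)"
  by (induction I rule: infinite_finite_induct) (auto intro: smooth1_const smooth1_add)

text \<open>The lower bound a keeps V away from the singularity of F (square root and reciprocal at
  0, both with a = 1), and the bound C along orbits confines the argument of F to [a, C].\<close>

lemma smooth1_compose:
  assumes V: "smooth1 V" "\<And>h. a \<le> V h"
    and F: "\<And>x. a \<le> x \<Longrightarrow> (F has_real_derivative F' x) (at x)"
    and bound: "\<And>C. \<exists>B. \<forall>x. a \<le> x \<longrightarrow> x \<le> C \<longrightarrow> \<bar>F x\<bar> \<le> B \<and> \<bar>F' x\<bar> \<le> B"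
    and meas: "F \<in> borel_measurable borel"
  shows "smooth1 (\<lambda>h. F (V h))"
proof -
  obtain C where C: "AE h in P. \<forall>y. \<bar>V (shift y h)\<bar> \<le> C \<and> (\<forall>k. \<bar>pd k (\<lambda>z. V (shift z h)) y\<bar> \<le> C)"
    using V unfolding smooth1_def by blast
  have d: "(\<lambda>z. V (shift z h)) differentiable (at y)" for h y
    using V unfolding smooth1_def by blast
  note comp = pd_compose[OF d F[OF V(2)]]
  obtain B where B: "\<And>x. a \<le> x \<Longrightarrow> x \<le> C \<Longrightarrow> \<bar>F x\<bar> \<le> B" "\<And>x. a \<le> x \<Longrightarrow> x \<le> C \<Longrightarrow> \<bar>F' x\<bar> \<le> B"
    using bound[of C] by blast
  \<comment> \<open>B bounds the value, and B * C the derivative given by the chain rule.\<close>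
  have "AE h in P. \<forall>y. \<bar>F (V (shift y h))\<bar> \<le> max B (B * C) \<and>
      (\<forall>k. \<bar>pd k (\<lambda>z. F (V (shift z h))) y\<bar> \<le> max B (B * C))"
    using C
  proof eventually_elim
    case (elim h)
    show ?case
    proof (intro allI conjI)
      fix y k
      have le: "V (shift y h) \<le> C" using elim by (meson abs_le_D1)
      have pdle: "\<bar>pd k (\<lambda>z. V (shift z h)) y\<bar> \<le> C" using elim by blast
      show "\<bar>F (V (shift y h))\<bar> \<le> max B (B * C)"
        using B(1)[OF V(2) le] by simp
      have "\<bar>F' (V (shift y h)) * pd k (\<lambda>z. V (shift z h)) y\<bar> \<le> B * C"
        unfolding abs_mult using B(2)[OF V(2) le] pdle by (intro mult_mono) auto
      then show "\<bar>pd k (\<lambda>z. F (V (shift z h))) y\<bar> \<le> max B (B * C)"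
        unfolding comp(2) by simp
    qed
  qed
  then show ?thesis using V(1) comp(1) measurable_compose[OF _ meas] unfolding smooth1_def by blast
qed

lemma pd_shift_fun:
  assumes "\<And>y. (\<lambda>z. V (shift z h)) differentiable (at y)"
  shows "pd i (\<lambda>z. V (shift z (shift y h))) x = pd i (\<lambda>z. V (shift z h)) (x + y)"
  using pd_shift[OF assms, of i y] by (simp add: shift_shift)

lemma Cb2_facts:
  fixes \<phi> :: "'n C3 \<Rightarrow> real"
  assumes "\<phi> \<in> Cb 2"
  shows "\<And>h. Ck 2 (\<lambda>z. \<phi> (shift z h))" "\<phi> \<in> borel_measurable borel"
    "\<exists>C. \<forall>h y. \<bar>\<phi> h\<bar> \<le> C \<and> (\<forall>k. \<bar>pd k (\<lambda>z. \<phi> (shift z h)) y\<bar> \<le> C)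
      \<and> (\<forall>k j. \<bar>pd k (pd j (\<lambda>z. \<phi> (shift z h))) y\<bar> \<le> C)"
proof -
  show "\<And>h. Ck 2 (\<lambda>z. \<phi> (shift z h))" "\<phi> \<in> borel_measurable borel"
    using assms unfolding Cb_def by blast+
  obtain C where C: "\<And>h x j. j \<le> 2 \<Longrightarrow> dnorm j (\<lambda>y. \<phi> (shift y h)) x \<le> C"
    using assms unfolding Cb_def by blast
  have 0: "\<bar>\<phi> h\<bar> \<le> C" for h using C[of 0 h 0] by (simp only: dnorm.simps(1) shift_0)
  have 1: "\<bar>pd k f y\<bar> \<le> dnorm 1 f y" for f :: "real^'n \<Rightarrow> real" and k y
    using member_le_L2_set[of UNIV k "\<lambda>k. \<bar>pd k f y\<bar>"] by simp
  have 3: "\<bar>pd k (\<lambda>z. \<phi> (shift z h)) y\<bar> \<le> C" for h y k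
  proof -
    have "dnorm 1 (\<lambda>z. \<phi> (shift z h)) y \<le> C" by (rule C) simp
    with 1 show ?thesis by (rule order_trans)
  qed
  have 2: "\<bar>pd k (pd j f) y\<bar> \<le> dnorm 2 f y" for f :: "real^'n \<Rightarrow> real" and k j y
  proof -
    have "dnorm 1 (pd j f) y \<le> dnorm (Suc 1) f y"
      unfolding dnorm.simps(2)[of 1] by (rule member_le_L2_set) auto
    with 1[of k "pd j f" y] show ?thesis by (simp only: numeral_2_eq_2 One_nat_def)
  qed
  have 4: "\<bar>pd k (pd j (\<lambda>z. \<phi> (shift z h))) y\<bar> \<le> C" for h y k j
  proof -
    have "dnorm 2 (\<lambda>z. \<phi> (shift z h)) y \<le> C" by (rule C) simp
    with 2 show ?thesis by (rule order_trans)
  qed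
  from 0 3 4 show "\<exists>C. \<forall>h y. \<bar>\<phi> h\<bar> \<le> C \<and> (\<forall>k. \<bar>pd k (\<lambda>z. \<phi> (shift z h)) y\<bar> \<le> C)
      \<and> (\<forall>k j. \<bar>pd k (pd j (\<lambda>z. \<phi> (shift z h))) y\<bar> \<le> C)" by blast
qed

lemma Cb2_smooth1:
  fixes \<phi> :: "'n C3 \<Rightarrow> real"
  assumes "\<phi> \<in> Cb 2"
  shows "smooth1 \<phi>" "smooth1 (\<lambda>h. pd j (\<lambda>z. \<phi> (shift z h)) 0)"
proof -
  note F = Cb2_facts[OF assms]
  from F(3) obtain C where C: "\<And>h. \<bar>\<phi> h\<bar> \<le> C" "\<And>k h y. \<bar>pd k (\<lambda>z. \<phi> (shift z h)) y\<bar> \<le> C"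
    "\<And>k j h y. \<bar>pd k (pd j (\<lambda>z. \<phi> (shift z h))) y\<bar> \<le> C" by blast
  have d: "(\<lambda>z. \<phi> (shift z h)) differentiable (at y)" "pd j (\<lambda>z. \<phi> (shift z h)) differentiable (at y)" for h y
    using F(1)[of h] by (auto simp: numeral_2_eq_2)
  show 1: "smooth1 \<phi>"
    unfolding smooth1_def using F(2) d(1) C by (intro conjI allI exI[of _ C] AE_I2) simp_all
  \<comment> \<open>The orbit of the derivative at 0 is the derivative of the orbit, so bounds on
    second derivatives of \<phi> become bounds on first derivatives here.\<close>
  have eq: "(\<lambda>y. pd j (\<lambda>z. \<phi> (shift z (shift y h))) 0) = pd j (\<lambda>z. \<phi> (shift z h))" for h
    using pd_shift_fun[OF d(1), of j _ h 0] by (auto simp: fun_eq_iff)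
  show "smooth1 (\<lambda>h. pd j (\<lambda>z. \<phi> (shift z h)) 0)"
    using L2_measurable[OF has_stoch_derivD(2)[OF smooth1_deriv[OF 1, of j]]] d(2) C(2,3)
    unfolding smooth1_def eq
    by (intro conjI allI exI[of _ C] AE_I2) (simp_all add: pd_shift_fun[OF d(1)])
qed

lemma Cb2_sob1: "\<phi> \<in> Cb 2 \<Longrightarrow> \<phi> \<in> sob1 P"
  by (intro smooth1_sob1 Cb2_smooth1)

lemma Cb2_stoch_D: "\<phi> \<in> Cb 2 \<Longrightarrow> AE h in P. stoch_D P i \<phi> h = pd i (\<lambda>z. \<phi> (shift z h)) 0"
  by (intro stoch_D_eq smooth1_deriv Cb2_smooth1)

end

section \<open>The coefficients\<close>

definition outer :: "real^'n \<Rightarrow> real^'n^'n::finite" where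
  "outer p = (\<chi> i j. p $ i * p $ j)"

definition slope :: "('n::finite) C3 \<Rightarrow> real^'n" where
  "slope h = (\<chi> i. pd i (app h) 0)"

lemma outer_mult_vec: "outer p *v x = (p \<bullet> x) *\<^sub>R p"
  by (simp add: outer_def matrix_vector_mult_def vec_eq_iff inner_vec_def sum_distrib_left mult_ac)

text \<open>An orthogonal map sends a multiple of a coordinate vector to p; in the rotated basis the
  matrix is diagonal, with 1 + |p|^2 as the only entry that can differ from 1.\<close>

lemma det_mat1_outer: "det (mat 1 + outer p) = 1 + p \<bullet> p" for p :: "real^'n::finite"
proof -
  obtain k :: 'n where True by simp
  define q :: "real^'n" where "q = axis k (norm p)"
  have "norm q = norm p" by (simp add: q_def norm_eq_sqrt_inner inner_axis_axis)
  then obtain T where T: "orthogonal_transformation T" "T q = p"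
    by (rule orthogonal_transformation_exists)
  define Q where "Q = matrix T"
  have lin: "linear T" and Q: "orthogonal_matrix Q"
    using T(1) unfolding orthogonal_transformation_matrix Q_def by auto
  have Qq: "Q *v q = p" unfolding Q_def using matrix_works[of T q] lin T(2)
    by (simp add: linear_def real_scaleR_def scalar_mult_eq_scaleR[abs_def] fun_eq_iff)
  have "mat 1 + outer p = Q ** (mat 1 + outer q) ** transpose Q"
    unfolding matrix_eq
  proof
    fix x
    have "Q *v (transpose Q *v x) = x"
      using Q unfolding matrix_vector_mul_assoc by (simp add: orthogonal_matrix_def)
    moreover have "q \<bullet> (transpose Q *v x) = p \<bullet> x"
      unfolding transpose_matrix_vector inner_commute[of q] dot_lmul_matrix Qq by (rule inner_commute)
    ultimately show "(mat 1 + outer p) *v x = (Q ** (mat 1 + outer q) ** transpose Q) *v x"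
      by (simp add: matrix_vector_mult_add_rdistrib outer_mult_vec matrix_vector_right_distrib
          matrix_vector_mult_scaleR Qq flip: matrix_vector_mul_assoc)
  qed
  then have "det (mat 1 + outer p) = (det Q * det Q) * det (mat 1 + outer q)"
    by (simp add: det_mul)
  also have "det Q * det Q = 1" using det_orthogonal_matrix[OF Q] by auto
  also have "det (mat 1 + outer q) = (\<Prod>i\<in>UNIV. (mat 1 + outer q) $ i $ i)"
    by (rule det_diagonal) (auto simp: mat_def outer_def q_def axis_def)
  also have "\<dots> = (\<Prod>i\<in>UNIV. if i = k then 1 + (norm p)\<^sup>2 else 1)"
    by (intro prod.cong refl) (simp add: mat_def outer_def q_def axis_def power2_eq_square)
  also have "\<dots> = 1 + (norm p)\<^sup>2" by simp
  finally show ?thesis by (simp add: power2_norm_eq_inner)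
qed

lemma matrix_inv_eqI:
  fixes A B :: "real^'n^'n::finite"
  assumes "A ** B = mat 1"
  shows "matrix_inv A = B"
proof -
  have BA: "B ** A = mat 1" using assms by (simp add: matrix_left_right_inverse)
  have "A ** matrix_inv A = mat 1 \<and> matrix_inv A ** A = mat 1"
    unfolding matrix_inv_def by (rule someI[of _ B]) (use assms BA in simp)
  then have "B ** (A ** matrix_inv A) = B" by simp
  then show ?thesis by (simp add: matrix_mul_assoc BA)
qed

lemma metric_g_0: "metric_g 0 h = mat 1 + outer (slope h)"
  by (simp add: metric_g_def outer_def slope_def)

text \<open>Exhibits the coefficients as stationary fields; the spatial derivatives in
  \<open>drift\<close> thereby become derivatives along orbits.\<close>

lemma metric_g_shift: "metric_g y h = metric_g 0 (shift y h)"
proof -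
  have "pd i (app (shift y h)) 0 = pd i (app h) y" for i
    unfolding app_shift using pd_shift[of "app h" 0 y i] Ck_differentiable[OF Ck_app[of h]] by simp
  then show ?thesis by (simp add: metric_g_def)
qed

lemma vol_shift: "vol y h = vol 0 (shift y h)"
  unfolding vol_def metric_g_shift[of y] ..

lemma ginv_shift: "ginv y h = ginv 0 (shift y h)"
  unfolding ginv_def metric_g_shift[of y] ..

lemma vol_eq: "vol 0 h = sqrt (1 + slope h \<bullet> slope h)"
  by (simp add: vol_def metric_g_0 det_mat1_outer)

lemma vol_sq: "(vol 0 h)\<^sup>2 = 1 + slope h \<bullet> slope h"
  by (simp add: vol_eq)

lemma vol_ge_1: "1 \<le> vol 0 h"
  by (simp add: vol_eq)

lemma vol_pos: "0 < vol 0 h"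
  using vol_ge_1[of h] by linarith

text \<open>The Sherman-Morrison formula, with denominator 1 + |p|^2 = |g|.\<close>

lemma ginv_eq: "ginv 0 h = mat 1 - (1 / (vol 0 h)\<^sup>2) *\<^sub>R outer (slope h)"
  unfolding ginv_def metric_g_0
proof (rule matrix_inv_eqI, unfold matrix_eq, rule allI)
  fix x
  let ?p = "slope h"
  have "(mat 1 + outer ?p) *v ((mat 1 - (1 / (vol 0 h)\<^sup>2) *\<^sub>R outer ?p) *v x)
      = x + ((?p \<bullet> x) - (?p \<bullet> x) / (vol 0 h)\<^sup>2 - (?p \<bullet> x) / (vol 0 h)\<^sup>2 * (?p \<bullet> ?p)) *\<^sub>R ?p"
    by (simp add: matrix_vector_mult_add_rdistrib matrix_vector_mult_diff_rdistrib outer_mult_vec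
        matrix_vector_right_distrib matrix_vector_mult_diff_distrib matrix_vector_mult_scaleR
        inner_diff_right algebra_simps flip: scaleR_matrix_vector_assoc)
  also have "(?p \<bullet> x) - (?p \<bullet> x) / (vol 0 h)\<^sup>2 - (?p \<bullet> x) / (vol 0 h)\<^sup>2 * (?p \<bullet> ?p)
      = (?p \<bullet> x) * (1 - (1 + ?p \<bullet> ?p) / (vol 0 h)\<^sup>2)"
    by (simp add: algebra_simps add_divide_distrib)
  also have "\<dots> = 0"
    using vol_sq[of h] vol_pos[of h] by (metis diff_self divide_self_if mult_zero_right not_less_iff_gr_or_eq zero_less_power)
  finally show "((mat 1 + outer ?p) ** (mat 1 - (1 / (vol 0 h)\<^sup>2) *\<^sub>R outer ?p)) *v x = mat 1 *v x"
    by (simp add: matrix_vector_mul_assoc)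
qed

text \<open>The weight sqrt|g| is absorbed into the inverse metric so that every energy is an
  integral of V . flux W against P itself.\<close>

definition flux :: "('n::finite) C3 \<Rightarrow> real^'n \<Rightarrow> real^'n" where
  "flux h x = vol 0 h *\<^sub>R (ginv 0 h *v x)"

lemma flux_eq: "flux h x = vol 0 h *\<^sub>R x - ((slope h \<bullet> x) / vol 0 h) *\<^sub>R slope h"
  using vol_pos[of h] unfolding flux_def ginv_eq
  by (simp add: matrix_vector_mult_diff_rdistrib outer_mult_vec scaleR_diff_right power2_eq_square
      flip: scaleR_matrix_vector_assoc)

lemma linear_flux: "linear (flux h)"
  unfolding flux_eq[abs_def]
  by (rule linearI) (simp_all add: algebra_simps inner_add_right add_divide_distrib)

lemmas flux_diff = linear_diff[OF linear_flux]

lemma flux_component: "flux h x $ i = (\<Sum>j\<in>UNIV. (vol 0 h * ginv 0 h $ i $ j) * x $ j)"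
  by (simp add: flux_def matrix_vector_mult_def sum_distrib_left mult.assoc)

section \<open>Spectral bounds for the weighted inverse metric\<close>

lemma inner_flux: "x \<bullet> flux h y = vol 0 h * (x \<bullet> y) - (slope h \<bullet> x) * (slope h \<bullet> y) / vol 0 h"
  by (simp add: flux_eq inner_diff_right inner_commute)

lemma inner_flux_commute: "x \<bullet> flux h y = y \<bullet> flux h x"
  by (simp add: inner_flux inner_commute mult.commute)

lemma slope_inner_sq: "(slope h \<bullet> x)\<^sup>2 \<le> ((vol 0 h)\<^sup>2 - 1) * (x \<bullet> x)"
  using Cauchy_Schwarz_ineq[of "slope h" x] by (simp add: vol_sq)

text \<open>Along \<open>slope h\<close> the map \<open>flux h\<close> multiplies by 1 / vol, on the
  orthogonal complement by vol. As vol \<ge> 1 these are the two extremes, used here and in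
  \<open>inner_flux_upper\<close>.\<close>

lemma inner_flux_lower: "(x \<bullet> x) / vol 0 h \<le> x \<bullet> flux h x"
proof -
  have "x \<bullet> flux h x - (x \<bullet> x) / vol 0 h = (((vol 0 h)\<^sup>2 - 1) * (x \<bullet> x) - (slope h \<bullet> x)\<^sup>2) / vol 0 h"
    using vol_pos[of h] by (simp add: inner_flux field_simps power2_eq_square)
  also have "\<dots> \<ge> 0" using slope_inner_sq[of h x] vol_pos[of h] by simp
  finally show ?thesis by simp
qed

lemma inner_flux_upper: "x \<bullet> flux h x \<le> vol 0 h * (x \<bullet> x)"
  using vol_pos[of h] by (simp add: inner_flux)

lemma inner_flux_nonneg: "0 \<le> x \<bullet> flux h x"
  using inner_flux_lower[of x h] vol_pos[of h] by (meson divide_nonneg_pos inner_ge_zero order_trans)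

text \<open>The triangle inequality loses a factor 2, which is harmless: the bound serves only to
  make the flux a bounded operator on L^2.\<close>

lemma norm_flux_le: "norm (flux h x) \<le> 2 * vol 0 h * norm x"
proof -
  have "norm (flux h x) \<le> vol 0 h * norm x + \<bar>slope h \<bullet> x\<bar> / vol 0 h * norm (slope h)"
    unfolding flux_eq using vol_pos[of h] norm_triangle_ineq4[of "vol 0 h *\<^sub>R x" "(slope h \<bullet> x / vol 0 h) *\<^sub>R slope h"]
    by (simp add: abs_divide)
  also have "\<bar>slope h \<bullet> x\<bar> / vol 0 h * norm (slope h) \<le> vol 0 h * norm x"
  proof -
    have "\<bar>slope h \<bullet> x\<bar> * norm (slope h) \<le> (norm (slope h) * norm x) * norm (slope h)"
      by (intro mult_right_mono Cauchy_Schwarz_ineq2) auto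
    also have "\<dots> = (slope h \<bullet> slope h) * norm x"
      by (simp add: dot_square_norm power2_eq_square)
    also have "\<dots> \<le> (vol 0 h)\<^sup>2 * norm x"
      by (intro mult_right_mono) (simp_all add: vol_sq)
    finally show ?thesis using vol_pos[of h] by (simp add: field_simps power2_eq_square)
  qed
  finally show ?thesis by (simp add: algebra_simps)
qed

lemma metric_inner: "x \<bullet> (metric_g 0 h *v y) = x \<bullet> y + (slope h \<bullet> x) * (slope h \<bullet> y)"
  by (simp add: metric_g_0 matrix_vector_mult_add_rdistrib outer_mult_vec inner_add_right inner_commute)

context admissible_measure
begin

lemma gradient_bounded:
  obtains K where "AE h in P. \<forall>y. (\<forall>i. \<bar>pd i (app h) y\<bar> \<le> K) \<and> (\<forall>i k. \<bar>pd k (pd i (app h)) y\<bar> \<le> K)"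
proof -
  obtain K where K: "AE h in P. \<forall>x. dnorm 1 (app h) x + dnorm 2 (app h) x \<le> K"
    using admissible unfolding admissible_def by (elim conjE exE)
  have 1: "\<bar>pd i f y\<bar> \<le> dnorm 1 f y" for f :: "real^'n \<Rightarrow> real" and i y
    using member_le_L2_set[of UNIV i "\<lambda>k. \<bar>pd k f y\<bar>"] by simp
  have 2: "\<bar>pd k (pd i f) y\<bar> \<le> dnorm 2 f y" for f :: "real^'n \<Rightarrow> real" and k i y
  proof -
    have "dnorm 1 (pd i f) y \<le> dnorm (Suc 1) f y"
      unfolding dnorm.simps(2)[of 1] by (rule member_le_L2_set) auto
    with 1[of k "pd i f" y] show ?thesis by (simp only: numeral_2_eq_2 One_nat_def)
  qed
  have "AE h in P. \<forall>y. (\<forall>i. \<bar>pd i (app h) y\<bar> \<le> K) \<and> (\<forall>i k. \<bar>pd k (pd i (app h)) y\<bar> \<le> K)"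
    using K
  proof eventually_elim
    case (elim h)
    show ?case
    proof (intro allI conjI)
      show "\<bar>pd i (app h) y\<bar> \<le> K" for i y
        using elim[rule_format, of y] 1[of i "app h" y] dnorm_nonneg[of 2 "app h" y] by linarith
      show "\<bar>pd k (pd i (app h)) y\<bar> \<le> K" for i k y
        using elim[rule_format, of y] 2[of k i "app h" y] dnorm_nonneg[of 1 "app h" y] by linarith
    qed
  qed
  then show ?thesis by (rule that)
qed

lemma slope_shift: "slope (shift z h) $ i = pd i (app h) z"
  unfolding slope_def app_shift using pd_shift[of "app h" 0 z i] Ck_differentiable[OF Ck_app[of h]] by simp

lemma smooth1_slope: "smooth1 (\<lambda>h. slope h $ i)"
  unfolding smooth1_def slope_shift
proof (intro conjI allI)
  show "(\<lambda>h. slope h $ i) \<in> borel_measurable borel"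
    unfolding slope_def
    by (intro borel_measurable_continuous_onI continuous_at_imp_continuous_on ballI)
      (simp add: isCont_pd)
  have "Ck (Suc (Suc (Suc 0))) (app h)" for h :: "'n C3"
    using Ck_app by (simp add: numeral_3_eq_3 del: Ck.simps)
  then have d: "(pd i (app h)) differentiable (at y)" for h :: "'n C3" and y by simp
  then show "(\<lambda>z. pd i (app h) z) differentiable (at y)" for h :: "'n C3" and y by simp
  obtain K where "AE h in P. \<forall>y. (\<forall>i. \<bar>pd i (app h) y\<bar> \<le> K) \<and> (\<forall>i k. \<bar>pd k (pd i (app h)) y\<bar> \<le> K)"
    by (rule gradient_bounded)
  then have "AE h in P. \<forall>y. \<bar>pd i (app h) y\<bar> \<le> K \<and> (\<forall>k. \<bar>pd k (\<lambda>z. pd i (app h) z) y\<bar> \<le> K)"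
    by eventually_elim simp
  then show "\<exists>C. AE h in P. \<forall>y. \<bar>pd i (app h) y\<bar> \<le> C \<and> (\<forall>k. \<bar>pd k (\<lambda>z. pd i (app h) z) y\<bar> \<le> C)"
    by blast
qed

lemma smooth1_vol: "smooth1 (vol 0)"
proof -
  have "smooth1 (\<lambda>h. 1 + (\<Sum>i\<in>UNIV. slope h $ i * slope h $ i))"
    by (intro smooth1_add smooth1_const smooth1_sum smooth1_mult smooth1_slope)
  then have s: "smooth1 (\<lambda>h. 1 + slope h \<bullet> slope h)" by (simp add: inner_vec_def)
  have "smooth1 (\<lambda>h. sqrt (1 + slope h \<bullet> slope h))"
  proof (rule smooth1_compose[OF s, where a = 1 and F' = "\<lambda>x. inverse (sqrt x) / 2"])
    show "(sqrt has_real_derivative inverse (sqrt x) / 2) (at x)" if "1 \<le> x" for x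
      using that by (intro DERIV_real_sqrt) simp
    show "\<exists>B. \<forall>x. 1 \<le> x \<longrightarrow> x \<le> C \<longrightarrow> \<bar>sqrt x\<bar> \<le> B \<and> \<bar>inverse (sqrt x) / 2\<bar> \<le> B" for C
    proof (intro exI[of _ "max 1 (sqrt C)"] allI impI conjI)
      fix x :: real assume x: "1 \<le> x" "x \<le> C"
      then show "\<bar>sqrt x\<bar> \<le> max 1 (sqrt C)" by simp
      have "inverse (sqrt x) \<le> 1" using x by (intro inverse_le_1_iff[THEN iffD2]) auto
      then have "\<bar>inverse (sqrt x) / 2\<bar> \<le> 1" using x by simp
      then show "\<bar>inverse (sqrt x) / 2\<bar> \<le> max 1 (sqrt C)" by simp
    qed
  qed auto
  then show ?thesis by (simp add: vol_eq[abs_def])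
qed

lemma smooth1_inverse_vol: "smooth1 (\<lambda>h. inverse (vol 0 h))"
proof (rule smooth1_compose[OF smooth1_vol vol_ge_1, where F' = "\<lambda>x. - (inverse x ^ Suc (Suc 0))"])
  show "(inverse has_real_derivative - (inverse x ^ Suc (Suc 0))) (at x)" if "1 \<le> x" for x :: real
    using that by (intro DERIV_inverse) simp
  show "\<exists>B. \<forall>x. 1 \<le> x \<longrightarrow> x \<le> C \<longrightarrow> \<bar>inverse x\<bar> \<le> B \<and> \<bar>- (inverse x ^ Suc (Suc 0))\<bar> \<le> B" for C :: real
  proof (intro exI[of _ 1] allI impI conjI)
    fix x :: real assume x: "1 \<le> x" "x \<le> C"
    then show *: "\<bar>inverse x\<bar> \<le> 1" by (simp add: inverse_le_1_iff)
    have "inverse x ^ Suc (Suc 0) \<le> 1" using x * by (intro power_le_one) auto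
    then show "\<bar>- (inverse x ^ Suc (Suc 0))\<bar> \<le> 1" using x by simp
  qed
qed auto

definition coeff :: "'n \<Rightarrow> 'n \<Rightarrow> 'n C3 \<Rightarrow> real" where
  "coeff i j h = vol 0 h * ginv 0 h $ i $ j"

lemma smooth1_coeff: "smooth1 (coeff i j)"
proof -
  have "coeff i j h = vol 0 h * mat 1 $ i $ j
      + (-1) * ((slope h $ i * slope h $ j) * inverse (vol 0 h))" for h
    using vol_pos[of h] by (simp add: coeff_def ginv_eq outer_def field_simps power2_eq_square)
  moreover have "smooth1 (\<lambda>h. vol 0 h * mat 1 $ i $ j
      + (-1) * ((slope h $ i * slope h $ j) * inverse (vol 0 h)))"
    by (intro smooth1_add smooth1_const smooth1_mult smooth1_slope smooth1_vol smooth1_inverse_vol)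
  ultimately show ?thesis by presburger
qed

lemma vol_measurable [measurable]: "vol 0 \<in> borel_measurable (borel :: 'n C3 measure)"
  using smooth1_vol by (simp add: smooth1_def)

lemma slope_measurable [measurable]: "slope \<in> borel_measurable (borel :: 'n C3 measure)"
  using L2_measurable[OF L2_vecI[OF has_stoch_derivD(1)[OF smooth1_deriv[OF smooth1_slope]]]] by simp

lemma vol_bounded: obtains C where "1 \<le> C" "AE h in P. vol 0 h \<le> C"
proof -
  obtain C where C: "AE h in P. \<bar>vol 0 h\<bar> \<le> C" by (rule smooth1_bounded[OF smooth1_vol])
  have "AE h in P. vol 0 h \<le> max 1 C" using C by eventually_elim auto
  then show ?thesis using that[of "max 1 C"] by simp
qed

lemma vol_L2: "vol 0 \<in> L2 P"
  by (rule has_stoch_derivD(1)[OF smooth1_deriv[OF smooth1_vol]])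

lemma Znorm_ge_1: "1 \<le> Znorm P"
proof -
  have "(\<integral>h. 1 \<partial>P) \<le> (\<integral>h. vol 0 h \<partial>P)"
    by (intro integral_mono L2_integrable[OF vol_L2] vol_ge_1) simp
  then show ?thesis using prob_space by (simp add: Znorm_def)
qed

lemma flux_measurable:
  "V \<in> borel_measurable borel \<Longrightarrow> (\<lambda>h. flux h (V h)) \<in> borel_measurable borel"
  for V :: "'n C3 \<Rightarrow> real^'n"
  unfolding flux_eq
  by (intro borel_measurable_diff borel_measurable_scaleR borel_measurable_divide
      borel_measurable_inner vol_measurable slope_measurable)

lemma flux_bound:
  obtains C where "0 \<le> C" "\<And>V. V \<in> L2 P \<Longrightarrow> (\<lambda>h. flux h (V h)) \<in> L2 P"
    "\<And>V. V \<in> L2 P \<Longrightarrow> L2_norm P (\<lambda>h. flux h (V h)) \<le> C * L2_norm P V"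
proof -
  obtain K where K: "1 \<le> K" "AE h in P. vol 0 h \<le> K" by (rule vol_bounded)
  have "AE h in P. norm (flux h (V h)) \<le> 2 * K * norm (V h)" for V
    using K(2)
  proof eventually_elim
    case (elim h)
    have "2 * vol 0 h * norm (V h) \<le> 2 * K * norm (V h)"
      using elim by (intro mult_right_mono) auto
    then show ?case using norm_flux_le[of h "V h"] by linarith
  qed
  note bound = this
  have m: "(\<lambda>h. flux h (V h)) \<in> borel_measurable P" if "V \<in> L2 P" for V
    using flux_measurable L2_measurable[OF that] by simp
  show ?thesis
    by (rule that[of "2 * K"]) (use K L2_dominated[OF m _ bound] in auto)
qed

lemma flux_L2: "V \<in> L2 P \<Longrightarrow> (\<lambda>h. flux h (V h)) \<in> L2 P"
  by (rule flux_bound) blast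

lemma flux_tendsto:
  assumes "\<And>n. V n \<in> L2 P" "W \<in> L2 P" "((\<lambda>n. L2_dist P (V n) W) \<longlongrightarrow> 0) F"
  shows "((\<lambda>n. L2_dist P (\<lambda>h. flux h (V n h)) (\<lambda>h. flux h (W h))) \<longlongrightarrow> 0) F"
proof -
  obtain C where C: "0 \<le> C" "\<And>V. V \<in> L2 P \<Longrightarrow> L2_norm P (\<lambda>h. flux h (V h)) \<le> C * L2_norm P V"
    by (rule flux_bound) blast
  have lim: "((\<lambda>n. C * L2_dist P (V n) W) \<longlongrightarrow> 0) F"
    using tendsto_mult_right_zero[OF assms(3)] by simp
  have "L2_dist P (\<lambda>h. flux h (V n h)) (\<lambda>h. flux h (W h)) \<le> C * L2_dist P (V n) W" for n
    using C(2)[OF L2_diff[OF assms(1,2)], of n] by (simp add: L2_dist_eq_norm flux_diff)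
  then show ?thesis
    by (intro tendsto_sandwich[OF always_eventually always_eventually tendsto_const lim]) auto
qed

subsection \<open>The measure \<open>\<pi>\<close>\<close>

lemma density_nonneg: "0 \<le> vol 0 h / Znorm P"
  using vol_pos[of h] Znorm_ge_1 by simp

lemma integral_piM:
  assumes [measurable]: "f \<in> borel_measurable borel"
  shows "(\<integral>h. f h \<partial>piM P) = (\<integral>h. f h * vol 0 h \<partial>P) / Znorm P"
proof -
  have "(\<integral>h. f h \<partial>piM P) = (\<integral>h. vol 0 h / Znorm P * f h \<partial>P)"
    unfolding piM_def using density_nonneg by (intro integral_real_density) auto
  also have "\<dots> = (\<integral>h. f h * vol 0 h / Znorm P \<partial>P)" by (simp add: mult.commute)
  finally show ?thesis by simp
qed

lemma AE_piM: "(AE h in piM P. Q h) \<longleftrightarrow> (AE h in P. Q h)"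
proof -
  have "0 < vol 0 h / Znorm P" for h using vol_pos[of h] Znorm_ge_1 by simp
  then show ?thesis unfolding piM_def by (subst AE_density) auto
qed

lemma measurable_piM [simp]: "f \<in> borel_measurable (piM P) \<longleftrightarrow> f \<in> borel_measurable borel"
  unfolding piM_def by simp

text \<open>The density of \<pi> lies between 1 / Z and, almost surely, K / Z, so both measures have
  the same square-integrable functions.\<close>

lemma L2_piM: "f \<in> L2 (piM P) \<longleftrightarrow> f \<in> L2 P" for f :: "'n C3 \<Rightarrow> real"
proof -
  obtain K where K: "1 \<le> K" "AE h in P. vol 0 h \<le> K" by (rule vol_bounded)
  have "integrable (piM P) (\<lambda>h. (norm (f h))\<^sup>2) \<longleftrightarrow> integrable P (\<lambda>h. (norm (f h))\<^sup>2)"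
    if [measurable]: "f \<in> borel_measurable borel"
  proof -
    have "integrable (piM P) (\<lambda>h. (norm (f h))\<^sup>2) \<longleftrightarrow> integrable P (\<lambda>h. vol 0 h / Znorm P * (norm (f h))\<^sup>2)"
      unfolding piM_def using density_nonneg by (intro integrable_real_density) auto
    also have "\<dots> \<longleftrightarrow> integrable P (\<lambda>h. (norm (f h))\<^sup>2)"
    proof
      assume i: "integrable P (\<lambda>h. vol 0 h / Znorm P * (norm (f h))\<^sup>2)"
      show "integrable P (\<lambda>h. (norm (f h))\<^sup>2)"
      proof (rule Bochner_Integration.integrable_bound[OF integrable_mult_right[OF i, of "Znorm P"]])
        have "(norm (f h))\<^sup>2 \<le> vol 0 h * (norm (f h))\<^sup>2" for h
          using mult_right_mono[OF vol_ge_1[of h], of "(norm (f h))\<^sup>2"] by simp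
        then show "AE h in P. norm ((norm (f h))\<^sup>2) \<le> norm (Znorm P * (vol 0 h / Znorm P * (norm (f h))\<^sup>2))"
          using Znorm_ge_1 by (auto simp: abs_mult abs_of_pos[OF vol_pos])
      qed simp
    next
      assume i: "integrable P (\<lambda>h. (norm (f h))\<^sup>2)"
      show "integrable P (\<lambda>h. vol 0 h / Znorm P * (norm (f h))\<^sup>2)"
      proof (rule Bochner_Integration.integrable_bound[OF integrable_mult_right[OF i, of "K / Znorm P"]])
        show "AE h in P. norm (vol 0 h / Znorm P * (norm (f h))\<^sup>2) \<le> norm (K / Znorm P * (norm (f h))\<^sup>2)"
          using K(2)
        proof eventually_elim
          case (elim h)
          have "vol 0 h / Znorm P * (norm (f h))\<^sup>2 \<le> K / Znorm P * (norm (f h))\<^sup>2"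
            using elim Znorm_ge_1 by (intro mult_right_mono divide_right_mono) auto
          moreover have "0 \<le> vol 0 h / Znorm P * (norm (f h))\<^sup>2"
            using Znorm_ge_1 vol_pos[of h] by simp
          ultimately show ?case unfolding real_norm_def by linarith
        qed
      qed simp
    qed
    finally show ?thesis .
  qed
  then show ?thesis by (auto simp: L2_def)
qed

text \<open>From the lower bound 1 / Z of the density. It transfers to L^2(P) the convergence that
  \<open>represents1\<close> states in L^2(\<pi>).\<close>

lemma L2_dist_piM:
  fixes f g :: "'n C3 \<Rightarrow> real"
  assumes "f \<in> L2 P" "g \<in> L2 P"
  shows "L2_dist P f g \<le> sqrt (Znorm P) * L2_dist (piM P) f g"
proof -
  have [measurable]: "f \<in> borel_measurable borel" "g \<in> borel_measurable borel"
    using assms by (simp_all add: L2_def)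
  have i: "integrable P (\<lambda>h. (norm (f h - g h))\<^sup>2)" by (intro L2_integrable_sq L2_diff assms)
  obtain K where K: "1 \<le> K" "AE h in P. vol 0 h \<le> K" by (rule vol_bounded)
  have "(\<integral>h. (norm (f h - g h))\<^sup>2 \<partial>P) \<le> (\<integral>h. (norm (f h - g h))\<^sup>2 * vol 0 h \<partial>P)"
  proof (rule integral_mono[OF i])
    show "integrable P (\<lambda>h. (norm (f h - g h))\<^sup>2 * vol 0 h)"
    proof (rule Bochner_Integration.integrable_bound[OF integrable_mult_right[OF i, of K]])
      show "AE h in P. norm ((norm (f h - g h))\<^sup>2 * vol 0 h) \<le> norm (K * (norm (f h - g h))\<^sup>2)"
        using K(2)
      proof eventually_elim
        case (elim h)
        then show ?case using vol_pos[of h] mult_right_mono[OF elim, of "(norm (f h - g h))\<^sup>2"]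
          by (simp add: abs_mult mult.commute)
      qed
    qed simp
    show "(norm (f h - g h))\<^sup>2 \<le> (norm (f h - g h))\<^sup>2 * vol 0 h" for h
      using mult_left_mono[OF vol_ge_1[of h], of "(norm (f h - g h))\<^sup>2"] by simp
  qed
  also have "\<dots> = Znorm P * (\<integral>h. (norm (f h - g h))\<^sup>2 \<partial>piM P)"
    using Znorm_ge_1 by (subst integral_piM) auto
  finally show ?thesis
    unfolding L2_dist_def by (metis real_sqrt_le_mono real_sqrt_mult)
qed

subsection \<open>The generator in divergence form\<close>

text \<open>\<open>stoch_D\<close> is an arbitrary function where no derivative exists. Replacing
  the chosen gradient by its pointwise version gives a \<open>smooth1\<close> function, so the
  derivatives inside \<open>Lhat\<close> are genuine.\<close>

lemma flux_grad_deriv: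
  assumes "\<phi> \<in> Cb 2"
  shows "\<exists>W. has_stoch_deriv P i (\<lambda>h. flux h (grad_D P \<phi> h) $ i) W"
proof -
  have sm: "smooth1 (\<lambda>h. \<Sum>j\<in>UNIV. coeff i j h * pd j (\<lambda>z. \<phi> (shift z h)) 0)"
    by (intro smooth1_sum smooth1_mult smooth1_coeff Cb2_smooth1 assms)
  have "AE h in P. \<forall>j. stoch_D P j \<phi> h = pd j (\<lambda>z. \<phi> (shift z h)) 0"
    using Cb2_stoch_D[OF assms] by (simp add: AE_all_countable)
  then have ae: "AE h in P. (\<Sum>j\<in>UNIV. coeff i j h * pd j (\<lambda>z. \<phi> (shift z h)) 0) = flux h (grad_D P \<phi> h) $ i"
    by eventually_elim (simp add: flux_component coeff_def grad_D_def)
  have "(\<lambda>h. flux h (grad_D P \<phi> h) $ i) \<in> L2 P"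
    by (intro L2_vecD flux_L2 grad_D_L2 Cb2_sob1 assms)
  then have "(\<lambda>h. flux h (grad_D P \<phi> h) $ i) \<in> borel_measurable borel" by (simp add: L2_def)
  from has_stoch_deriv_cong[OF smooth1_deriv[OF sm] this ae] show ?thesis by blast
qed

text \<open>The factor vol, which is Z times the density of \<pi>, cancels the prefactor of
  \<open>Lhat\<close> and leaves a divergence to be integrated by parts.\<close>

lemma Lhat_weak:
  assumes \<phi>: "\<phi> \<in> Cb 2" and \<psi>: "\<psi> \<in> sob1 P"
  shows "(\<integral>h. \<psi> h * Lhat P \<phi> h * vol 0 h \<partial>P) = - (\<integral>h. grad_D P \<psi> h \<bullet> flux h (grad_D P \<phi> h) \<partial>P)"
proof -
  define F where "F i h = flux h (grad_D P \<phi> h) $ i" for i h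
  have D: "has_stoch_deriv P i (F i) (stoch_D P i (F i))" for i
    using flux_grad_deriv[OF \<phi>, of i] has_stoch_deriv_stoch_D unfolding F_def by blast
  have "(\<integral>h. \<psi> h * Lhat P \<phi> h * vol 0 h \<partial>P) = (\<integral>h. (\<Sum>i\<in>UNIV. \<psi> h * stoch_D P i (F i) h) \<partial>P)"
  proof (intro Bochner_Integration.integral_cong refl)
    fix h
    show "\<psi> h * Lhat P \<phi> h * vol 0 h = (\<Sum>i\<in>UNIV. \<psi> h * stoch_D P i (F i) h)"
      using vol_pos[of h] by (simp add: Lhat_def div_D_def F_def[abs_def] flux_def sum_distrib_left)
  qed
  also have "\<dots> = (\<Sum>i\<in>UNIV. \<integral>h. \<psi> h * stoch_D P i (F i) h \<partial>P)"
    by (intro Bochner_Integration.integral_sum L2_integrable_mult sob1_L2 \<psi> has_stoch_derivD(2)[OF D])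
  also have "\<dots> = (\<Sum>i\<in>UNIV. - (\<integral>h. F i h * stoch_D P i \<psi> h \<partial>P))"
    by (intro sum.cong refl integration_by_parts[OF D sob1_stoch_D[OF \<psi>]])
  also have "\<dots> = - (\<integral>h. flux h (grad_D P \<phi> h) \<bullet> grad_D P \<psi> h \<partial>P)"
    unfolding L2_inner_vec[OF flux_L2[OF grad_D_L2[OF Cb2_sob1[OF \<phi>]]] grad_D_L2[OF \<psi>]]
    by (simp add: F_def grad_D_def sum_negf)
  finally show ?thesis by (simp add: inner_commute)
qed

text \<open>Formally F . e is the generator applied to the linear function x \<mapsto> e . x, whose
  gradient is the constant field e; hence the same weak form with e in place of a gradient.\<close>

lemma drift_weak:
  assumes \<phi>: "\<phi> \<in> Cb 2"
  shows "(\<integral>h. (drift 0 h \<bullet> e) * \<phi> h * vol 0 h \<partial>P) = - (\<integral>h. e \<bullet> flux h (grad_D P \<phi> h) \<partial>P)"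
proof -
  define C' where "C' i j h = pd j (\<lambda>z. coeff i j (shift z h)) 0" for i j h
  have D: "has_stoch_deriv P j (coeff i j) (C' i j)" for i j
    unfolding C'_def by (rule smooth1_deriv[OF smooth1_coeff])
  note D\<phi> = sob1_stoch_D[OF Cb2_sob1[OF \<phi>]]
  have "(\<integral>h. (drift 0 h \<bullet> e) * \<phi> h * vol 0 h \<partial>P)
      = (\<integral>h. (\<Sum>i\<in>UNIV. \<Sum>j\<in>UNIV. e $ i * (\<phi> h * C' i j h)) \<partial>P)"
  proof (intro Bochner_Integration.integral_cong refl)
    fix h
    \<comment> \<open>Stationarity of the coefficients identifies the spatial derivative at 0 with
      the derivative along the orbit.\<close>
    have "drift 0 h $ i = (\<Sum>j\<in>UNIV. C' i j h) / vol 0 h" for i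
      unfolding drift_def C'_def coeff_def vol_shift[symmetric] ginv_shift[symmetric] by simp
    then have "(drift 0 h \<bullet> e) * \<phi> h * vol 0 h = (\<Sum>i\<in>UNIV. (\<Sum>j\<in>UNIV. C' i j h) * e $ i) * \<phi> h"
      using vol_pos[of h] by (simp add: inner_vec_def flip: sum_divide_distrib)
    then show "(drift 0 h \<bullet> e) * \<phi> h * vol 0 h = (\<Sum>i\<in>UNIV. \<Sum>j\<in>UNIV. e $ i * (\<phi> h * C' i j h))"
      by (simp add: sum_distrib_right sum_distrib_left mult_ac)
  qed
  also have "\<dots> = (\<Sum>i\<in>UNIV. \<Sum>j\<in>UNIV. e $ i * (\<integral>h. \<phi> h * C' i j h \<partial>P))"
    using L2_integrable_mult[OF has_stoch_derivD(1)[OF D\<phi>] has_stoch_derivD(2)[OF D]]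
    by (simp add: Bochner_Integration.integral_sum)
  also have "\<dots> = (\<Sum>i\<in>UNIV. \<Sum>j\<in>UNIV. e $ i * (- (\<integral>h. coeff i j h * stoch_D P j \<phi> h \<partial>P)))"
    by (simp only: integration_by_parts[OF D D\<phi>])
  also have "\<dots> = - (\<integral>h. (\<Sum>i\<in>UNIV. \<Sum>j\<in>UNIV. e $ i * (coeff i j h * stoch_D P j \<phi> h)) \<partial>P)"
    using L2_integrable_mult[OF has_stoch_derivD(1)[OF D] has_stoch_derivD(2)[OF D\<phi>]]
    by (simp add: Bochner_Integration.integral_sum sum_negf)
  also have "(\<lambda>h. \<Sum>i\<in>UNIV. \<Sum>j\<in>UNIV. e $ i * (coeff i j h * stoch_D P j \<phi> h))
      = (\<lambda>h. e \<bullet> flux h (grad_D P \<phi> h))"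
    by (simp add: inner_vec_def flux_component coeff_def grad_D_def sum_distrib_left)
  finally show ?thesis .
qed

end

section \<open>Convolution with compactly supported kernels\<close>

definition vanishes_outside :: "real \<Rightarrow> (real^'n::finite \<Rightarrow> real) \<Rightarrow> bool" where
  "vanishes_outside R \<rho> \<longleftrightarrow> (\<forall>x. R < norm x \<longrightarrow> \<rho> x = 0)"

text \<open>The kernel argument is y - x, as it arises from averaging along an orbit. Each
  derivative in x therefore produces a minus sign, which is later kept on u so that the result is
  again a \<open>conv\<close>.\<close>

definition conv :: "(real^'n::finite \<Rightarrow> real) \<Rightarrow> (real^'n \<Rightarrow> real) \<Rightarrow> real^'n \<Rightarrow> real" where
  "conv \<rho> u x = (\<integral>y. u y * \<rho> (y - x) \<partial>lborel)"

lemma integrable_indicator_cball [simp]: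
  "integrable lborel (indicator (cball (c::real^'n::finite) R) :: _ \<Rightarrow> real)"
  using emeasure_bounded_finite[OF bounded_cball] by (intro integrable_real_indicator) auto

lemma vanishes_outside_bounded:
  assumes "continuous_on UNIV \<rho>" "vanishes_outside R \<rho>"
  obtains B where "0 \<le> B" "\<And>x. \<bar>\<rho> x\<bar> \<le> B * indicator (cball 0 R) x"
proof -
  have "compact (\<rho> ` cball 0 R)"
    by (rule compact_continuous_image[OF continuous_on_subset[OF assms(1) subset_UNIV] compact_cball])
  from compact_imp_bounded[OF this]
  obtain B where "\<forall>r\<in>\<rho> ` cball 0 R. norm r \<le> B" unfolding bounded_iff by blast
  then have B: "\<And>x. x \<in> cball 0 R \<Longrightarrow> norm (\<rho> x) \<le> B" by blast
  have "\<bar>\<rho> x\<bar> \<le> \<bar>B\<bar> * indicator (cball 0 R) x" for x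
    using B[of x] assms(2) by (cases "x \<in> cball 0 R") (auto simp: vanishes_outside_def)
  then show ?thesis by (rule that[of "\<bar>B\<bar>", rotated]) simp
qed

lemma vanishes_outside_integrable:
  assumes "continuous_on UNIV \<rho>" "vanishes_outside R \<rho>"
  shows "integrable lborel \<rho>"
proof -
  obtain B where B: "0 \<le> B" "\<And>x. \<bar>\<rho> x\<bar> \<le> B * indicator (cball 0 R) x"
    using assms by (rule vanishes_outside_bounded) blast
  show ?thesis
  proof (rule Bochner_Integration.integrable_bound)
    show "integrable lborel (\<lambda>x::real^'a. B * indicator (cball 0 R) x :: real)" by simp
    show "\<rho> \<in> borel_measurable lborel" using borel_measurable_continuous_onI[OF assms(1)] by simp
    show "AE x in lborel. norm (\<rho> x) \<le> norm (B * indicator (cball 0 R) x :: real)"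
      using B by (auto simp: abs_of_nonneg)
  qed
qed

lemma lborel_integral_translate:
  "(\<integral>y. f (y + c) \<partial>lborel) = (\<integral>y. f y \<partial>lborel)"
  if [measurable]: "f \<in> borel_measurable borel" for f :: "real^'n::finite \<Rightarrow> real"
proof -
  have "(\<integral>y. f y \<partial>lborel) = (\<integral>y. f y \<partial>distr lborel borel ((+) c))"
    by (simp add: lborel_distr_plus)
  also have "\<dots> = (\<integral>y. f (c + y) \<partial>lborel)" by (rule integral_distr) auto
  finally show ?thesis by (simp add: add.commute)
qed

lemma conv_translate:
  assumes [measurable]: "u \<in> borel_measurable borel" "\<rho> \<in> borel_measurable borel"
  shows "conv \<rho> u x = (\<integral>y. u (y + x) * \<rho> y \<partial>lborel)"
  using lborel_integral_translate[of "\<lambda>y. u y * \<rho> (y - x)" x] by (simp add: conv_def)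

lemma pd_vanishes_outside:
  assumes "vanishes_outside R \<rho>"
  shows "vanishes_outside R (pd i \<rho>)"
  unfolding vanishes_outside_def
proof (intro allI impI)
  fix x :: "real^'a" assume x: "R < norm x"
  have op: "open {x :: real^'a. R < norm x}" by (intro open_Collect_less continuous_intros)
  have "(\<rho> has_derivative (\<lambda>_. 0)) (at x)"
    by (rule has_derivative_transform_within_open[OF has_derivative_const[of 0] op])
      (use x assms in \<open>auto simp: vanishes_outside_def\<close>)
  from pd_eqI[OF this] show "pd i \<rho> x = 0" by simp
qed

lemma frechet_derivative_pd:
  assumes "f differentiable (at x)"
  shows "frechet_derivative f (at x) v = (\<Sum>i\<in>UNIV. v $ i * pd i f x)"
proof -
  have lin: "linear (frechet_derivative f (at x))"
    by (rule linear_frechet_derivative[OF assms])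
  have "v = (\<Sum>i\<in>UNIV. v $ i *\<^sub>R axis i 1)"
    by (simp add: vec_eq_iff axis_def if_distrib cong: if_cong)
  then have "frechet_derivative f (at x) v = frechet_derivative f (at x) (\<Sum>i\<in>UNIV. v $ i *\<^sub>R axis i 1)"
    by simp
  also have "\<dots> = (\<Sum>i\<in>UNIV. v $ i * pd i f x)"
    by (simp add: linear_sum[OF lin] linear_scale[OF lin] pd_def)
  finally show ?thesis .
qed

lemma Ck1_Lipschitz:
  fixes \<rho> :: "real^'n::finite \<Rightarrow> real"
  assumes "Ck 1 \<rho>" "vanishes_outside R \<rho>"
  obtains K where "0 \<le> K" "\<And>x v. \<bar>\<Sum>i\<in>UNIV. v $ i * pd i \<rho> x\<bar> \<le> K * norm v"
    "\<And>x y. \<bar>\<rho> x - \<rho> y\<bar> \<le> K * norm (x - y)"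
proof -
  have "\<forall>i. \<exists>B. 0 \<le> B \<and> (\<forall>x. \<bar>pd i \<rho> x\<bar> \<le> B)"
  proof
    fix i
    have "continuous_on UNIV (pd i \<rho>)" using assms(1) by simp
    then obtain B where B: "0 \<le> B" "\<And>x. \<bar>pd i \<rho> x\<bar> \<le> B * indicator (cball 0 R) x"
      using pd_vanishes_outside[OF assms(2)] by (rule vanishes_outside_bounded) blast
    have "\<bar>pd i \<rho> x\<bar> \<le> B" for x
      using B(2)[of x] B(1) by (cases "x \<in> cball 0 R") auto
    then show "\<exists>B. 0 \<le> B \<and> (\<forall>x. \<bar>pd i \<rho> x\<bar> \<le> B)" using B(1) by blast
  qed
  from choice[OF this] obtain B where B: "\<And>i. 0 \<le> B i" "\<And>i x. \<bar>pd i \<rho> x\<bar> \<le> B i" by blast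
  define K where "K = sum B UNIV"
  have K: "0 \<le> K" unfolding K_def by (intro sum_nonneg B)
  have le: "\<bar>\<Sum>i\<in>UNIV. v $ i * pd i \<rho> x\<bar> \<le> K * norm v" for x v
  proof -
    have "\<bar>\<Sum>i\<in>UNIV. v $ i * pd i \<rho> x\<bar> \<le> (\<Sum>i\<in>UNIV. \<bar>v $ i * pd i \<rho> x\<bar>)" by (rule sum_abs)
    also have "\<dots> \<le> (\<Sum>i\<in>UNIV. norm v * B i)"
      unfolding abs_mult by (intro sum_mono mult_mono B component_le_norm_cart) auto
    finally show ?thesis by (simp add: K_def sum_distrib_left mult.commute)
  qed
  have "\<bar>\<rho> x - \<rho> y\<bar> \<le> K * norm (x - y)" for x y
  proof -
    have d: "\<rho> differentiable (at z)" for z using assms(1) by simp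
    have "norm (\<rho> x - \<rho> y) \<le> K * norm (x - y)"
    proof (rule differentiable_bound[OF convex_UNIV])
      show "(\<rho> has_derivative frechet_derivative \<rho> (at z)) (at z)" for z
        using d by (simp flip: frechet_derivative_works)
      show "onorm (frechet_derivative \<rho> (at z)) \<le> K" for z
        by (rule onorm_le) (simp add: frechet_derivative_pd[OF d] le)
    qed auto
    then show ?thesis by simp
  qed
  with K le show ?thesis by (rule that)
qed

lemma conv_bound:
  assumes "continuous_on UNIV \<rho>" "vanishes_outside R \<rho>" "u \<in> borel_measurable borel" "\<And>y. \<bar>u y\<bar> \<le> M"
  shows "\<bar>conv \<rho> u x\<bar> \<le> M * (\<integral>y. \<bar>\<rho> y\<bar> \<partial>lborel)"
proof -
  note [measurable] = borel_measurable_continuous_onI[OF assms(1)] assms(3)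
  note int = vanishes_outside_integrable[OF assms(1,2)]
  have "\<bar>conv \<rho> u x\<bar> \<le> (\<integral>y. \<bar>u (y + x) * \<rho> y\<bar> \<partial>lborel)"
    unfolding conv_translate[OF assms(3) borel_measurable_continuous_onI[OF assms(1)]]
    by (rule integral_abs_bound)
  also have "\<dots> \<le> (\<integral>y. M * \<bar>\<rho> y\<bar> \<partial>lborel)"
  proof (rule integral_mono)
    have *: "\<bar>u (y + x) * \<rho> y\<bar> \<le> M * \<bar>\<rho> y\<bar>" for y
      unfolding abs_mult by (intro mult_right_mono assms) simp
    then show "\<bar>u (y + x) * \<rho> y\<bar> \<le> M * \<bar>\<rho> y\<bar>" for y .
    show int2: "integrable lborel (\<lambda>y. M * \<bar>\<rho> y\<bar>)" by (intro integrable_mult_right integrable_abs int)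
    show "integrable lborel (\<lambda>y. \<bar>u (y + x) * \<rho> y\<bar>)"
    proof (rule Bochner_Integration.integrable_bound[OF int2])
      show "AE y in lborel. norm \<bar>u (y + x) * \<rho> y\<bar> \<le> norm (M * \<bar>\<rho> y\<bar>)"
        using * by (intro AE_I2) (metis abs_ge_self order_trans real_norm_def abs_idempotent)
    qed measurable
  qed
  finally show ?thesis by simp
qed

lemma integral_tendsto_0_cball:
  fixes f :: "nat \<Rightarrow> real^'n::finite \<Rightarrow> real"
  assumes "\<And>n. f n \<in> borel_measurable borel" "\<And>y. (\<lambda>n. f n y) \<longlonglongrightarrow> 0"
    "\<And>n y. \<bar>f n y\<bar> \<le> K * indicator (cball 0 L) y"
  shows "(\<lambda>n. \<integral>y. f n y \<partial>lborel) \<longlonglongrightarrow> 0"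
proof -
  have "(\<lambda>n. \<integral>y. f n y \<partial>lborel) \<longlonglongrightarrow> integral\<^sup>L lborel (\<lambda>_::real^'n. 0)"
    by (rule integral_dominated_convergence[where w = "\<lambda>y. K * indicator (cball 0 L) y"])
      (use assms in auto)
  then show ?thesis by simp
qed

lemma conv_integrable:
  assumes "continuous_on UNIV \<rho>" "vanishes_outside R \<rho>" "u \<in> borel_measurable borel" "\<And>y. \<bar>u y\<bar> \<le> M"
  shows "integrable lborel (\<lambda>y. u y * \<rho> (y - x))"
proof -
  note [measurable] = borel_measurable_continuous_onI[OF assms(1)] assms(3)
  obtain B where B: "0 \<le> B" "\<And>x. \<bar>\<rho> x\<bar> \<le> B * indicator (cball 0 R) x"
    using assms(1,2) by (rule vanishes_outside_bounded) blast
  show ?thesis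
  proof (rule Bochner_Integration.integrable_bound)
    show "integrable lborel (\<lambda>y::real^'a. M * B * indicator (cball x R) y :: real)" by simp
    show "AE y in lborel. norm (u y * \<rho> (y - x)) \<le> norm (M * B * indicator (cball x R) y)"
    proof (rule AE_I2)
      fix y
      have "\<bar>u y * \<rho> (y - x)\<bar> \<le> M * (B * indicator (cball 0 R) (y - x))"
        unfolding abs_mult using order_trans[OF abs_ge_zero assms(4)] by (intro mult_mono assms B) auto
      also have "indicator (cball 0 R) (y - x) = (indicator (cball x R) y :: real)"
        by (simp add: indicator_def dist_norm norm_minus_commute)
      finally show "norm (u y * \<rho> (y - x)) \<le> norm (M * B * indicator (cball x R) y)" by simp
    qed
  qed measurable
qed

text \<open>A convergent sequence of centres is bounded, say by L, so all shifted kernels live in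
  one ball of radius R + L and dominated convergence applies.\<close>

lemma conv_continuous:
  assumes \<rho>: "continuous_on UNIV \<rho>" "vanishes_outside R \<rho>" and u: "u \<in> borel_measurable borel" "\<And>y. \<bar>u y\<bar> \<le> M"
  shows "continuous_on UNIV (conv \<rho> u)"
  unfolding continuous_on_sequentially
proof (intro ballI allI impI, elim conjE)
  fix X and x :: "real^'a" assume X: "X \<longlonglongrightarrow> x"
  note [measurable] = borel_measurable_continuous_onI[OF \<rho>(1)] u(1)
  obtain B where B: "0 \<le> B" "\<And>x. \<bar>\<rho> x\<bar> \<le> B * indicator (cball 0 R) x"
    using \<rho> by (rule vanishes_outside_bounded) blast
  obtain L where L: "\<And>n. norm (X n) \<le> L"
    using convergent_imp_Bseq[OF convergentI[OF X]] unfolding Bseq_def by blast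
  have Lx: "norm x \<le> L" using LIMSEQ_le_const2[OF tendsto_norm[OF X]] L by blast
  have M0: "0 \<le> M" using order_trans[OF abs_ge_zero u(2)] by blast
  have le: "\<bar>u y * \<rho> (y - z)\<bar> \<le> M * B * indicator (cball 0 (R + L)) y" if "norm z \<le> L" for z y
  proof -
    have "\<bar>u y * \<rho> (y - z)\<bar> \<le> M * (B * indicator (cball 0 R) (y - z))"
      unfolding abs_mult using M0 by (intro mult_mono u B) auto
    also have "\<dots> \<le> M * (B * indicator (cball 0 (R + L)) y)"
      using norm_triangle_sub[of y z] that M0 B(1)
      by (intro mult_left_mono) (auto simp: indicator_def)
    finally show ?thesis by simp
  qed
  have "(\<lambda>n. \<integral>y. u y * \<rho> (y - X n) \<partial>lborel) \<longlonglongrightarrow> (\<integral>y. u y * \<rho> (y - x) \<partial>lborel)"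
  proof (rule integral_dominated_convergence[where w = "\<lambda>y. M * B * indicator (cball 0 (R + L)) y"])
    show "AE y in lborel. (\<lambda>n. u y * \<rho> (y - X n)) \<longlonglongrightarrow> u y * \<rho> (y - x)"
    proof (rule AE_I2)
      fix y
      have "isCont \<rho> (y - x)" using \<rho>(1) by (simp add: continuous_on_eq_continuous_at)
      then have "(\<lambda>n. \<rho> (y - X n)) \<longlonglongrightarrow> \<rho> (y - x)"
        by (rule isCont_tendsto_compose) (intro tendsto_intros X)
      then show "(\<lambda>n. u y * \<rho> (y - X n)) \<longlonglongrightarrow> u y * \<rho> (y - x)" by (intro tendsto_intros)
    qed
  qed (use le[OF L] in auto)
  then show "(conv \<rho> u \<circ> X) \<longlonglongrightarrow> conv \<rho> u x" by (simp add: conv_def o_def)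
qed

text \<open>A majorant uniform in v, for dominated convergence: inside the ball the increment and
  the linear term are each at most K norm v, outside everything vanishes.\<close>

lemma difference_quotient_bound:
  fixes \<rho> :: "real^'n::finite \<Rightarrow> real"
  assumes "Ck 1 \<rho>" "vanishes_outside R \<rho>"
  obtains K where "0 \<le> K" "\<And>x v. v \<noteq> 0 \<Longrightarrow> norm v \<le> L \<Longrightarrow>
    \<bar>(\<rho> (x - v) - \<rho> x + (\<Sum>i\<in>UNIV. v $ i * pd i \<rho> x)) / norm v\<bar> \<le> K * indicator (cball 0 (R + L)) x"
proof -
  obtain K where K: "0 \<le> K" "\<And>x v. \<bar>\<Sum>i\<in>UNIV. v $ i * pd i \<rho> x\<bar> \<le> K * norm v"
    "\<And>x y. \<bar>\<rho> x - \<rho> y\<bar> \<le> K * norm (x - y)"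
    using assms by (rule Ck1_Lipschitz) blast
  have "\<bar>(\<rho> (x - v) - \<rho> x + (\<Sum>i\<in>UNIV. v $ i * pd i \<rho> x)) / norm v\<bar>
      \<le> (2 * K) * indicator (cball 0 (R + L)) x" if v: "v \<noteq> 0" "norm v \<le> L" for x v
  proof (cases "x \<in> cball 0 (R + L)")
    case True
    have "\<bar>\<rho> (x - v) - \<rho> x + (\<Sum>i\<in>UNIV. v $ i * pd i \<rho> x)\<bar> \<le> 2 * K * norm v"
      using K(2)[of v x] K(3)[of "x - v" x] by simp
    then show ?thesis using True v(1) by (simp add: divide_le_eq abs_divide)
  next
    case False
    then have x: "R + L < norm x" by simp
    have "0 \<le> L" using v(2) norm_ge_zero order_trans by blast
    have "R < norm (x - v)" using x v(2) norm_triangle_ineq2[of x v] by linarith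
    moreover have "R < norm x" using x \<open>0 \<le> L\<close> by linarith
    ultimately have "\<rho> (x - v) = 0" "\<rho> x = 0" "pd i \<rho> x = 0" for i
      using assms(2) pd_vanishes_outside[OF assms(2), of i] by (auto simp: vanishes_outside_def)
    then show ?thesis using K(1) by simp
  qed
  then show ?thesis using that[of "2 * K"] K(1) by simp
qed

lemma difference_quotient_tendsto:
  fixes \<rho> :: "real^'n::finite \<Rightarrow> real"
  assumes "\<rho> differentiable (at x)" "X \<longlonglongrightarrow> 0" "\<And>n. X n \<noteq> 0"
  shows "(\<lambda>n. (\<rho> (x - X n) - \<rho> x + (\<Sum>i\<in>UNIV. X n $ i * pd i \<rho> x)) / norm (X n)) \<longlonglongrightarrow> 0"
proof -
  let ?D = "frechet_derivative \<rho> (at x)"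
  have lin: "linear ?D" by (rule linear_frechet_derivative[OF assms(1)])
  have "(\<rho> has_derivative ?D) (at x)" using assms(1) by (simp flip: frechet_derivative_works)
  then have "(\<lambda>v. norm (\<rho> (x + v) - \<rho> x - ?D v) / norm v) \<midarrow>0\<rightarrow> 0"
    by (simp add: has_derivative_at)
  moreover have "filterlim (\<lambda>n. - X n) (at 0) sequentially"
    using tendsto_minus[OF assms(2)] assms(3) by (simp add: filterlim_at)
  ultimately have "(\<lambda>n. norm (\<rho> (x + - X n) - \<rho> x - ?D (- X n)) / norm (- X n)) \<longlonglongrightarrow> 0"
    by (rule filterlim_compose)
  then have "(\<lambda>n. \<bar>(\<rho> (x - X n) - \<rho> x + (\<Sum>i\<in>UNIV. X n $ i * pd i \<rho> x)) / norm (X n)\<bar>) \<longlonglongrightarrow> 0"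
    by (simp add: linear_neg[OF lin] frechet_derivative_pd[OF assms(1)] abs_divide sum_negf)
  then show ?thesis by (rule tendsto_rabs_zero_cancel)
qed

text \<open>Since u is only bounded and measurable, the whole increment is made to fall on the
  kernel, whose first-order remainder tends to 0 under a fixed majorant.\<close>

lemma conv_has_derivative:
  assumes \<rho>: "Ck 1 \<rho>" "vanishes_outside R \<rho>" and u: "u \<in> borel_measurable borel" "\<And>y. \<bar>u y\<bar> \<le> M"
  shows "(conv \<rho> u has_derivative (\<lambda>v. \<Sum>i\<in>UNIV. v $ i * conv (pd i \<rho>) (\<lambda>y. - u y) x)) (at x)"
  unfolding has_derivative_at
proof
  show "bounded_linear (\<lambda>v. \<Sum>i\<in>UNIV. v $ i * conv (pd i \<rho>) (\<lambda>y. - u y) x)"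
    by (intro bounded_linear_sum bounded_linear_mult_const bounded_linear_vec_nth)
  have cont: "continuous_on UNIV \<rho>" "continuous_on UNIV (pd i \<rho>)" for i
    using \<rho>(1) Ck_imp_continuous[OF \<rho>(1)] by simp_all
  note [measurable] = borel_measurable_continuous_onI[OF cont(1)] borel_measurable_continuous_onI[OF cont(2)] u(1)
  have u': "(\<lambda>y. - u y) \<in> borel_measurable borel" "\<And>y. \<bar>- u y\<bar> \<le> M" using u by simp_all
  define q where "q v z = (\<rho> (z - v) - \<rho> z + (\<Sum>i\<in>UNIV. v $ i * pd i \<rho> z)) / norm v" for v z
  have eq: "(conv \<rho> u (x + v) - conv \<rho> u x - (\<Sum>i\<in>UNIV. v $ i * conv (pd i \<rho>) (\<lambda>y. - u y) x)) / norm v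
      = (\<integral>y. u y * q v (y - x) \<partial>lborel)" for v
  proof -
    note i = conv_integrable[OF cont(1) \<rho>(2) u] conv_integrable[OF cont(2) pd_vanishes_outside[OF \<rho>(2)] u']
    have "conv \<rho> u (x + v) - conv \<rho> u x - (\<Sum>i\<in>UNIV. v $ i * conv (pd i \<rho>) (\<lambda>y. - u y) x)
      = (\<integral>y. u y * \<rho> (y - (x + v)) - u y * \<rho> (y - x) - (\<Sum>i\<in>UNIV. v $ i * (- u y * pd i \<rho> (y - x))) \<partial>lborel)"
      unfolding conv_def using i
      by (simp add: Bochner_Integration.integral_sum Bochner_Integration.integrable_sum)
    then have "(conv \<rho> u (x + v) - conv \<rho> u x - (\<Sum>i\<in>UNIV. v $ i * conv (pd i \<rho>) (\<lambda>y. - u y) x)) / norm v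
      = (\<integral>y. u y * \<rho> (y - (x + v)) - u y * \<rho> (y - x) - (\<Sum>i\<in>UNIV. v $ i * (- u y * pd i \<rho> (y - x))) \<partial>lborel) / norm v"
      by (rule arg_cong)
    also have "\<dots> = (\<integral>y. (u y * \<rho> (y - (x + v)) - u y * \<rho> (y - x) - (\<Sum>i\<in>UNIV. v $ i * (- u y * pd i \<rho> (y - x)))) / norm v \<partial>lborel)"
      by (rule integral_divide_zero[symmetric])
    also have "\<dots> = (\<integral>y. u y * q v (y - x) \<partial>lborel)"
    proof (rule Bochner_Integration.integral_cong[OF refl])
      fix y
      have "(\<Sum>i\<in>UNIV. v $ i * (- u y * pd i \<rho> (y - x))) = - (u y * (\<Sum>i\<in>UNIV. v $ i * pd i \<rho> (y - x)))"
        by (simp add: sum_distrib_left sum_negf mult.left_commute)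
      moreover have "y - (x + v) = y - x - v" by simp
      ultimately show "(u y * \<rho> (y - (x + v)) - u y * \<rho> (y - x) - (\<Sum>i\<in>UNIV. v $ i * (- u y * pd i \<rho> (y - x)))) / norm v
          = u y * q v (y - x)"
        unfolding q_def by (simp only: distrib_left right_diff_distrib diff_minus_eq_add times_divide_eq_right)
    qed
    finally show ?thesis .
  qed
  show "(\<lambda>v. norm (conv \<rho> u (x + v) - conv \<rho> u x - (\<Sum>i\<in>UNIV. v $ i * conv (pd i \<rho>) (\<lambda>y. - u y) x)) / norm v) \<midarrow>0\<rightarrow> 0"
    unfolding tendsto_at_iff_sequentially
  proof (intro allI impI)
    fix X assume X: "\<forall>n. X n \<in> UNIV - {0 :: real^'a}" "X \<longlonglongrightarrow> 0"
    obtain L where L: "\<And>n. norm (X n) \<le> L"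
      using convergent_imp_Bseq[OF convergentI[OF X(2)]] unfolding Bseq_def by blast
    obtain K where K: "0 \<le> K" "\<And>z v. v \<noteq> 0 \<Longrightarrow> norm v \<le> L \<Longrightarrow> \<bar>q v z\<bar> \<le> K * indicator (cball 0 (R + L)) z"
      unfolding q_def using \<rho> by (rule difference_quotient_bound[where L = L]) blast
    have M0: "0 \<le> M" using order_trans[OF abs_ge_zero u(2)] by blast
    have "(\<lambda>n. \<integral>y. u y * q (X n) (y - x) \<partial>lborel) \<longlonglongrightarrow> 0"
    proof (rule integral_tendsto_0_cball)
      show "(\<lambda>y. u y * q (X n) (y - x)) \<in> borel_measurable borel" for n
        unfolding q_def by measurable
      have "(\<lambda>n. q (X n) (y - x)) \<longlonglongrightarrow> 0" for y
        unfolding q_def using X \<rho>(1) by (intro difference_quotient_tendsto) auto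
      from tendsto_mult_right_zero[OF this] show "(\<lambda>n. u y * q (X n) (y - x)) \<longlonglongrightarrow> 0" for y .
      fix n y
      have "\<bar>u y * q (X n) (y - x)\<bar> \<le> M * (K * indicator (cball 0 (R + L)) (y - x))"
        unfolding abs_mult using X(1) L M0 by (intro mult_mono u K) auto
      also have "\<dots> \<le> M * (K * indicator (cball 0 (R + L + norm x)) y)"
        using norm_triangle_sub[of y x] M0 K(1) by (intro mult_left_mono) (auto simp: indicator_def)
      finally show "\<bar>u y * q (X n) (y - x)\<bar> \<le> (M * K) * indicator (cball 0 (R + L + norm x)) y" by simp
    qed
    from tendsto_rabs_zero[OF this]
    show "((\<lambda>v. norm (conv \<rho> u (x + v) - conv \<rho> u x - (\<Sum>i\<in>UNIV. v $ i * conv (pd i \<rho>) (\<lambda>y. - u y) x)) / norm v) \<circ> X) \<longlonglongrightarrow> 0"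
      by (simp add: o_def abs_divide flip: eq)
  qed
qed

lemma conv_pd:
  assumes "Ck 1 \<rho>" "vanishes_outside R \<rho>" "u \<in> borel_measurable borel" "\<And>y. \<bar>u y\<bar> \<le> M"
  shows "conv \<rho> u differentiable (at x)" "pd i (conv \<rho> u) x = conv (pd i \<rho>) (\<lambda>y. - u y) x"
proof -
  note D = conv_has_derivative[OF assms, of x]
  then show "conv \<rho> u differentiable (at x)" by (auto simp: differentiable_def)
  show "pd i (conv \<rho> u) x = conv (pd i \<rho>) (\<lambda>y. - u y) x"
    using pd_eqI[OF D, of i] by (simp add: axis_def if_distrib[of "\<lambda>a. a * _"] cong: if_cong)
qed

text \<open>The order of quantifiers is the point: C depends on \<rho> and M but not on u. Applied
  to all orbits of one bounded function it yields the deterministic constants required by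
  \<open>Cb\<close>.\<close>

lemma conv_Ck:
  assumes "Ck k \<rho>" "vanishes_outside R \<rho>"
  shows "\<exists>C. \<forall>u. u \<in> borel_measurable borel \<and> (\<forall>y. \<bar>u y\<bar> \<le> M) \<longrightarrow>
    Ck k (conv \<rho> u) \<and> (\<forall>x. dnorm k (conv \<rho> u) x \<le> C)"
  using assms
proof (induction k arbitrary: \<rho>)
  case 0
  then have "continuous_on UNIV \<rho>" by simp
  note conv_continuous[OF this 0(2), where M = M] conv_bound[OF this 0(2), where M = M]
  then show ?case by (intro exI[of _ "M * (\<integral>y. \<bar>\<rho> y\<bar> \<partial>lborel)"]) simp
next
  case (Suc k)
  have "\<forall>i. \<exists>C. \<forall>u. u \<in> borel_measurable borel \<and> (\<forall>y. \<bar>u y\<bar> \<le> M) \<longrightarrow>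
    Ck k (conv (pd i \<rho>) u) \<and> (\<forall>x. dnorm k (conv (pd i \<rho>) u) x \<le> C)"
    using Suc.prems by (intro allI Suc.IH pd_vanishes_outside) simp_all
  from choice[OF this] obtain C where C: "\<And>i u. u \<in> borel_measurable borel \<Longrightarrow> (\<And>y. \<bar>u y\<bar> \<le> M) \<Longrightarrow>
    Ck k (conv (pd i \<rho>) u)" "\<And>i u x. u \<in> borel_measurable borel \<Longrightarrow> (\<And>y. \<bar>u y\<bar> \<le> M) \<Longrightarrow>
    dnorm k (conv (pd i \<rho>) u) x \<le> C i" by blast
  show ?case
  proof (intro exI[of _ "sum C UNIV"] allI impI, elim conjE)
    fix u :: "real^'a \<Rightarrow> real" assume u: "u \<in> borel_measurable borel" "\<forall>y. \<bar>u y\<bar> \<le> M"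
    then have u': "(\<lambda>y. - u y) \<in> borel_measurable borel" "\<And>y. \<bar>- u y\<bar> \<le> M" by simp_all
    have \<rho>1: "Ck 1 \<rho>" by (rule Ck_mono[OF Suc.prems(1)]) simp
    note pd = conv_pd[OF \<rho>1 Suc.prems(2) u(1) u(2)[rule_format]]
    have pd': "pd i (conv \<rho> u) = conv (pd i \<rho>) (\<lambda>y. - u y)" for i by (rule ext) (rule pd(2))
    have "dnorm (Suc k) (conv \<rho> u) x \<le> sum C UNIV" for x
    proof -
      have "dnorm (Suc k) (conv \<rho> u) x \<le> (\<Sum>i\<in>UNIV. dnorm k (pd i (conv \<rho> u)) x)"
        by (simp add: L2_set_le_sum dnorm_nonneg)
      also have "\<dots> \<le> sum C UNIV" unfolding pd' by (intro sum_mono C(2) u')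
      finally show ?thesis .
    qed
    moreover have "Ck (Suc k) (conv \<rho> u)"
      using pd(1) C(1)[OF u'] by (simp add: pd')
    ultimately show "Ck (Suc k) (conv \<rho> u) \<and> (\<forall>x. dnorm (Suc k) (conv \<rho> u) x \<le> sum C UNIV)" by blast
  qed
qed

subsection \<open>A bump function\<close>

lemma DERIV_pos_part_power:
  "((\<lambda>s. max 0 s ^ Suc (Suc m)) has_real_derivative real (Suc (Suc m)) * max 0 s ^ Suc m) (at s)"
proof (cases s "0 :: real" rule: linorder_cases)
  case less
  have "((\<lambda>s::real. 0) has_real_derivative 0) (at s)" by simp
  then have "((\<lambda>s. max 0 s ^ Suc (Suc m)) has_real_derivative 0) (at s)"
    by (rule has_field_derivative_transform_within_open[where S = "{..<0}"]) (use less in auto)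
  then show ?thesis using less by simp
next
  case greater
  have "((\<lambda>s::real. s ^ Suc (Suc m)) has_real_derivative real (Suc (Suc m)) * s ^ Suc m) (at s)"
    by (rule derivative_eq_intros refl)+ simp
  then have "((\<lambda>s. max 0 s ^ Suc (Suc m)) has_real_derivative real (Suc (Suc m)) * s ^ Suc m) (at s)"
    by (rule has_field_derivative_transform_within_open[where S = "{0<..}"]) (use greater in auto)
  then show ?thesis using greater by simp
next
  case equal
  have "((\<lambda>t. max 0 t ^ Suc m) \<longlongrightarrow> max 0 0 ^ Suc m) (at (0::real))"
    by (intro tendsto_intros)
  then have lim: "((\<lambda>t. max 0 t ^ Suc m) \<longlongrightarrow> 0) (at (0::real))" by simp
  have "((\<lambda>t. max 0 t ^ Suc (Suc m) / t) \<longlongrightarrow> 0) (at (0::real))"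
  proof (rule Lim_transform_eventually[OF lim])
    show "\<forall>\<^sub>F t in at (0::real). max 0 t ^ Suc m = max 0 t ^ Suc (Suc m) / t"
      unfolding eventually_at_filter by (intro always_eventually) (auto simp: max_def)
  qed
  then show ?thesis using equal by (simp add: has_field_derivative_iff)
qed

text \<open>The cube is the smallest integer power for which the polynomial, glued to 0 across the
  sphere of radius \<delta>, is twice continuously differentiable.\<close>

definition bump :: "real \<Rightarrow> real^'n::finite \<Rightarrow> real" where
  "bump \<delta> x = max 0 (\<delta>\<^sup>2 - x \<bullet> x) ^ 3"

lemma bump_Ck: "Ck 2 (bump \<delta>)"
proof -
  let ?f = "\<lambda>x::real^'a. \<delta>\<^sup>2 - x \<bullet> x"
  have Df: "(?f has_derivative (\<lambda>v. - 2 * (x \<bullet> v))) (at x)" for x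
    by (auto intro!: derivative_eq_intros simp: inner_commute)
  then have df: "?f differentiable (at x)" for x by (auto simp: differentiable_def)
  have pf: "pd i ?f x = - 2 * x $ i" for i x
    using pd_eqI[OF Df, of i x] by (simp add: inner_axis)
  have eta: "(\<lambda>x. max 0 (?f x) ^ Suc (Suc m)) differentiable (at x)"
    "pd i (\<lambda>x. max 0 (?f x) ^ Suc (Suc m)) x = real (Suc (Suc m)) * max 0 (?f x) ^ Suc m * (- 2 * x $ i)" for m i x
    using pd_compose[OF df DERIV_pos_part_power[of m "?f x"]] unfolding pf by blast+
  have D1: "((\<lambda>x::real^'a. - 6 * x $ i) has_derivative (\<lambda>v. - 6 * v $ i)) (at x)" for i x
    by (intro has_derivative_mult_right bounded_linear_imp_has_derivative bounded_linear_vec_nth)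
  then have d1: "(\<lambda>x::real^'a. - 6 * x $ i) differentiable (at x)" for i x by (auto simp: differentiable_def)
  have b: "bump \<delta> = (\<lambda>x::real^'a. max 0 (?f x) ^ Suc (Suc 1))"
    by (simp add: bump_def[abs_def] numeral_3_eq_3)
  have p1: "pd i (bump \<delta>) = (\<lambda>x::real^'a. max 0 (?f x) ^ Suc (Suc 0) * (- 6 * x $ i))" for i
    unfolding b by (rule ext, subst eta(2)) simp
  have d2: "pd i (bump \<delta>) differentiable (at x)" for i and x :: "real^'a"
    unfolding p1 by (intro differentiable_mult eta d1)
  have p2: "pd j (pd i (bump \<delta>)) = (\<lambda>x::real^'a. max 0 (?f x) ^ Suc (Suc 0) * (- 6 * axis j 1 $ i)
      + (2 * max 0 (?f x) * (- 2 * x $ j)) * (- 6 * x $ i))" for i j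
    unfolding p1 by (rule ext, subst pd_mult[OF eta(1) d1], subst eta(2), subst pd_eqI[OF D1]) simp
  have "continuous_on UNIV (pd j (pd i (bump \<delta> :: real^'a \<Rightarrow> real)))" for i j
    unfolding p2 by (intro continuous_intros)
  moreover have "bump \<delta> differentiable (at x)" for x :: "real^'a" unfolding b by (rule eta(1))
  ultimately show ?thesis using d2 by (simp add: numeral_2_eq_2)
qed

lemma bump_vanishes: "0 \<le> \<delta> \<Longrightarrow> vanishes_outside \<delta> (bump \<delta>)"
  unfolding vanishes_outside_def bump_def
proof (intro allI impI)
  fix x :: "real^'a" assume "0 \<le> \<delta>" "\<delta> < norm x"
  then have "\<delta>\<^sup>2 < (norm x)\<^sup>2" by (intro power_strict_mono) auto
  then show "max 0 (\<delta>\<^sup>2 - x \<bullet> x) ^ 3 = 0" by (simp add: power2_norm_eq_inner)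
qed

lemma bump_nonneg: "0 \<le> bump \<delta> x"
  by (simp add: bump_def)

lemma bump_integral_pos:
  assumes "0 < \<delta>"
  shows "0 < integral\<^sup>L lborel (bump \<delta> :: real^'n::finite \<Rightarrow> real)"
proof -
  have cont: "continuous_on UNIV (bump \<delta> :: real^'n \<Rightarrow> real)" by (rule Ck_imp_continuous[OF bump_Ck])
  have int: "integrable lborel (bump \<delta> :: real^'n \<Rightarrow> real)"
    using assms by (intro vanishes_outside_integrable[OF cont bump_vanishes]) simp
  have "integral\<^sup>L lborel (bump \<delta> :: real^'n \<Rightarrow> real) \<noteq> 0"
  proof
    assume "integral\<^sup>L lborel (bump \<delta> :: real^'n \<Rightarrow> real) = 0"
    then have "AE x in lborel :: (real^'n) measure. bump \<delta> x = 0"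
      using integral_nonneg_eq_0_iff_AE[OF int AE_I2[OF bump_nonneg]] by simp
    then have "AE x in lborel :: (real^'n) measure. x \<notin> ball 0 \<delta>"
    proof eventually_elim
      case (elim x)
      show ?case
      proof
        assume "x \<in> ball 0 \<delta>"
        then have "(norm x)\<^sup>2 < \<delta>\<^sup>2" using assms by (intro power_strict_mono) auto
        with elim show False by (simp add: bump_def power2_norm_eq_inner)
      qed
    qed
    then have "emeasure lborel (ball (0::real^'n) \<delta>) = 0"
      by (subst (asm) AE_iff_null_sets[symmetric]) (auto simp: null_sets_def)
    then have "measure lborel (ball (0::real^'n) \<delta>) = 0" by (simp add: measure_def)
    then show False using content_ball_pos[OF assms, of "0::real^'n"] by simp
  qed
  moreover have "0 \<le> integral\<^sup>L lborel (bump \<delta> :: real^'n \<Rightarrow> real)" by (simp add: bump_nonneg)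
  ultimately show ?thesis by simp
qed

section \<open>Density of smooth gradients\<close>

context admissible_measure
begin

text \<open>A weighted average of U along its orbit, which turns a bounded measurable function into
  an element of \<open>Cb\<close>.\<close>

definition mollify :: "(real^'n \<Rightarrow> real) \<Rightarrow> ('n C3 \<Rightarrow> real) \<Rightarrow> 'n C3 \<Rightarrow> real" where
  "mollify \<rho> U h = (\<integral>y. U (shift y h) * \<rho> y \<partial>lborel)"

lemma shift_left_measurable: "U \<in> borel_measurable borel \<Longrightarrow> (\<lambda>y. U (shift y h)) \<in> borel_measurable borel"
  for U :: "'n C3 \<Rightarrow> real"
  by (rule measurable_compose[OF borel_measurable_continuous_onI])
    (intro continuous_at_imp_continuous_on ballI isCont_shift_left)

lemma orbit_measurable:
  assumes "U \<in> borel_measurable borel"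
  shows "(\<lambda>(h, y). U (shift y h)) \<in> borel_measurable (P \<Otimes>\<^sub>M lborel)"
proof -
  have s: "sets (borel \<Otimes>\<^sub>M P) = sets (borel \<Otimes>\<^sub>M (borel :: 'n C3 measure))"
    by (intro sets_pair_measure_cong refl sets_P)
  have "(\<lambda>(h, y). (y, h)) \<in> P \<Otimes>\<^sub>M lborel \<rightarrow>\<^sub>M borel \<Otimes>\<^sub>M P"
    by measurable
  then have 1: "(\<lambda>(h, y). (y, h)) \<in> P \<Otimes>\<^sub>M lborel \<rightarrow>\<^sub>M borel \<Otimes>\<^sub>M (borel :: 'n C3 measure)"
    by (simp cong: measurable_cong_sets add: s)
  have "(\<lambda>p. U ((\<lambda>(y, h). shift y h) ((\<lambda>(h, y). (y, h)) p))) \<in> borel_measurable (P \<Otimes>\<^sub>M lborel)"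
    by (rule measurable_compose[OF measurable_compose[OF 1 shift_measurable_pair] assms])
  then show ?thesis by (simp add: case_prod_beta')
qed

text \<open>The bridge from Omega to R^d: along each orbit mollification is convolution, so all
  regularity comes from \<rho>.\<close>

lemma mollify_shift:
  assumes "U \<in> borel_measurable borel" "\<rho> \<in> borel_measurable borel"
  shows "mollify \<rho> U (shift x h) = conv \<rho> (\<lambda>y. U (shift y h)) x"
  unfolding mollify_def conv_translate[OF shift_left_measurable[OF assms(1)] assms(2)]
  by (simp add: shift_shift)

lemma mollify_Cb:
  assumes \<rho>: "Ck k \<rho>" "vanishes_outside R \<rho>" and U: "U \<in> borel_measurable borel" "\<And>h. \<bar>U h\<bar> \<le> M"
  shows "mollify \<rho> U \<in> Cb k"
proof -
  have \<rho>m: "\<rho> \<in> borel_measurable borel" by (intro borel_measurable_continuous_onI Ck_imp_continuous[OF \<rho>(1)])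
  note eq = mollify_shift[OF U(1) \<rho>m]
  have "\<exists>C. \<forall>h. Ck j (\<lambda>x. mollify \<rho> U (shift x h)) \<and> (\<forall>x. dnorm j (\<lambda>y. mollify \<rho> U (shift y h)) x \<le> C)"
    if jk: "j \<le> k" for j
  proof -
    obtain C where C: "\<And>u. u \<in> borel_measurable borel \<Longrightarrow> (\<And>y. \<bar>u y\<bar> \<le> M) \<Longrightarrow>
        Ck j (conv \<rho> u) \<and> (\<forall>x. dnorm j (conv \<rho> u) x \<le> C)"
      using conv_Ck[OF Ck_mono[OF \<rho>(1) jk] \<rho>(2), of M] by blast
    show ?thesis
      by (intro exI[of _ C] allI) (simp only: eq C[OF shift_left_measurable[OF U(1)] U(2)] simp_thms)
  qed
  then have "\<forall>j. \<exists>C. j \<le> k \<longrightarrow> (\<forall>h. Ck j (\<lambda>x. mollify \<rho> U (shift x h)) \<and>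
      (\<forall>x. dnorm j (\<lambda>y. mollify \<rho> U (shift y h)) x \<le> C))" by blast
  from choice[OF this] obtain C where C: "\<And>j h. j \<le> k \<Longrightarrow> Ck j (\<lambda>x. mollify \<rho> U (shift x h))"
    "\<And>j h x. j \<le> k \<Longrightarrow> dnorm j (\<lambda>y. mollify \<rho> U (shift y h)) x \<le> C j" by blast
  \<comment> \<open>One constant for all orders j \<le> k: the sum dominates each summand because
    all are nonnegative.\<close>
  define B where "B = (\<Sum>j\<le>k. C j)"
  have C0: "0 \<le> C j" if "j \<le> k" for j
    using order_trans[OF dnorm_nonneg C(2)[OF that]] by blast
  have bound: "dnorm j (\<lambda>y. mollify \<rho> U (shift y h)) x \<le> B" if "j \<le> k" for j h x
  proof -
    have "C j \<le> B" unfolding B_def using that C0 by (intro member_le_sum) auto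
    then show ?thesis using C(2)[OF that, of h x] by linarith
  qed
  have "\<bar>mollify \<rho> U h\<bar> \<le> B" for h
    using bound[of 0 h 0] by (simp only: dnorm.simps(1) shift_0)
  then have "bounded (range (mollify \<rho> U))"
    unfolding bounded_iff by (intro exI[of _ B]) auto
  moreover have "mollify \<rho> U \<in> borel_measurable borel"
  proof -
    have [measurable]: "(\<lambda>(h, y). U (shift y h)) \<in> borel_measurable (P \<Otimes>\<^sub>M lborel)"
      by (rule orbit_measurable[OF U(1)])
    note [measurable] = \<rho>m
    have "(\<lambda>h. \<integral>y. (\<lambda>(h, y). U (shift y h)) (h, y) * \<rho> y \<partial>lborel) \<in> borel_measurable P"
      by measurable
    then show ?thesis by (simp add: mollify_def[abs_def])
  qed
  ultimately show ?thesis
    unfolding Cb_def using C(1)[OF order_refl] bound by blast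
qed

lemma mollify_gradient:
  assumes \<rho>: "Ck 2 \<rho>" "vanishes_outside R \<rho>" and U: "U \<in> borel_measurable borel" "\<And>h. \<bar>U h\<bar> \<le> M"
  shows "AE h in P. stoch_D P i (mollify \<rho> U) h = - mollify (pd i \<rho>) U h"
proof -
  have \<rho>1: "Ck 1 \<rho>" by (rule Ck_mono[OF \<rho>(1)]) simp
  have m: "\<rho> \<in> borel_measurable borel" "pd i \<rho> \<in> borel_measurable borel"
    using Ck_imp_continuous[OF \<rho>1] \<rho>1 by (auto intro: borel_measurable_continuous_onI)
  have "pd i (\<lambda>z. mollify \<rho> U (shift z h)) 0 = - mollify (pd i \<rho>) U h" for h
  proof -
    have "pd i (\<lambda>z. mollify \<rho> U (shift z h)) 0 = pd i (conv \<rho> (\<lambda>y. U (shift y h))) 0"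
      unfolding mollify_shift[OF U(1) m(1)] ..
    also have "\<dots> = conv (pd i \<rho>) (\<lambda>y. - U (shift y h)) 0"
      by (rule conv_pd(2)[OF \<rho>1 \<rho>(2) shift_left_measurable[OF U(1)] U(2)])
    also have "\<dots> = - mollify (pd i \<rho>) U h"
      by (simp add: conv_def mollify_def)
    finally show ?thesis .
  qed
  with Cb2_stoch_D[OF mollify_Cb[OF \<rho> U], of i] show ?thesis by simp
qed

text \<open>Fubini. The bound on U, the compact support of \<rho> and the integrability of W make
  the integrand integrable on the product.\<close>

lemma mollify_corr:
  assumes \<rho>: "continuous_on UNIV \<rho>" "vanishes_outside R \<rho>"
    and U: "U \<in> borel_measurable borel" "\<And>h. \<bar>U h\<bar> \<le> M" and W: "W \<in> L2 P"
  shows "(\<integral>h. W h * mollify \<rho> U h \<partial>P) = (\<integral>y. \<rho> y * corr W U y \<partial>lborel)"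
    "(\<lambda>h. W h * mollify \<rho> U h) \<in> borel_measurable borel"
proof -
  interpret pair_sigma_finite P "lborel :: (real^'n) measure" ..
  note \<rho>m [measurable] = borel_measurable_continuous_onI[OF \<rho>(1)]
  have Wm [measurable]: "W \<in> borel_measurable P" by (rule L2_measurable[OF W])
  have orb [measurable]: "(\<lambda>(h, y). U (shift y h)) \<in> borel_measurable (P \<Otimes>\<^sub>M lborel)"
    by (rule orbit_measurable[OF U(1)])
  have m: "(\<lambda>(h, y). W h * (U (shift y h) * \<rho> y)) \<in> borel_measurable (P \<Otimes>\<^sub>M lborel)"
  proof -
    have "(\<lambda>p. W (fst p) * ((\<lambda>(h, y). U (shift y h)) p * \<rho> (snd p))) \<in> borel_measurable (P \<Otimes>\<^sub>M lborel)"
      by measurable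
    then show ?thesis by (simp add: case_prod_beta')
  qed
  have M0: "0 \<le> M" using order_trans[OF abs_ge_zero U(2)] by blast
  have int\<rho>: "integrable lborel \<rho>" by (rule vanishes_outside_integrable[OF \<rho>])
  have int2: "integrable lborel (\<lambda>y. W h * (U (shift y h) * \<rho> y))" for h
    using conv_integrable[OF \<rho> shift_left_measurable[OF U(1)] U(2), of h 0] by simp
  have inner: "(\<integral>y. norm (W h * (U (shift y h) * \<rho> y)) \<partial>lborel) \<le> \<bar>W h\<bar> * (M * (\<integral>y. \<bar>\<rho> y\<bar> \<partial>lborel))" for h
  proof -
    have "(\<integral>y. norm (W h * (U (shift y h) * \<rho> y)) \<partial>lborel) \<le> (\<integral>y. \<bar>W h\<bar> * (M * \<bar>\<rho> y\<bar>) \<partial>lborel)"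
    proof (rule integral_mono)
      show "integrable lborel (\<lambda>y. norm (W h * (U (shift y h) * \<rho> y)))" by (rule integrable_norm[OF int2])
      show "integrable lborel (\<lambda>y. \<bar>W h\<bar> * (M * \<bar>\<rho> y\<bar>))"
        by (intro integrable_mult_right integrable_abs int\<rho>)
      show "norm (W h * (U (shift y h) * \<rho> y)) \<le> \<bar>W h\<bar> * (M * \<bar>\<rho> y\<bar>)" for y
        using mult_right_mono[OF U(2)[of "shift y h"], of "\<bar>\<rho> y\<bar>"] by (simp add: abs_mult mult_left_mono)
    qed
    then show ?thesis by simp
  qed
  have int: "integrable (P \<Otimes>\<^sub>M lborel) (\<lambda>(h, y). W h * (U (shift y h) * \<rho> y))"
  proof (rule Fubini_integrable[OF m])
    show "integrable P (\<lambda>h. \<integral>y. norm (case (h, y) of (h, y) \<Rightarrow> W h * (U (shift y h) * \<rho> y)) \<partial>lborel)"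
    proof (rule Bochner_Integration.integrable_bound)
      show "integrable P (\<lambda>h. \<bar>W h\<bar> * (M * (\<integral>y. \<bar>\<rho> y\<bar> \<partial>lborel)))"
        by (intro integrable_mult_left integrable_abs L2_integrable[OF W])
      show "(\<lambda>h. \<integral>y. norm (case (h, y) of (h, y) \<Rightarrow> W h * (U (shift y h) * \<rho> y)) \<partial>lborel) \<in> borel_measurable P"
        using m by measurable
      show "AE h in P. norm (\<integral>y. norm (case (h, y) of (h, y) \<Rightarrow> W h * (U (shift y h) * \<rho> y)) \<partial>lborel)
          \<le> norm (\<bar>W h\<bar> * (M * (\<integral>y. \<bar>\<rho> y\<bar> \<partial>lborel)))"
        using inner M0 by (intro AE_I2) (simp add: abs_of_nonneg)
    qed
    show "AE h in P. integrable lborel (\<lambda>y. case (h, y) of (h, y) \<Rightarrow> W h * (U (shift y h) * \<rho> y))"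
      using int2 by simp
  qed
  have "(\<integral>h. W h * mollify \<rho> U h \<partial>P) = (\<integral>h. (\<integral>y. W h * (U (shift y h) * \<rho> y) \<partial>lborel) \<partial>P)"
    by (simp add: mollify_def)
  also have "\<dots> = (\<integral>y. (\<integral>h. W h * (U (shift y h) * \<rho> y) \<partial>P) \<partial>lborel)"
    by (rule Fubini_integral[OF int, symmetric])
  also have "\<dots> = (\<integral>y. \<rho> y * corr W U y \<partial>lborel)"
    by (intro Bochner_Integration.integral_cong refl)
      (simp add: corr_def mult_ac flip: integral_mult_right_zero)
  finally show "(\<integral>h. W h * mollify \<rho> U h \<partial>P) = (\<integral>y. \<rho> y * corr W U y \<partial>lborel)" .
  have "(\<lambda>h. \<integral>y. (\<lambda>(h, y). U (shift y h)) (h, y) * \<rho> y \<partial>lborel) \<in> borel_measurable P"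
    by measurable
  then show "(\<lambda>h. W h * mollify \<rho> U h) \<in> borel_measurable borel"
    using Wm by (simp add: mollify_def[abs_def])
qed

section \<open>Correlations as functions on R^d\<close>

lemma corr_continuous: "W \<in> L2 P \<Longrightarrow> V \<in> L2 P \<Longrightarrow> continuous_on UNIV (corr W V)"
  by (intro continuous_at_imp_continuous_on ballI corr_isCont)

lemma corr_measurable: "W \<in> L2 P \<Longrightarrow> V \<in> L2 P \<Longrightarrow> corr W V \<in> borel_measurable borel"
  by (rule borel_measurable_continuous_onI[OF corr_continuous])

lemma corr_integrable:
  assumes "continuous_on UNIV \<rho>" "vanishes_outside R \<rho>" "W \<in> L2 P" "V \<in> L2 P"
  shows "integrable lborel (\<lambda>y. \<rho> y * corr W V y)"
  using conv_integrable[OF assms(1,2) corr_measurable[OF assms(3,4)] corr_bound[OF assms(3,4)], of 0]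
  by (simp add: mult.commute)

lemma corr_diff:
  assumes "W \<in> L2 P" "V \<in> L2 P" "V' \<in> L2 P"
  shows "corr W V y - corr W V' y = corr W (\<lambda>h. V h - V' h) y"
  using L2_integrable_mult[OF assms(1) L2_shift[OF assms(2), of y]] L2_integrable_mult[OF assms(1) L2_shift[OF assms(3), of y]]
  by (simp add: corr_def algebra_simps)

lemma integral_corr_tendsto:
  assumes \<rho>: "continuous_on UNIV \<rho>" "vanishes_outside R \<rho>" and W: "W \<in> L2 P"
    and V: "\<And>n. V n \<in> L2 P" "V' \<in> L2 P" "(\<lambda>n. L2_dist P (V n) V') \<longlonglongrightarrow> 0"
  shows "(\<lambda>n. \<integral>y. \<rho> y * corr W (V n) y \<partial>lborel) \<longlonglongrightarrow> (\<integral>y. \<rho> y * corr W V' y \<partial>lborel)"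
proof -
  have le: "\<bar>(\<integral>y. \<rho> y * corr W (V n) y \<partial>lborel) - (\<integral>y. \<rho> y * corr W V' y \<partial>lborel)\<bar>
      \<le> (L2_norm P W * (\<integral>y. \<bar>\<rho> y\<bar> \<partial>lborel)) * L2_dist P (V n) V'" for n
  proof -
    have D: "(\<lambda>h. V n h - V' h) \<in> L2 P" by (intro L2_diff V)
    have "(\<integral>y. \<rho> y * corr W (V n) y \<partial>lborel) - (\<integral>y. \<rho> y * corr W V' y \<partial>lborel)
        = (\<integral>y. \<rho> y * corr W (V n) y - \<rho> y * corr W V' y \<partial>lborel)"
      using corr_integrable[OF \<rho> W] V by simp
    also have "\<dots> = (\<integral>y. corr W (\<lambda>h. V n h - V' h) y * \<rho> (y - 0) \<partial>lborel)"
      by (simp add: corr_diff[OF W V(1,2), symmetric] algebra_simps)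
    finally have "(\<integral>y. \<rho> y * corr W (V n) y \<partial>lborel) - (\<integral>y. \<rho> y * corr W V' y \<partial>lborel)
        = conv \<rho> (corr W (\<lambda>h. V n h - V' h)) 0" by (simp add: conv_def)
    with conv_bound[OF \<rho> corr_measurable[OF W D] corr_bound[OF W D], of 0]
    show ?thesis by (simp add: L2_dist_eq_norm mult_ac)
  qed
  have lim: "(\<lambda>n. (L2_norm P W * (\<integral>y. \<bar>\<rho> y\<bar> \<partial>lborel)) * L2_dist P (V n) V') \<longlonglongrightarrow> 0"
    by (rule tendsto_mult_right_zero[OF V(3)])
  have "(\<lambda>n. (\<integral>y. \<rho> y * corr W (V n) y \<partial>lborel) - (\<integral>y. \<rho> y * corr W V' y \<partial>lborel)) \<longlonglongrightarrow> 0"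
    by (rule Lim_null_comparison[OF always_eventually lim]) (simp only: real_norm_def le simp_thms)
  then show ?thesis by (rule LIM_zero_cancel)
qed

text \<open>The increment of U on Omega becomes an increment of the correlation in y, and a
  translation of the integral moves it onto \<rho>. The correlation, known only to be continuous, is
  never differentiated.\<close>

lemma corr_by_parts:
  assumes \<rho>: "Ck 2 \<rho>" "vanishes_outside R \<rho>" and W: "W \<in> L2 P" and U: "has_stoch_deriv P i U U'"
  shows "(\<integral>y. pd i \<rho> y * corr W U y \<partial>lborel) = - (\<integral>y. \<rho> y * corr W U' y \<partial>lborel)"
proof -
  \<comment> \<open>Positive steps, so that norm (v n) = t n and the quotients of \<rho> take the
    form of \<open>difference_quotient_bound\<close>.\<close>
  define t where "t n = inverse (real (Suc n))" for n
  have t: "t \<longlonglongrightarrow> 0" "t n \<noteq> 0" "norm (t n) \<le> 1" for n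
    unfolding t_def[abs_def] by (rule LIMSEQ_inverse_real_of_nat) (simp_all add: inverse_le_1_iff)
  define v where "v n = t n *\<^sub>R (axis i 1 :: real^'n)" for n
  have v: "v \<longlonglongrightarrow> 0" "v n \<noteq> 0" "norm (v n) = \<bar>t n\<bar>" for n
  proof -
    have "(\<lambda>n. t n *\<^sub>R (axis i 1 :: real^'n)) \<longlonglongrightarrow> 0 *\<^sub>R axis i 1" by (intro tendsto_intros t)
    then show "v \<longlonglongrightarrow> 0" by (simp add: v_def[abs_def])
    show "v n \<noteq> 0" using t(2)[of n] by (simp add: v_def axis_eq_0_iff)
    show "norm (v n) = \<bar>t n\<bar>" by (simp add: v_def)
  qed
  have \<rho>1: "Ck 1 \<rho>" by (rule Ck_mono[OF \<rho>(1)]) simp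
  have cont: "continuous_on UNIV \<rho>" "continuous_on UNIV (pd i \<rho>)"
    using Ck_imp_continuous[OF \<rho>1] \<rho>1 by simp_all
  note [measurable] = borel_measurable_continuous_onI[OF cont(1)] borel_measurable_continuous_onI[OF cont(2)]
  note DU = has_stoch_derivD[OF U]
  have cm [measurable]: "corr W U \<in> borel_measurable borel" by (rule corr_measurable[OF W DU(1)])
  have intU: "integrable lborel (\<lambda>y. corr W U y * \<rho> (y - x))" for x
    by (rule conv_integrable[OF cont(1) \<rho>(2) cm corr_bound[OF W DU(1)]])
  have t0: "filterlim t (at 0) sequentially" using t by (simp add: filterlim_at)
  have "(\<lambda>n. L2_dist P (dq i (t n) U) U') \<longlonglongrightarrow> 0" by (rule filterlim_compose[OF DU(3) t0])
  from integral_corr_tendsto[OF cont(1) \<rho>(2) W dq_L2[OF DU(1)] DU(2) this]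
  have 1: "(\<lambda>n. \<integral>y. \<rho> y * corr W (dq i (t n) U) y \<partial>lborel) \<longlonglongrightarrow> (\<integral>y. \<rho> y * corr W U' y \<partial>lborel)" .
  have eq: "(\<integral>y. \<rho> y * corr W (dq i (t n) U) y \<partial>lborel)
      = (\<integral>y. corr W U y * ((\<rho> (y - v n) - \<rho> y) / t n) \<partial>lborel)" for n
  proof -
    have "corr W (dq i (t n) U) y = (corr W U (y + v n) - corr W U y) / t n" for y
    proof -
      have "corr W (dq i (t n) U) y = (\<integral>h. (W h * U (shift (y + v n) h) - W h * U (shift y h)) / t n \<partial>P)"
        by (simp add: corr_def dq_def v_def shift_shift add.commute algebra_simps diff_divide_distrib)
      also have "\<dots> = (corr W U (y + v n) - corr W U y) / t n"
        using L2_integrable_mult[OF W L2_shift[OF DU(1)]] by (simp add: corr_def)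
      finally show ?thesis .
    qed
    then have "\<rho> y * corr W (dq i (t n) U) y = (corr W U (y + v n) * \<rho> y - corr W U y * \<rho> y) / t n" for y
      by (simp only: times_divide_eq_right right_diff_distrib mult.commute[of "\<rho> y"])
    then have "(\<integral>y. \<rho> y * corr W (dq i (t n) U) y \<partial>lborel)
        = (\<integral>y. (corr W U (y + v n) * \<rho> y - corr W U y * \<rho> y) / t n \<partial>lborel)"
      by presburger
    also have "\<dots> = ((\<integral>y. corr W U (y + v n) * \<rho> y \<partial>lborel) - (\<integral>y. corr W U y * \<rho> y \<partial>lborel)) / t n"
    proof -
      have "integrable lborel (\<lambda>y. corr W (\<lambda>h. U (shift (v n) h)) y * \<rho> (y - 0))"
        by (rule conv_integrable[OF cont(1) \<rho>(2) corr_measurable[OF W L2_shift[OF DU(1)]] corr_bound[OF W L2_shift[OF DU(1)]]])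
      then have "integrable lborel (\<lambda>y. corr W U (y + v n) * \<rho> y)"
        by (simp add: corr_def shift_shift add.commute)
      then show ?thesis using intU[of 0] by simp
    qed
    also have "(\<integral>y. corr W U (y + v n) * \<rho> y \<partial>lborel) = conv \<rho> (corr W U) (v n)"
      by (rule conv_translate[symmetric]) measurable
    also have "(conv \<rho> (corr W U) (v n) - (\<integral>y. corr W U y * \<rho> y \<partial>lborel)) / t n
        = (\<integral>y. (corr W U y * \<rho> (y - v n) - corr W U y * \<rho> y) / t n \<partial>lborel)"
      unfolding conv_def using intU[of "v n"] intU[of 0] by simp
    also have "\<dots> = (\<integral>y. corr W U y * ((\<rho> (y - v n) - \<rho> y) / t n) \<partial>lborel)"
      by (simp add: right_diff_distrib diff_divide_distrib)
    finally show ?thesis .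
  qed
  have pdsum: "(\<Sum>j\<in>UNIV. v n $ j * pd j \<rho> y) = t n * pd i \<rho> y" for n y
    by (simp add: v_def axis_def if_distrib[of "\<lambda>a. t n * a * _"] cong: if_cong)
  have tpos: "\<bar>t n\<bar> = t n" "0 < t n" for n by (simp_all add: t_def)
  \<comment> \<open>The shift in \<rho> is backward, so its quotient tends to -
    \<open>pd i \<rho>\<close>; hence the plus sign in this error term.\<close>
  define f where "f n y = corr W U y * ((\<rho> (y - v n) - \<rho> y) / t n + pd i \<rho> y)" for n y
  have feq: "f n y = corr W U y * ((\<rho> (y - v n) - \<rho> y + (\<Sum>j\<in>UNIV. v n $ j * pd j \<rho> y)) / norm (v n))" for n y
    using tpos(2)[of n] unfolding f_def pdsum v(3) tpos(1) by (simp add: add_divide_distrib)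
  obtain K where K: "0 \<le> K" "\<And>x u. u \<noteq> 0 \<Longrightarrow> norm u \<le> 1 \<Longrightarrow>
    \<bar>(\<rho> (x - u) - \<rho> x + (\<Sum>j\<in>UNIV. u $ j * pd j \<rho> x)) / norm u\<bar> \<le> K * indicator (cball 0 (R + 1)) x"
    using \<rho>1 \<rho>(2) by (rule difference_quotient_bound[where L = 1]) blast
  have "(\<lambda>n. \<integral>y. f n y \<partial>lborel) \<longlonglongrightarrow> 0"
  proof (rule integral_tendsto_0_cball)
    show "f n \<in> borel_measurable borel" for n unfolding f_def by measurable
    have d: "\<rho> differentiable (at y)" for y using \<rho>1 by simp
    show "(\<lambda>n. f n y) \<longlonglongrightarrow> 0" for y
      unfolding feq by (rule tendsto_mult_right_zero[OF difference_quotient_tendsto[OF d v(1,2)]])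
    show "\<bar>f n y\<bar> \<le> (L2_norm P W * L2_norm P U * K) * indicator (cball 0 (R + 1)) y" for n y
    proof -
      have "\<bar>f n y\<bar> \<le> (L2_norm P W * L2_norm P U) * (K * indicator (cball 0 (R + 1)) y)"
        unfolding feq abs_mult using t(3)[of n]
        by (intro mult_mono corr_bound[OF W DU(1)] K(2) v) (simp_all add: v(3))
      then show ?thesis by (simp add: mult_ac)
    qed
  qed
  moreover have "(\<integral>y. f n y \<partial>lborel) = (\<integral>y. corr W U y * ((\<rho> (y - v n) - \<rho> y) / t n) \<partial>lborel)
      + (\<integral>y. pd i \<rho> y * corr W U y \<partial>lborel)" for n
  proof -
    have "integrable lborel (\<lambda>y. (corr W U y * \<rho> (y - v n) - corr W U y * \<rho> (y - 0)) / t n)"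
      by (intro integrable_divide Bochner_Integration.integrable_diff intU)
    then have "integrable lborel (\<lambda>y. corr W U y * ((\<rho> (y - v n) - \<rho> y) / t n))"
      by (simp add: right_diff_distrib diff_divide_distrib)
    moreover have "integrable lborel (\<lambda>y. pd i \<rho> y * corr W U y)"
      by (rule corr_integrable[OF cont(2) pd_vanishes_outside[OF \<rho>(2)] W DU(1)])
    ultimately show ?thesis by (simp add: f_def distrib_left mult.commute[of "pd i \<rho> _"])
  qed
  ultimately have "(\<lambda>n. (\<integral>y. \<rho> y * corr W (dq i (t n) U) y \<partial>lborel) + (\<integral>y. pd i \<rho> y * corr W U y \<partial>lborel)) \<longlonglongrightarrow> 0"
    by (simp add: eq)
  moreover have "(\<lambda>n. (\<integral>y. \<rho> y * corr W (dq i (t n) U) y \<partial>lborel) + (\<integral>y. pd i \<rho> y * corr W U y \<partial>lborel))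
      \<longlonglongrightarrow> (\<integral>y. \<rho> y * corr W U' y \<partial>lborel) + (\<integral>y. pd i \<rho> y * corr W U y \<partial>lborel)"
    by (intro tendsto_add 1 tendsto_const)
  ultimately have "(\<integral>y. \<rho> y * corr W U' y \<partial>lborel) + (\<integral>y. pd i \<rho> y * corr W U y \<partial>lborel) = 0"
    using LIMSEQ_unique by blast
  then show ?thesis by linarith
qed

text \<open>Orthogonality to the gradients of the mollified truncations of \<open>U\<close> says that the continuous
  function \<open>y \<mapsto> \<integral> W \<bullet> (\<D>U \<circ> \<tau>\<^sub>y)\<close> integrates to zero against every bump function, hence vanishes
  at the origin.\<close>

theorem gradient_orthogonality:
  assumes W: "W \<in> L2 P" and orth: "\<And>\<phi>. \<phi> \<in> Cb 2 \<Longrightarrow> (\<integral>h. W h \<bullet> grad_D P \<phi> h \<partial>P) = 0"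
    and U: "U \<in> sob1 P"
  shows "(\<integral>h. W h \<bullet> grad_D P U h \<partial>P) = 0"
proof -
  define w where "w i h = W h $ i" for i h
  have w: "w i \<in> L2 P" for i unfolding w_def by (rule L2_vecD[OF W])
  have UL: "U \<in> L2 P" by (rule sob1_L2[OF U])
  define b where "b y = (\<Sum>i\<in>UNIV. corr (w i) (stoch_D P i U) y)" for y
  have DU: "stoch_D P i U \<in> L2 P" for i by (rule has_stoch_derivD(2)[OF sob1_stoch_D[OF U]])
  have zero: "(\<integral>y. \<rho> y * b y \<partial>lborel) = 0" if \<rho>: "Ck 2 \<rho>" "vanishes_outside R \<rho>" for \<rho> R
  proof -
    have \<rho>1: "Ck 1 \<rho>" by (rule Ck_mono[OF \<rho>(1)]) simp
    have cont: "continuous_on UNIV \<rho>" "continuous_on UNIV (pd i \<rho>)" for i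
      using Ck_imp_continuous[OF \<rho>1] \<rho>1 by simp_all
    \<comment> \<open>Mollification asks for a bounded function. The derivative stays on \<rho>
      while U is truncated, so L^2 convergence of the truncations suffices and no truncated function
      is differentiated.\<close>
    define Utr where "Utr n h = trunc n (U h)" for n h
    have Utr: "Utr n \<in> L2 P" "(\<lambda>n. L2_dist P (Utr n) U) \<longlonglongrightarrow> 0" for n
      unfolding Utr_def by (rule trunc_L2[OF UL])+
    have "(\<Sum>i\<in>UNIV. \<integral>y. pd i \<rho> y * corr (w i) (Utr n) y \<partial>lborel) = 0" for n
    proof -
      have Utr_meas: "Utr n \<in> borel_measurable borel" using L2_measurable[OF Utr(1)[of n]] by simp
      have bd: "\<And>h. \<bar>Utr n h\<bar> \<le> real n" unfolding Utr_def by (rule trunc_bound(1))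
      note moll = mollify_corr[OF cont(2) pd_vanishes_outside[OF \<rho>(2)] Utr_meas bd w]
      have C: "mollify \<rho> (Utr n) \<in> Cb 2" by (rule mollify_Cb[OF \<rho> Utr_meas bd])
      have ae: "AE h in P. \<forall>i. stoch_D P i (mollify \<rho> (Utr n)) h = - mollify (pd i \<rho>) (Utr n) h"
        using mollify_gradient[OF \<rho> Utr_meas bd] by (simp add: AE_all_countable)
      have "0 = (\<integral>h. W h \<bullet> grad_D P (mollify \<rho> (Utr n)) h \<partial>P)" using orth[OF C] by simp
      also have "\<dots> = (\<Sum>i\<in>UNIV. \<integral>h. w i h * stoch_D P i (mollify \<rho> (Utr n)) h \<partial>P)"
        unfolding L2_inner_vec[OF W grad_D_L2[OF Cb2_sob1[OF C]]] by (simp add: w_def grad_D_def)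
      also have "\<dots> = (\<Sum>i\<in>UNIV. - (\<integral>h. w i h * mollify (pd i \<rho>) (Utr n) h \<partial>P))"
      proof (intro sum.cong refl)
        fix i
        have "(\<integral>h. w i h * stoch_D P i (mollify \<rho> (Utr n)) h \<partial>P)
            = (\<integral>h. - (w i h * mollify (pd i \<rho>) (Utr n) h) \<partial>P)"
        proof (rule integral_cong_AE)
          show "(\<lambda>h. w i h * stoch_D P i (mollify \<rho> (Utr n)) h) \<in> borel_measurable P"
            using L2_measurable[OF w[of i]] L2_measurable[OF has_stoch_derivD(2)[OF sob1_stoch_D[OF Cb2_sob1[OF C]], of i]]
            by (rule borel_measurable_times)
          show "(\<lambda>h. - (w i h * mollify (pd i \<rho>) (Utr n) h)) \<in> borel_measurable P"
            using moll(2)[of i i] by simp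
          show "AE h in P. w i h * stoch_D P i (mollify \<rho> (Utr n)) h = - (w i h * mollify (pd i \<rho>) (Utr n) h)"
            using ae by eventually_elim simp
        qed
        then show "(\<integral>h. w i h * stoch_D P i (mollify \<rho> (Utr n)) h \<partial>P)
            = - (\<integral>h. w i h * mollify (pd i \<rho>) (Utr n) h \<partial>P)" by simp
      qed
      also have "\<dots> = - (\<Sum>i\<in>UNIV. \<integral>y. pd i \<rho> y * corr (w i) (Utr n) y \<partial>lborel)"
        by (simp add: moll(1) sum_negf)
      finally show ?thesis by simp
    qed
    moreover have "(\<lambda>n. \<Sum>i\<in>UNIV. \<integral>y. pd i \<rho> y * corr (w i) (Utr n) y \<partial>lborel)
        \<longlonglongrightarrow> (\<Sum>i\<in>UNIV. \<integral>y. pd i \<rho> y * corr (w i) U y \<partial>lborel)"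
      by (intro tendsto_sum integral_corr_tendsto[OF cont(2) pd_vanishes_outside[OF \<rho>(2)] w Utr(1) UL Utr(2)])
    ultimately have "(\<Sum>i\<in>UNIV. \<integral>y. pd i \<rho> y * corr (w i) U y \<partial>lborel) = 0"
      by (simp add: LIMSEQ_const_iff)
    \<comment> \<open>With the truncation removed, the derivative is returned from \<rho> to
      U.\<close>
    then have "(\<Sum>i\<in>UNIV. \<integral>y. \<rho> y * corr (w i) (stoch_D P i U) y \<partial>lborel) = 0"
      by (simp add: corr_by_parts[OF \<rho> w sob1_stoch_D[OF U]] sum_negf)
    moreover have "(\<integral>y. \<rho> y * b y \<partial>lborel) = (\<Sum>i\<in>UNIV. \<integral>y. \<rho> y * corr (w i) (stoch_D P i U) y \<partial>lborel)"
      unfolding b_def sum_distrib_left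
      by (intro Bochner_Integration.integral_sum corr_integrable[OF cont(1) \<rho>(2) w DU])
    ultimately show ?thesis by simp
  qed
  have "\<bar>b 0\<bar> \<le> e" if e: "e > 0" for e
  proof -
    have "isCont b 0" unfolding b_def by (intro continuous_intros corr_isCont w DU)
    then obtain d where d: "d > 0" "\<And>y. norm y < d \<Longrightarrow> \<bar>b y - b 0\<bar> < e"
      unfolding isCont_def LIM_def using e by (auto simp: dist_norm) (metis abs_0 diff_self)
    \<comment> \<open>Radius d / 2 keeps the support inside the open ball on which b stays within e
      of b 0.\<close>
    let ?\<rho> = "bump (d / 2) :: real^'n \<Rightarrow> real"
    have v: "vanishes_outside (d / 2) ?\<rho>" using d(1) by (intro bump_vanishes) simp
    have cont: "continuous_on UNIV ?\<rho>" by (rule Ck_imp_continuous[OF bump_Ck])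
    have int: "integrable lborel ?\<rho>" by (rule vanishes_outside_integrable[OF cont v])
    have intb: "integrable lborel (\<lambda>y. ?\<rho> y * b y)"
      unfolding b_def sum_distrib_left
      by (intro Bochner_Integration.integrable_sum corr_integrable[OF cont v w DU])
    have I: "0 < integral\<^sup>L lborel ?\<rho>" using d(1) by (intro bump_integral_pos) simp
    have "(\<integral>y. ?\<rho> y * (b 0 - b y) \<partial>lborel) = (\<integral>y. ?\<rho> y * b 0 - ?\<rho> y * b y \<partial>lborel)"
      by (simp only: right_diff_distrib)
    also have "\<dots> = integral\<^sup>L lborel ?\<rho> * b 0 - (\<integral>y. ?\<rho> y * b y \<partial>lborel)"
      by (subst Bochner_Integration.integral_diff[OF integrable_mult_left intb])
        (simp_all only: int simp_thms integral_mult_left_zero)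
    finally have "(\<integral>y. ?\<rho> y * (b 0 - b y) \<partial>lborel) = integral\<^sup>L lborel ?\<rho> * b 0"
      unfolding zero[OF bump_Ck v] diff_0_right .
    then have "b 0 * integral\<^sup>L lborel ?\<rho> = (\<integral>y. ?\<rho> y * (b 0 - b y) \<partial>lborel)"
      by (metis mult.commute)
    then have "\<bar>b 0\<bar> * integral\<^sup>L lborel ?\<rho> = \<bar>\<integral>y. ?\<rho> y * (b 0 - b y) \<partial>lborel\<bar>"
      using I by (metis abs_mult abs_of_pos)
    also have "\<dots> \<le> (\<integral>y. \<bar>?\<rho> y * (b 0 - b y)\<bar> \<partial>lborel)" by (rule integral_abs_bound)
    also have "\<dots> \<le> (\<integral>y. e * ?\<rho> y \<partial>lborel)"
    proof (rule integral_mono)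
      show "integrable lborel (\<lambda>y. \<bar>?\<rho> y * (b 0 - b y)\<bar>)"
        unfolding right_diff_distrib
        by (intro integrable_abs Bochner_Integration.integrable_diff intb integrable_mult_left int)
      show "integrable lborel (\<lambda>y. e * ?\<rho> y)" by (intro integrable_mult_right int)
      fix y
      show "\<bar>?\<rho> y * (b 0 - b y)\<bar> \<le> e * ?\<rho> y"
      proof (cases "norm y < d")
        case True
        from d(2)[OF this] have "\<bar>b 0 - b y\<bar> \<le> e" by (simp add: abs_minus_commute)
        from mult_right_mono[OF this bump_nonneg[of "d / 2" y]] show ?thesis
          by (simp add: abs_mult bump_nonneg mult.commute)
      next
        case False
        then have "?\<rho> y = 0" using v d(1) by (simp add: vanishes_outside_def)
        then show ?thesis by simp
      qed
    qed
    also have "\<dots> = e * integral\<^sup>L lborel ?\<rho>" by simp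
    finally show ?thesis using I by simp
  qed
  then have "b 0 = 0" using dense_ge[of 0 "\<bar>b 0\<bar>"] by fastforce
  then show ?thesis
    unfolding L2_inner_vec[OF W grad_D_L2[OF U]] by (simp add: b_def corr_def w_def grad_D_def)
qed

end

section \<open>The space \<open>\<H>\<^sub>1\<close> and the correctors\<close>

lemma integrable_matrixI:
  fixes A :: "'a \<Rightarrow> real^'n^'m"
  assumes "\<And>i j. integrable M (\<lambda>x. A x $ i $ j)"
  shows "integrable M A"
proof -
  have eq: "B = (\<Sum>i\<in>UNIV. \<Sum>j\<in>UNIV. (B $ i $ j) *\<^sub>R axis i (axis j 1))" for B :: "real^'n^'m"
  proof -
    have "(\<Sum>y\<in>UNIV. if i = x then if j = y then B $ x $ y else 0 else 0) = (if i = x then B $ x $ j else 0)"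
      for i x :: 'm and j :: 'n by (cases "i = x") simp_all
    then show ?thesis
      by (simp add: vec_eq_iff axis_def if_distrib[of "\<lambda>v. v $ _"] if_distrib[of "\<lambda>a. _ * a"] cong: if_cong)
  qed
  have "integrable M (\<lambda>x. \<Sum>i\<in>UNIV. \<Sum>j\<in>UNIV. (A x $ i $ j) *\<^sub>R axis i (axis j 1) :: real^'n^'m)"
    by (intro Bochner_Integration.integrable_sum integrable_scaleR_left assms)
  then show ?thesis by (simp flip: eq)
qed

lemma integral_quadratic:
  fixes A :: "'a \<Rightarrow> real^'n^'m"
  assumes "integrable M A"
  shows "(\<integral>h. y \<bullet> (A h *v x) \<partial>M) = y \<bullet> ((\<integral>h. A h \<partial>M) *v x)"
proof (rule integral_bounded_linear[OF _ assms])
  have "linear (\<lambda>B :: real^'n^'m. y \<bullet> (B *v x))"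
    by (rule linearI)
      (simp_all add: matrix_vector_mult_add_rdistrib inner_add_right flip: scaleR_matrix_vector_assoc)
  then show "bounded_linear (\<lambda>B :: real^'n^'m. y \<bullet> (B *v x))"
    by (simp add: linear_conv_bounded_linear)
qed

text \<open>Reduces integrability and symmetry of a matrix to statements about its bilinear
  form.\<close>

lemma matrix_nth_quadratic: "A $ i $ j = axis i 1 \<bullet> (A *v axis j 1)" for A :: "real^'n^'m"
  by (simp add: inner_axis' matrix_vector_mult_basis column_def)

context admissible_measure
begin

section \<open>The energy form on square-integrable fields\<close>

definition qform :: "('n C3 \<Rightarrow> real^'n) \<Rightarrow> ('n C3 \<Rightarrow> real^'n) \<Rightarrow> real" where
  "qform V W = (\<integral>h. V h \<bullet> flux h (W h) \<partial>P)"

lemma qform_integrable: "V \<in> L2 P \<Longrightarrow> W \<in> L2 P \<Longrightarrow> integrable P (\<lambda>h. V h \<bullet> flux h (W h))"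
  by (intro L2_integrable_inner flux_L2)

lemma qform_commute: "qform V W = qform W V"
  unfolding qform_def by (simp add: inner_flux_commute[of "V _"])

lemma qform_add_left:
  "V \<in> L2 P \<Longrightarrow> V' \<in> L2 P \<Longrightarrow> W \<in> L2 P \<Longrightarrow> qform (\<lambda>h. V h + V' h) W = qform V W + qform V' W"
  unfolding qform_def inner_add_left by (intro Bochner_Integration.integral_add qform_integrable)

lemma qform_add_right:
  "V \<in> L2 P \<Longrightarrow> V' \<in> L2 P \<Longrightarrow> W \<in> L2 P \<Longrightarrow> qform W (\<lambda>h. V h + V' h) = qform W V + qform W V'"
  using qform_add_left by (simp add: qform_commute[of W])

lemma qform_nonneg: "0 \<le> qform V V"
  unfolding qform_def by (simp add: inner_flux_nonneg)

lemma qform_cong_AE: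
  assumes "V \<in> L2 P" "V' \<in> L2 P" "W \<in> L2 P" "W' \<in> L2 P"
    "AE h in P. V h = V' h" "AE h in P. W h = W' h"
  shows "qform V W = qform V' W'"
proof -
  have "AE h in P. V h \<bullet> flux h (W h) = V' h \<bullet> flux h (W' h)"
    using assms(5,6) by eventually_elim simp
  then show ?thesis unfolding qform_def
    using assms(1-4) by (intro integral_cong_AE borel_measurable_integrable qform_integrable)
qed

lemma qform_tendsto:
  assumes "\<And>n. V n \<in> L2 P" "V0 \<in> L2 P" "((\<lambda>n. L2_dist P (V n) V0) \<longlongrightarrow> 0) F"
    "\<And>n. W n \<in> L2 P" "W0 \<in> L2 P" "((\<lambda>n. L2_dist P (W n) W0) \<longlongrightarrow> 0) F"
  shows "((\<lambda>n. qform (V n) (W n)) \<longlongrightarrow> qform V0 W0) F"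
  unfolding qform_def
  by (rule L2_tendsto_inner[OF assms(1-3) flux_L2[OF assms(4)] flux_L2[OF assms(5)] flux_tendsto[OF assms(4-6)]])

lemma qform_tendsto_left:
  assumes "\<And>n. V n \<in> L2 P" "V0 \<in> L2 P" "((\<lambda>n. L2_dist P (V n) V0) \<longlongrightarrow> 0) F" "W \<in> L2 P"
  shows "((\<lambda>n. qform (V n) W) \<longlongrightarrow> qform V0 W) F"
  unfolding qform_def by (rule L2_tendsto_inner_left[OF assms(1-3) flux_L2[OF assms(4)]])

text \<open>Coercivity: \<open>flux h\<close> is bounded below by 1 / vol, which is at least 1 / K
  almost surely.\<close>

lemma L2_norm_le_qform:
  obtains C where "0 < C" "\<And>V. V \<in> L2 P \<Longrightarrow> L2_norm P V \<le> C * sqrt (qform V V)"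
proof -
  obtain K where K: "1 \<le> K" "AE h in P. vol 0 h \<le> K" by (rule vol_bounded)
  have "L2_norm P V \<le> sqrt K * sqrt (qform V V)" if V: "V \<in> L2 P" for V
  proof -
    have "(L2_norm P V)\<^sup>2 = (\<integral>h. V h \<bullet> V h \<partial>P)" by (rule L2_norm_sq)
    also have "\<dots> \<le> (\<integral>h. K * (V h \<bullet> flux h (V h)) \<partial>P)"
    proof (rule integral_mono_AE)
      show "AE h in P. V h \<bullet> V h \<le> K * (V h \<bullet> flux h (V h))"
        using K(2)
      proof eventually_elim
        case (elim h)
        have "V h \<bullet> V h \<le> vol 0 h * (V h \<bullet> flux h (V h))"
          using inner_flux_lower[of "V h" h] vol_pos[of h] by (simp add: divide_le_eq mult.commute)
        also have "\<dots> \<le> K * (V h \<bullet> flux h (V h))"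
          by (intro mult_right_mono elim inner_flux_nonneg)
        finally show ?case .
      qed
    qed (use V in \<open>auto intro: L2_integrable_inner qform_integrable\<close>)
    also have "\<dots> = K * qform V V" by (simp add: qform_def)
    finally show ?thesis using K(1) by (simp add: real_le_rsqrt flip: real_sqrt_mult)
  qed
  then show ?thesis using that[of "sqrt K"] K(1) by simp
qed

lemma qform_eq_0:
  assumes "V \<in> L2 P" "qform V V = 0"
  shows "AE h in P. V h = 0"
proof -
  obtain C where "\<And>V. V \<in> L2 P \<Longrightarrow> L2_norm P V \<le> C * sqrt (qform V V)" by (rule L2_norm_le_qform) blast
  from this[OF assms(1)] have "L2_norm P V = 0" using assms(2) L2_norm_nonneg[of P V] by simp
  then have "L2_dist P V (\<lambda>_. 0) = 0" by (simp add: L2_dist_eq_norm)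
  then show ?thesis using L2_dist_0_iff[OF assms(1) L2_zero] by simp
qed

subsection \<open>Gradients of elements of \<open>\<H>\<^sub>1\<close>\<close>

lemma norm1_eq: "norm1 P \<phi> = sqrt (qform (grad_D P \<phi>) (grad_D P \<phi>) / Znorm P)"
  by (simp add: norm1_def qform_def flux_def mult.commute)

lemma norm1_diff:
  assumes "\<phi> \<in> sob1 P" "\<psi> \<in> sob1 P"
  shows "norm1 P (\<lambda>h. \<phi> h - \<psi> h) = sqrt (qform (\<lambda>h. grad_D P \<phi> h - grad_D P \<psi> h)
    (\<lambda>h. grad_D P \<phi> h - grad_D P \<psi> h) / Znorm P)"
proof -
  note D = grad_D_lincomb[OF assms, of "-1"]
  have L: "(\<lambda>h. grad_D P \<phi> h - grad_D P \<psi> h) \<in> L2 P" by (intro L2_diff grad_D_L2 assms)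
  have "grad_D P (\<lambda>h. \<phi> h - \<psi> h) \<in> L2 P" using grad_D_L2[OF D(1)] by simp
  from qform_cong_AE[OF this L this L] D(2)
  show ?thesis by (simp add: norm1_eq)
qed

lemma L2_dist_le_norm1:
  obtains C where "0 < C" "\<And>\<phi> \<psi>. \<phi> \<in> sob1 P \<Longrightarrow> \<psi> \<in> sob1 P \<Longrightarrow>
    L2_dist P (grad_D P \<phi>) (grad_D P \<psi>) \<le> C * norm1 P (\<lambda>h. \<phi> h - \<psi> h)"
proof -
  obtain C where C: "0 < C" "\<And>V. V \<in> L2 P \<Longrightarrow> L2_norm P V \<le> C * sqrt (qform V V)"
    by (rule L2_norm_le_qform) blast
  have Z: "0 < Znorm P" using Znorm_ge_1 by simp
  have "L2_dist P (grad_D P \<phi>) (grad_D P \<psi>) \<le> C * sqrt (Znorm P) * norm1 P (\<lambda>h. \<phi> h - \<psi> h)"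
    if "\<phi> \<in> sob1 P" "\<psi> \<in> sob1 P" for \<phi> \<psi>
    using C(2)[OF L2_diff[OF grad_D_L2[OF that(1)] grad_D_L2[OF that(2)]]] Z
    by (simp add: norm1_diff[OF that] L2_dist_eq_norm real_sqrt_divide)
  then show ?thesis using that[of "C * sqrt (Znorm P)"] C(1) Z by simp
qed

lemma cauchy1_sob1: "cauchy1 P u \<Longrightarrow> u n \<in> sob1 P"
  unfolding cauchy1_def pre_H1_def using Cb2_sob1 by blast

lemma cauchy1_limit:
  assumes "cauchy1 P u"
  shows "\<exists>W\<in>L2 P. (\<lambda>n. L2_dist P (grad_D P (u n)) W) \<longlonglongrightarrow> 0"
proof (rule L2_complete)
  note s = cauchy1_sob1[OF assms]
  show "grad_D P (u n) \<in> L2 P" for n by (rule grad_D_L2[OF s])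
  fix e :: real assume e: "e > 0"
  obtain C where C: "0 < C" "\<And>\<phi> \<psi>. \<phi> \<in> sob1 P \<Longrightarrow> \<psi> \<in> sob1 P \<Longrightarrow>
    L2_dist P (grad_D P \<phi>) (grad_D P \<psi>) \<le> C * norm1 P (\<lambda>h. \<phi> h - \<psi> h)"
    by (rule L2_dist_le_norm1) blast
  have "0 < e / C" using e C(1) by simp
  then obtain N where N: "\<forall>m\<ge>N. \<forall>n\<ge>N. norm1 P (\<lambda>h. u m h - u n h) < e / C"
    using assms unfolding cauchy1_def by blast
  show "\<exists>N. \<forall>i\<ge>N. \<forall>j\<ge>N. L2_dist P (grad_D P (u i)) (grad_D P (u j)) < e"
  proof (intro exI[of _ N] allI impI)
    fix i j assume "N \<le> i" "N \<le> j"
    then have "C * norm1 P (\<lambda>h. u i h - u j h) < C * (e / C)"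
      using N C(1) by (intro mult_strict_left_mono) auto
    then show "L2_dist P (grad_D P (u i)) (grad_D P (u j)) < e"
      using C(2)[OF s s, of i j] C(1) by simp
  qed
qed

text \<open>The choice behind \<open>grad_H1\<close> provides convergence along one representative
  only. By coercivity the gradients of equivalent sequences are asymptotically equal in L^2, so
  every representative has this limit.\<close>

lemma grad_H1_tendsto:
  assumes a: "a \<in> H1 P"
  shows "grad_H1 P a \<in> L2 P"
    "u \<in> a \<Longrightarrow> cauchy1 P u \<and> (\<lambda>n. L2_dist P (grad_D P (u n)) (grad_H1 P a)) \<longlonglongrightarrow> 0"
    "\<exists>u. u \<in> a"
proof -
  obtain u0 where u0: "cauchy1 P u0" "a = rel1 P `` {u0}"
    using a unfolding H1_def quotient_def by blast
  have "norm1 P (\<lambda>h. u0 n h - u0 n h) = 0" for n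
    unfolding norm1_diff[OF cauchy1_sob1[OF u0(1)] cauchy1_sob1[OF u0(1)]] by (simp add: qform_def)
  then have "u0 \<in> a" using u0 by (simp add: rel1_def)
  then show "\<exists>u. u \<in> a" by blast
  define Q where "Q W \<longleftrightarrow> W \<in> L2 P \<and> (\<exists>u\<in>a. (\<lambda>n. L2_dist P (grad_D P (u n)) W) \<longlonglongrightarrow> 0)" for W
  have "\<exists>W. Q W" using cauchy1_limit[OF u0(1)] \<open>u0 \<in> a\<close> unfolding Q_def by blast
  from someI_ex[OF this] have "Q (grad_H1 P a)" unfolding grad_H1_def Q_def .
  then obtain u1 where G: "grad_H1 P a \<in> L2 P"
    and u1: "u1 \<in> a" "(\<lambda>n. L2_dist P (grad_D P (u1 n)) (grad_H1 P a)) \<longlonglongrightarrow> 0"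
    unfolding Q_def by blast
  show "grad_H1 P a \<in> L2 P" by (rule G)
  obtain C where C: "0 < C" "\<And>\<phi> \<psi>. \<phi> \<in> sob1 P \<Longrightarrow> \<psi> \<in> sob1 P \<Longrightarrow>
    L2_dist P (grad_D P \<phi>) (grad_D P \<psi>) \<le> C * norm1 P (\<lambda>h. \<phi> h - \<psi> h)"
    by (rule L2_dist_le_norm1) blast
  have rel: "cauchy1 P u" "(\<lambda>n. norm1 P (\<lambda>h. u0 n h - u n h)) \<longlonglongrightarrow> 0" if "u \<in> a" for u
    using that u0(2) unfolding rel1_def by auto
  show "cauchy1 P u \<and> (\<lambda>n. L2_dist P (grad_D P (u n)) (grad_H1 P a)) \<longlonglongrightarrow> 0" if u: "u \<in> a"
  proof
    show "cauchy1 P u" by (rule rel(1)[OF u])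
    note s = cauchy1_sob1[OF rel(1)[OF u]] cauchy1_sob1[OF rel(1)[OF u1(1)]] cauchy1_sob1[OF u0(1)]
    \<comment> \<open>u is compared with u1 through u0, because the class a is given as the class of
      u0.\<close>
    have lim: "(\<lambda>n. C * norm1 P (\<lambda>h. u0 n h - u n h) + (C * norm1 P (\<lambda>h. u0 n h - u1 n h)
        + L2_dist P (grad_D P (u1 n)) (grad_H1 P a))) \<longlonglongrightarrow> 0"
      by (intro tendsto_add_zero tendsto_mult_right_zero rel(2)[OF u] rel(2)[OF u1(1)] u1(2))
    have le: "L2_dist P (grad_D P (u n)) (grad_H1 P a) \<le> C * norm1 P (\<lambda>h. u0 n h - u n h)
        + (C * norm1 P (\<lambda>h. u0 n h - u1 n h) + L2_dist P (grad_D P (u1 n)) (grad_H1 P a))" for n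
      using L2_dist_triangle[OF grad_D_L2[OF s(1)] grad_D_L2[OF s(3)] G, of n n]
        L2_dist_triangle[OF grad_D_L2[OF s(3)] grad_D_L2[OF s(2)] G, of n n]
        C(2)[OF s(3,1), of n n] C(2)[OF s(3,2), of n n]
      by (simp add: L2_dist_commute[of P "grad_D P (u n)" "grad_D P (u0 n)"])
    show "(\<lambda>n. L2_dist P (grad_D P (u n)) (grad_H1 P a)) \<longlonglongrightarrow> 0"
      by (rule tendsto_sandwich[OF always_eventually always_eventually tendsto_const lim]) (simp_all add: le)
  qed
qed

lemma L2_tendsto_diff:
  fixes V V' :: "'b \<Rightarrow> 'n C3 \<Rightarrow> real^'n"
  assumes "\<And>n. V n \<in> L2 P" "W \<in> L2 P" "((\<lambda>n. L2_dist P (V n) W) \<longlongrightarrow> 0) F"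
    "\<And>n. V' n \<in> L2 P" "W' \<in> L2 P" "((\<lambda>n. L2_dist P (V' n) W') \<longlongrightarrow> 0) F"
  shows "((\<lambda>n. L2_dist P (\<lambda>h. V n h - V' n h) (\<lambda>h. W h - W' h)) \<longlongrightarrow> 0) F"
proof -
  have lim: "((\<lambda>n. L2_dist P (V n) W + L2_dist P (V' n) W') \<longlongrightarrow> 0) F"
    using tendsto_add[OF assms(3,6)] by simp
  have le: "L2_dist P (\<lambda>h. V n h - V' n h) (\<lambda>h. W h - W' h) \<le> L2_dist P (V n) W + L2_dist P (V' n) W'" for n
    using L2_dist_add[OF assms(1)[of n] L2_minus[OF assms(4)[of n]] assms(2) L2_minus[OF assms(5)]]
      L2_dist_scaleR[of P "-1" "V' n" W'] by simp
  show ?thesis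
    by (rule tendsto_sandwich[OF always_eventually always_eventually tendsto_const lim]) (simp_all add: le)
qed

text \<open>The limit exists and agrees for all pairs of representatives, which settles the definite
  description in \<open>dist1\<close>. Convergence in H1 thereby becomes L^2 convergence of
  gradients.\<close>

lemma dist1_eq:
  assumes a: "a \<in> H1 P" and b: "b \<in> H1 P"
  shows "dist1 P a b = sqrt (qform (\<lambda>h. grad_H1 P a h - grad_H1 P b h)
    (\<lambda>h. grad_H1 P a h - grad_H1 P b h) / Znorm P)" (is "_ = ?r")
proof -
  have lim: "(\<lambda>n. norm1 P (\<lambda>h. u n h - v n h)) \<longlonglongrightarrow> ?r" if u: "u \<in> a" and v: "v \<in> b" for u v
  proof -
    note U = grad_H1_tendsto(2)[OF a u] and V = grad_H1_tendsto(2)[OF b v]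
    note su = cauchy1_sob1[OF conjunct1[OF U]] and sv = cauchy1_sob1[OF conjunct1[OF V]]
    note G = grad_H1_tendsto(1)[OF a] grad_H1_tendsto(1)[OF b]
    have d: "(\<lambda>n. L2_dist P (\<lambda>h. grad_D P (u n) h - grad_D P (v n) h)
        (\<lambda>h. grad_H1 P a h - grad_H1 P b h)) \<longlonglongrightarrow> 0"
      using U V by (intro L2_tendsto_diff grad_D_L2 su sv G) auto
    have L: "(\<lambda>h. grad_D P (u n) h - grad_D P (v n) h) \<in> L2 P" for n
      by (intro L2_diff grad_D_L2 su sv)
    note L0 = L2_diff[OF G]
    show ?thesis unfolding norm1_diff[OF su sv]
      using Znorm_ge_1 by (intro tendsto_real_sqrt tendsto_divide tendsto_const qform_tendsto[OF L L0 d L L0 d]) simp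
  qed
  obtain u v where uv: "u \<in> a" "v \<in> b" using grad_H1_tendsto(3)[OF a] grad_H1_tendsto(3)[OF b] by blast
  show ?thesis unfolding dist1_def
  proof (rule the_equality)
    show "\<exists>u\<in>a. \<exists>v\<in>b. (\<lambda>n. norm1 P (\<lambda>h. u n h - v n h)) \<longlonglongrightarrow> ?r" using uv lim by blast
    fix r assume "\<exists>u\<in>a. \<exists>v\<in>b. (\<lambda>n. norm1 P (\<lambda>h. u n h - v n h)) \<longlonglongrightarrow> r"
    then show "r = ?r" using lim LIMSEQ_unique by blast
  qed
qed

subsection \<open>The resolvent equation\<close>

lemma drift_measurable: "(\<lambda>h. drift 0 h \<bullet> e) \<in> borel_measurable borel" for e :: "real^'n"
proof -
  have "(\<lambda>h. pd j (\<lambda>z. coeff i j (shift z h)) 0) \<in> borel_measurable borel" for i j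
    using L2_measurable[OF has_stoch_derivD(2)[OF smooth1_deriv[OF smooth1_coeff, of j i j]]] by simp
  then have "(\<lambda>h. \<Sum>i\<in>UNIV. ((\<Sum>j\<in>UNIV. pd j (\<lambda>z. coeff i j (shift z h)) 0) / vol 0 h) * e $ i) \<in> borel_measurable borel"
    by (intro borel_measurable_sum borel_measurable_times borel_measurable_divide vol_measurable borel_measurable_const)
  then show ?thesis
    by (simp add: inner_vec_def drift_def coeff_def flip: vol_shift ginv_shift)
qed

lemma mult_vol_L2: "f \<in> L2 P \<Longrightarrow> (\<lambda>h. f h * vol 0 h) \<in> L2 P" for f :: "'n C3 \<Rightarrow> real"
proof -
  assume f: "f \<in> L2 P"
  obtain K where K: "1 \<le> K" "AE h in P. vol 0 h \<le> K" by (rule vol_bounded)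
  show ?thesis
  proof (rule L2_dominated(1)[OF _ f])
    show "(\<lambda>h. f h * vol 0 h) \<in> borel_measurable P"
      using L2_measurable[OF f] by simp
    show "AE h in P. norm (f h * vol 0 h) \<le> K * norm (f h)"
      using K(2)
    proof eventually_elim
      case (elim h)
      then show ?case using mult_right_mono[OF elim, of "\<bar>f h\<bar>"] vol_pos[of h]
        by (simp add: abs_mult mult.commute)
    qed
  qed
qed

lemma represents1_approx:
  assumes "represents1 P f a"
  obtains u where "a \<in> H1 P" "f \<in> L2 P" "u \<in> a" "\<And>n. u n \<in> Cb 2" "(\<lambda>n. L2_dist P (u n) f) \<longlonglongrightarrow> 0"
proof -
  obtain u where a: "a \<in> H1 P" "f \<in> L2 P" and u: "u \<in> a" "(\<lambda>n. L2_dist (piM P) (u n) f) \<longlonglongrightarrow> 0"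
    using assms L2_piM unfolding represents1_def by blast
  have C: "u n \<in> Cb 2" for n
    using grad_H1_tendsto(2)[OF a(1) u(1)] unfolding cauchy1_def pre_H1_def by blast
  have lim: "(\<lambda>n. sqrt (Znorm P) * L2_dist (piM P) (u n) f) \<longlonglongrightarrow> 0"
    by (rule tendsto_mult_right_zero[OF u(2)])
  have "(\<lambda>n. L2_dist P (u n) f) \<longlonglongrightarrow> 0"
    by (rule tendsto_sandwich[OF always_eventually always_eventually tendsto_const lim])
      (simp_all add: L2_dist_piM[OF sob1_L2[OF Cb2_sob1[OF C]] a(2)])
  with a u(1) C show ?thesis by (rule that)
qed

text \<open>The generator acts on f only abstractly. Symmetry moves it to \<phi>, where it is
  explicit, and the remaining gradient of f is reached as the limit of gradients of the
  \<open>Cb\<close> sequence representing f.\<close>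

lemma resolvent_weak:
  assumes L: "self_adjoint_ext P L" and f: "solves_resolvent P L l e f" and a: "represents1 P f a"
    and \<phi>: "\<phi> \<in> Cb 2"
  shows "qform (\<lambda>h. e + grad_H1 P a h) (grad_D P \<phi>) = - l * (\<integral>h. f h * (\<phi> h * vol 0 h) \<partial>P)"
proof -
  obtain k where k: "(f, k) \<in> L" "AE h in piM P. l * f h - k h = drift 0 h \<bullet> e"
    using f unfolding solves_resolvent_def by blast
  \<comment> \<open>Both pairs, (f, k) and that of \<phi>, lie in the adjoint graph: the first
    membership gives the symmetry relation, the second the square integrability of \<phi> and of its
    image.\<close>
  have "L \<subseteq> adjoint_graph (piM P) L" and \<phi>L: "(\<phi>, Lhat P \<phi>) \<in> L"
    using L \<phi> unfolding self_adjoint_ext_def self_adjoint_def by blast+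
  then have fk': "(f, k) \<in> adjoint_graph (piM P) L" and \<phi>L': "(\<phi>, Lhat P \<phi>) \<in> adjoint_graph (piM P) L"
    using k(1) by blast+
  from fk' \<phi>L have fk: "f \<in> L2 P" "k \<in> L2 P"
    and eqL: "(\<integral>h. f h * Lhat P \<phi> h \<partial>piM P) = (\<integral>h. k h * \<phi> h \<partial>piM P)"
    unfolding adjoint_graph_def L2_piM by auto
  from \<phi>L' have LL: "Lhat P \<phi> \<in> L2 P" and \<phi>2: "\<phi> \<in> L2 P"
    unfolding adjoint_graph_def L2_piM by auto
  note [measurable] = fk[THEN L2_measurable, simplified] LL[THEN L2_measurable, simplified] \<phi>2[THEN L2_measurable, simplified]
  have Z: "Znorm P \<noteq> 0" using Znorm_ge_1 by simp
  have "(\<integral>h. f h * Lhat P \<phi> h * vol 0 h \<partial>P) / Znorm P = (\<integral>h. k h * \<phi> h * vol 0 h \<partial>P) / Znorm P"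
    using eqL by (subst (asm) (1 2) integral_piM) measurable
  then have eq: "(\<integral>h. f h * (Lhat P \<phi> h * vol 0 h) \<partial>P) = (\<integral>h. k h * (\<phi> h * vol 0 h) \<partial>P)"
    using Z by (simp add: mult.assoc)
  obtain u where aH: "a \<in> H1 P" and u: "u \<in> a" and C: "\<And>n. u n \<in> Cb 2"
    and ulim: "(\<lambda>n. L2_dist P (u n) f) \<longlonglongrightarrow> 0"
    using a by (rule represents1_approx) blast
  note U = grad_H1_tendsto(2)[OF aH u] and su = Cb2_sob1[OF C]
  have G: "grad_H1 P a \<in> L2 P" by (rule grad_H1_tendsto(1)[OF aH])
  have D\<phi>: "grad_D P \<phi> \<in> L2 P" by (intro grad_D_L2 Cb2_sob1 \<phi>)
  \<comment> \<open>The same sequence has two limits to be identified: one from u n -> f in L^2, the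
    other from the convergence of the gradients.\<close>
  have "(\<lambda>n. \<integral>h. u n h * (Lhat P \<phi> h * vol 0 h) \<partial>P) \<longlonglongrightarrow> (\<integral>h. f h * (Lhat P \<phi> h * vol 0 h) \<partial>P)"
    using L2_tendsto_inner_left[OF sob1_L2[OF su] fk(1) ulim mult_vol_L2[OF LL]] by simp
  moreover have "(\<integral>h. u n h * (Lhat P \<phi> h * vol 0 h) \<partial>P) = - qform (grad_D P (u n)) (grad_D P \<phi>)" for n
    using Lhat_weak[OF \<phi> su, of n] by (simp add: qform_def mult.assoc)
  moreover have "(\<lambda>n. - qform (grad_D P (u n)) (grad_D P \<phi>)) \<longlonglongrightarrow> - qform (grad_H1 P a) (grad_D P \<phi>)"
    using U by (intro tendsto_minus qform_tendsto_left grad_D_L2 su G D\<phi>) auto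
  ultimately have 1: "(\<integral>h. f h * (Lhat P \<phi> h * vol 0 h) \<partial>P) = - qform (grad_H1 P a) (grad_D P \<phi>)"
    using LIMSEQ_unique by simp
  have "AE h in P. (drift 0 h \<bullet> e) * \<phi> h * vol 0 h = l * (f h * (\<phi> h * vol 0 h)) - k h * (\<phi> h * vol 0 h)"
    using k(2) unfolding AE_piM
  proof eventually_elim
    case (elim h)
    show ?case unfolding elim[symmetric] by (simp only: left_diff_distrib mult.assoc)
  qed
  then have "(\<integral>h. (drift 0 h \<bullet> e) * \<phi> h * vol 0 h \<partial>P)
      = (\<integral>h. l * (f h * (\<phi> h * vol 0 h)) - k h * (\<phi> h * vol 0 h) \<partial>P)"
    using drift_measurable[of e] by (intro integral_cong_AE) auto
  also have "\<dots> = l * (\<integral>h. f h * (\<phi> h * vol 0 h) \<partial>P) - (\<integral>h. k h * (\<phi> h * vol 0 h) \<partial>P)"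
    using L2_integrable_mult[OF fk(1) mult_vol_L2[OF \<phi>2]] L2_integrable_mult[OF fk(2) mult_vol_L2[OF \<phi>2]] by simp
  finally have "- qform (\<lambda>_. e) (grad_D P \<phi>) = l * (\<integral>h. f h * (\<phi> h * vol 0 h) \<partial>P) - (\<integral>h. k h * (\<phi> h * vol 0 h) \<partial>P)"
    by (simp add: drift_weak[OF \<phi>] qform_def)
  then show ?thesis
    using 1 eq qform_add_left[OF L2_const[of e] G D\<phi>] by simp
qed

text \<open>f need not belong to \<open>Cb 2\<close>, so its approximants are inserted into
  \<open>resolvent_weak\<close>; their values converge on one side and their gradients on the
  other.\<close>

lemma resolvent_energy:
  assumes L: "self_adjoint_ext P L" and f: "solves_resolvent P L l e f" and a: "represents1 P f a"
  shows "qform (\<lambda>h. e + grad_H1 P a h) (grad_H1 P a) = - l * (\<integral>h. f h * (f h * vol 0 h) \<partial>P)"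
proof -
  obtain u where aH: "a \<in> H1 P" and u: "u \<in> a" and C: "\<And>n. u n \<in> Cb 2"
    and ulim: "(\<lambda>n. L2_dist P (u n) f) \<longlonglongrightarrow> 0" and fL: "f \<in> L2 P"
    using a by (rule represents1_approx) blast
  note U = grad_H1_tendsto(2)[OF aH u] and su = Cb2_sob1[OF C]
  have G: "grad_H1 P a \<in> L2 P" by (rule grad_H1_tendsto(1)[OF aH])
  have eG: "(\<lambda>h. e + grad_H1 P a h) \<in> L2 P" by (intro L2_add L2_const G)
  have "(\<lambda>n. \<integral>h. u n h * (f h * vol 0 h) \<partial>P) \<longlonglongrightarrow> (\<integral>h. f h * (f h * vol 0 h) \<partial>P)"
    using L2_tendsto_inner_left[OF sob1_L2[OF su] fL ulim mult_vol_L2[OF fL]] by simp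
  then have "(\<lambda>n. - l * (\<integral>h. u n h * (f h * vol 0 h) \<partial>P)) \<longlonglongrightarrow> - l * (\<integral>h. f h * (f h * vol 0 h) \<partial>P)"
    by (intro tendsto_mult tendsto_const)
  moreover have "- l * (\<integral>h. u n h * (f h * vol 0 h) \<partial>P) = qform (grad_D P (u n)) (\<lambda>h. e + grad_H1 P a h)" for n
    using resolvent_weak[OF L f a C, of n] by (simp add: qform_commute[of "grad_D P (u n)"] mult.left_commute)
  moreover have "(\<lambda>n. qform (grad_D P (u n)) (\<lambda>h. e + grad_H1 P a h)) \<longlonglongrightarrow> qform (grad_H1 P a) (\<lambda>h. e + grad_H1 P a h)"
    using U by (intro qform_tendsto_left grad_D_L2 su G eG) auto
  ultimately show ?thesis
    using LIMSEQ_unique by (simp add: qform_commute[of "grad_H1 P a"])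
qed

text \<open>Testing the resolvent equation with \<open>\<chi>\<^sub>\<lambda>\<close> itself bounds \<open>\<lambda> \<parallel>\<chi>\<^sub>\<lambda>\<parallel>\<^sup>2\<close>, so that \<open>\<lambda> \<chi>\<^sub>\<lambda>\<close> tends to
  zero and the Euler-Lagrange equation appears in the limit.\<close>

lemma corrector_orthogonal_Cb2:
  assumes L: "self_adjoint_ext P L" and f: "\<And>l. l > 0 \<Longrightarrow> solves_resolvent P L l e (f l)"
    and a: "converges1 P f a" and \<phi>: "\<phi> \<in> Cb 2"
  shows "qform (\<lambda>h. e + grad_H1 P a h) (grad_D P \<phi>) = 0"
proof -
  obtain X where aH: "a \<in> H1 P" and X: "\<And>l. l > 0 \<Longrightarrow> represents1 P (f l) (X l)"
    "((\<lambda>l. dist1 P (X l) a) \<longlongrightarrow> 0) (at_right 0)"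
    using a unfolding converges1_def by blast
  define t where "t n = inverse (real (Suc n))" for n
  have t: "t n > 0" "t \<longlonglongrightarrow> 0" for n
    unfolding t_def[abs_def] by (simp, rule LIMSEQ_inverse_real_of_nat)
  then have "filterlim t (at_right 0) sequentially"
    by (simp add: filterlim_at less_imp_neq[symmetric])
  from filterlim_compose[OF X(2) this]
  have dlim: "(\<lambda>n. dist1 P (X (t n)) a) \<longlonglongrightarrow> 0" .
  define G where "G n = grad_H1 P (X (t n))" for n
  define G0 where "G0 = grad_H1 P a"
  have XH: "X (t n) \<in> H1 P" for n using X(1)[OF t(1)] unfolding represents1_def by blast
  have G: "G n \<in> L2 P" "G0 \<in> L2 P" for n
    unfolding G_def G0_def by (rule grad_H1_tendsto(1), rule XH, rule grad_H1_tendsto(1), rule aH)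
  have fL: "f (t n) \<in> L2 P" for n using X(1)[OF t(1)] L2_piM unfolding represents1_def by blast
  have Glim: "(\<lambda>n. L2_dist P (G n) G0) \<longlonglongrightarrow> 0"
  proof -
    obtain C where C: "0 < C" "\<And>V. V \<in> L2 P \<Longrightarrow> L2_norm P V \<le> C * sqrt (qform V V)"
      by (rule L2_norm_le_qform) blast
    have Z: "0 < Znorm P" using Znorm_ge_1 by simp
    have "L2_dist P (G n) G0 \<le> C * sqrt (Znorm P) * dist1 P (X (t n)) a" for n
      using C(2)[OF L2_diff[OF G], of n] Z
      unfolding dist1_eq[OF XH aH] by (simp add: G_def G0_def L2_dist_eq_norm real_sqrt_divide)
    then show ?thesis
      by (intro tendsto_sandwich[OF always_eventually always_eventually tendsto_const
          tendsto_mult_right_zero[OF dlim, of "C * sqrt (Znorm P)"]]) auto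
  qed
  have eG: "(\<lambda>h. e + G n h) \<in> L2 P" "(\<lambda>h. e + G0 h) \<in> L2 P" for n by (intro L2_add L2_const G)+
  have eGlim: "(\<lambda>n. L2_dist P (\<lambda>h. e + G n h) (\<lambda>h. e + G0 h)) \<longlonglongrightarrow> 0"
    using Glim by (simp add: L2_dist_def)
  have D\<phi>: "grad_D P \<phi> \<in> L2 P" by (intro grad_D_L2 Cb2_sob1 \<phi>)
  define E where "E n = t n * (L2_norm P (f (t n)))\<^sup>2" for n
  \<comment> \<open>A convergent sequence is bounded; with the energy identity this bounds E n
    uniformly.\<close>
  have "(\<lambda>n. - qform (\<lambda>h. e + G n h) (G n)) \<longlonglongrightarrow> - qform (\<lambda>h. e + G0 h) G0"
    by (intro tendsto_minus qform_tendsto eG eGlim G Glim)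
  from convergent_imp_Bseq[OF convergentI[OF this]]
  obtain B where "\<forall>n. norm (- qform (\<lambda>h. e + G n h) (G n)) \<le> B" by (rule BseqE)
  then have B: "\<bar>- qform (\<lambda>h. e + G n h) (G n)\<bar> \<le> B" for n unfolding real_norm_def by (rule spec)
  have E_le: "E n \<le> B" for n
  proof -
    have "(L2_norm P (f (t n)))\<^sup>2 \<le> (\<integral>h. f (t n) h * (f (t n) h * vol 0 h) \<partial>P)"
      unfolding L2_norm_sq
    proof (rule integral_mono)
      show "integrable P (\<lambda>h. f (t n) h \<bullet> f (t n) h)" by (intro L2_integrable_inner fL)
      show "integrable P (\<lambda>h. f (t n) h * (f (t n) h * vol 0 h))"
        by (intro L2_integrable_mult fL mult_vol_L2)
      show "f (t n) h \<bullet> f (t n) h \<le> f (t n) h * (f (t n) h * vol 0 h)" for h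
        using mult_left_mono[OF vol_ge_1[of h], of "f (t n) h * f (t n) h"] by (simp add: mult.assoc)
    qed
    then have "E n \<le> t n * (\<integral>h. f (t n) h * (f (t n) h * vol 0 h) \<partial>P)"
      unfolding E_def using t(1)[of n] by (intro mult_left_mono) auto
    also have "\<dots> = - qform (\<lambda>h. e + G n h) (G n)"
      using resolvent_energy[OF L f[OF t(1)] X(1)[OF t(1)], of n] by (simp add: G_def)
    finally show ?thesis using B[of n] by linarith
  qed
  define c where "c = L2_norm P (\<lambda>h. \<phi> h * vol 0 h)"
  \<comment> \<open>Writing lambda ||f|| as sqrt lambda times sqrt (lambda ||f||^2) exposes the
    factor that tends to 0.\<close>
  have le: "\<bar>qform (\<lambda>h. e + G n h) (grad_D P \<phi>)\<bar> \<le> sqrt (t n) * (sqrt B * c)" for n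
  proof -
    have "\<bar>qform (\<lambda>h. e + G n h) (grad_D P \<phi>)\<bar> = t n * \<bar>\<integral>h. f (t n) h \<bullet> (\<phi> h * vol 0 h) \<partial>P\<bar>"
      using resolvent_weak[OF L f[OF t(1)] X(1)[OF t(1)] \<phi>, of n] t(1)[of n] by (simp add: G_def abs_mult)
    also have "\<dots> \<le> t n * (L2_norm P (f (t n)) * c)"
      unfolding c_def using t(1)[of n]
      by (intro mult_left_mono L2_Cauchy_Schwarz fL mult_vol_L2 sob1_L2 Cb2_sob1 \<phi>) auto
    also have "\<dots> = sqrt (t n) * (sqrt (E n) * c)"
      using t(1)[of n] by (simp add: E_def real_sqrt_mult flip: mult.assoc)
    also have "\<dots> \<le> sqrt (t n) * (sqrt B * c)"
      using t(1)[of n] E_le[of n] by (intro mult_left_mono mult_right_mono) (auto simp: c_def)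
    finally show ?thesis .
  qed
  have "(\<lambda>n. sqrt (t n) * (sqrt B * c)) \<longlonglongrightarrow> sqrt 0 * (sqrt B * c)"
    by (intro tendsto_mult tendsto_real_sqrt tendsto_const t)
  then have lim: "(\<lambda>n. sqrt (t n) * (sqrt B * c)) \<longlonglongrightarrow> 0" by simp
  have "(\<lambda>n. qform (\<lambda>h. e + G n h) (grad_D P \<phi>)) \<longlonglongrightarrow> 0"
    by (rule Lim_null_comparison[OF always_eventually lim]) (simp only: real_norm_def le simp_thms)
  moreover have "(\<lambda>n. qform (\<lambda>h. e + G n h) (grad_D P \<phi>)) \<longlonglongrightarrow> qform (\<lambda>h. e + G0 h) (grad_D P \<phi>)"
    by (intro qform_tendsto_left eG eGlim D\<phi>)
  ultimately show ?thesis unfolding G0_def using LIMSEQ_unique by blast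
qed

section \<open>The variational principle\<close>

lemma L2pot_L2: "V \<in> L2pot P \<Longrightarrow> V \<in> L2 P"
  by (simp add: L2pot_def)

lemma L2pot_zero: "(\<lambda>_. 0) \<in> L2pot P"
proof -
  have c: "(\<lambda>_. 0) \<in> sob1 P" unfolding sob1_def using has_stoch_deriv_const by blast
  have "AE h in P. \<forall>i. stoch_D P i (\<lambda>_. 0) h = 0"
    using stoch_D_eq[OF has_stoch_deriv_const] by (simp add: AE_all_countable)
  then have "AE h in P. grad_D P (\<lambda>_. 0) h = 0"
    by eventually_elim (simp add: grad_D_def vec_eq_iff)
  then have "L2_dist P (grad_D P (\<lambda>_. 0)) (\<lambda>_. 0) = 0"
    using L2_dist_0_iff[OF grad_D_L2[OF c] L2_zero] by simp
  then show ?thesis unfolding L2pot_def using c by (auto intro!: bexI[of _ "\<lambda>_. 0"])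
qed

lemma L2pot_lincomb:
  assumes V: "V \<in> L2pot P" and W: "W \<in> L2pot P"
  shows "(\<lambda>h. V h + c *\<^sub>R W h) \<in> L2pot P"
proof -
  note VL = L2pot_L2[OF V] and WL = L2pot_L2[OF W]
  have "\<exists>U\<in>sob1 P. L2_dist P (grad_D P U) (\<lambda>h. V h + c *\<^sub>R W h) < \<epsilon>" if e: "\<epsilon> > 0" for \<epsilon>
  proof -
    \<comment> \<open>|c| + 1 in place of |c| avoids a division by zero when c = 0.\<close>
    have c0: "0 < \<bar>c\<bar> + 1" by (simp add: add_nonneg_pos)
    obtain A where A: "A \<in> sob1 P" "L2_dist P (grad_D P A) V < \<epsilon> / 2"
      using V e unfolding L2pot_def by (auto dest: spec[where x = "\<epsilon> / 2"])
    have "0 < \<epsilon> / (2 * (\<bar>c\<bar> + 1))" using e c0 by simp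
    then obtain B where B: "B \<in> sob1 P" "L2_dist P (grad_D P B) W < \<epsilon> / (2 * (\<bar>c\<bar> + 1))"
      using W unfolding L2pot_def by blast
    note D = grad_D_lincomb[OF A(1) B(1), of c]
    note gA = grad_D_L2[OF A(1)] and gB = grad_D_L2[OF B(1)]
    have "L2_dist P (grad_D P (\<lambda>h. A h + c * B h)) (\<lambda>h. V h + c *\<^sub>R W h)
        = L2_dist P (\<lambda>h. grad_D P A h + c *\<^sub>R grad_D P B h) (\<lambda>h. V h + c *\<^sub>R W h)"
      using D(2) by (intro L2_dist_cong_AE L2_measurable grad_D_L2 D(1) L2_add L2_scaleR gA gB VL WL) auto
    also have "\<dots> \<le> L2_dist P (grad_D P A) V + \<bar>c\<bar> * L2_dist P (grad_D P B) W"
      using L2_dist_add[OF gA L2_scaleR[OF gB, of c] VL L2_scaleR[OF WL, of c]] by (simp add: L2_dist_scaleR)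
    finally have "L2_dist P (grad_D P (\<lambda>h. A h + c * B h)) (\<lambda>h. V h + c *\<^sub>R W h)
        \<le> L2_dist P (grad_D P A) V + \<bar>c\<bar> * L2_dist P (grad_D P B) W" .
    moreover have "\<bar>c\<bar> * L2_dist P (grad_D P B) W \<le> (\<bar>c\<bar> + 1) * L2_dist P (grad_D P B) W"
      by (intro mult_right_mono) auto
    moreover have "(\<bar>c\<bar> + 1) * L2_dist P (grad_D P B) W < \<epsilon> / 2" using B(2) c0 by (simp add: field_simps)
    ultimately have "L2_dist P (grad_D P (\<lambda>h. A h + c * B h)) (\<lambda>h. V h + c *\<^sub>R W h) < \<epsilon>"
      using A(2) by linarith
    then show ?thesis using D(1) by blast
  qed
  then show ?thesis unfolding L2pot_def using VL WL by (auto intro: L2_add L2_scaleR)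
qed

lemma L2pot_sum: "(\<And>i. i \<in> I \<Longrightarrow> V i \<in> L2pot P) \<Longrightarrow> (\<lambda>h. \<Sum>i\<in>I. c i *\<^sub>R V i h) \<in> L2pot P"
proof (induction I rule: infinite_finite_induct)
  case (insert i I)
  then have "(\<lambda>h. (\<Sum>i\<in>I. c i *\<^sub>R V i h) + c i *\<^sub>R V i h) \<in> L2pot P"
    by (intro L2pot_lincomb) auto
  then show ?case using insert by (simp add: add.commute)
qed (simp_all add: L2pot_zero)

lemma L2pot_orthogonal:
  assumes W: "W \<in> L2 P" and orth: "\<And>U. U \<in> sob1 P \<Longrightarrow> (\<integral>h. W h \<bullet> grad_D P U h \<partial>P) = 0"
    and V: "V \<in> L2pot P"
  shows "(\<integral>h. W h \<bullet> V h \<partial>P) = 0"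
proof -
  have "\<forall>n. \<exists>U. U \<in> sob1 P \<and> L2_dist P (grad_D P U) V < inverse (real (Suc n))"
  proof
    fix n
    have "inverse (real (Suc n)) > 0" by simp
    then show "\<exists>U. U \<in> sob1 P \<and> L2_dist P (grad_D P U) V < inverse (real (Suc n))"
      using V unfolding L2pot_def by blast
  qed
  from choice[OF this] obtain U where U: "\<And>n. U n \<in> sob1 P"
    "\<And>n. L2_dist P (grad_D P (U n)) V < inverse (real (Suc n))" by blast
  have "(\<lambda>n. L2_dist P (grad_D P (U n)) V) \<longlonglongrightarrow> 0"
    by (rule tendsto_sandwich[OF always_eventually always_eventually tendsto_const LIMSEQ_inverse_real_of_nat])
      (use U(2) in \<open>auto intro: less_imp_le simp del: of_nat_Suc\<close>)
  from L2_tendsto_inner_left[OF grad_D_L2[OF U(1)] L2pot_L2[OF V] this W]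
  have "(\<lambda>n. 0) \<longlonglongrightarrow> (\<integral>h. V h \<bullet> W h \<partial>P)"
    using orth[OF U(1)] by (simp add: inner_commute)
  then show ?thesis by (simp add: LIMSEQ_const_iff inner_commute)
qed

lemma L2pot_mean: "V \<in> L2pot P \<Longrightarrow> (\<integral>h. c \<bullet> V h \<partial>P) = 0"
proof (rule L2pot_orthogonal[OF L2_const])
  fix U assume U: "U \<in> sob1 P"
  show "(\<integral>h. c \<bullet> grad_D P U h \<partial>P) = 0"
    unfolding L2_inner_vec[OF L2_const grad_D_L2[OF U]]
    by (simp add: grad_D_def integral_stoch_deriv[OF sob1_stoch_D[OF U]])
qed

text \<open>The Euler-Lagrange equation in weak form, detached from resolvents and from H1 so that
  linear combinations can satisfy it too.\<close>

definition corrector :: "real^'n \<Rightarrow> ('n C3 \<Rightarrow> real^'n) \<Rightarrow> bool" where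
  "corrector e G \<longleftrightarrow> G \<in> L2pot P \<and> (\<forall>V\<in>L2pot P. qform (\<lambda>h. e + G h) V = 0)"

lemma correctorD:
  assumes "corrector e G"
  shows "G \<in> L2pot P" "G \<in> L2 P" "(\<lambda>h. e + G h) \<in> L2 P" "\<And>V. V \<in> L2pot P \<Longrightarrow> qform (\<lambda>h. e + G h) V = 0"
  using assms unfolding corrector_def by (auto intro: L2pot_L2 L2_add)

text \<open>The class of test fields grows from \<open>Cb\<close> gradients to \<open>sob1\<close>
  gradients by \<open>gradient_orthogonality\<close>, and then to their closure.\<close>

lemma corrector_grad_H1:
  assumes L: "self_adjoint_ext P L" and f: "\<And>l. l > 0 \<Longrightarrow> solves_resolvent P L l e (f l)"
    and a: "converges1 P f a"
  shows "corrector e (grad_H1 P a)"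
  unfolding corrector_def
proof (intro conjI ballI)
  have aH: "a \<in> H1 P" using a unfolding converges1_def by blast
  note G = grad_H1_tendsto(1)[OF aH]
  obtain u where u: "u \<in> a" using grad_H1_tendsto(3)[OF aH] by blast
  note U = grad_H1_tendsto(2)[OF aH u]
  have eG: "(\<lambda>h. e + grad_H1 P a h) \<in> L2 P" by (intro L2_add L2_const G)
  show "grad_H1 P a \<in> L2pot P"
    unfolding L2pot_def
  proof (intro CollectI conjI G allI impI)
    fix \<epsilon> :: real assume "\<epsilon> > 0"
    with U have "\<forall>\<^sub>F n in sequentially. L2_dist P (grad_D P (u n)) (grad_H1 P a) < \<epsilon>"
      using order_tendstoD(2) by blast
    from eventually_happens'[OF sequentially_bot this]
    show "\<exists>U\<in>sob1 P. L2_dist P (grad_D P U) (grad_H1 P a) < \<epsilon>"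
      using cauchy1_sob1[OF conjunct1[OF U]] by blast
  qed
  fix V assume V: "V \<in> L2pot P"
  \<comment> \<open>Symmetry puts the flux on the fixed factor, which becomes the W of the
    orthogonality statements.\<close>
  have flux: "qform (\<lambda>h. e + grad_H1 P a h) W = (\<integral>h. flux h (e + grad_H1 P a h) \<bullet> W h \<partial>P)" for W
    unfolding qform_commute[of _ W] by (simp add: qform_def inner_commute)
  have "(\<integral>h. flux h (e + grad_H1 P a h) \<bullet> grad_D P \<phi> h \<partial>P) = 0" if "\<phi> \<in> Cb 2" for \<phi>
    using corrector_orthogonal_Cb2[OF L f a that] unfolding flux .
  then show "qform (\<lambda>h. e + grad_H1 P a h) V = 0"
    unfolding flux by (rule L2pot_orthogonal[OF flux_L2[OF eG] gradient_orthogonality[OF flux_L2[OF eG]] V])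
qed

section \<open>Energy and its minimiser\<close>

lemma energy_eq: "energy P e V = qform (\<lambda>h. e + V h) (\<lambda>h. e + V h)"
  unfolding energy_def qform_def flux_def by (simp add: mult.commute)

text \<open>Pythagoras for \<open>qform\<close>: V - G is again potential, so the Euler-Lagrange
  equation removes the cross terms.\<close>

lemma energy_expansion:
  assumes G: "corrector e G" and V: "V \<in> L2pot P"
  shows "energy P e V = energy P e G + qform (\<lambda>h. V h - G h) (\<lambda>h. V h - G h)"
proof -
  note C = correctorD[OF G]
  have "(\<lambda>h. V h + (-1) *\<^sub>R G h) \<in> L2pot P" by (rule L2pot_lincomb[OF V C(1)])
  then have W: "(\<lambda>h. V h - G h) \<in> L2pot P" by simp
  note WL = L2pot_L2[OF W]
  have eq: "(\<lambda>h. e + V h) = (\<lambda>h. (e + G h) + (V h - G h))" by simp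
  have "energy P e V = qform (\<lambda>h. (e + G h) + (V h - G h)) (\<lambda>h. (e + G h) + (V h - G h))"
    unfolding energy_eq eq ..
  also have "\<dots> = energy P e G + qform (\<lambda>h. e + G h) (\<lambda>h. V h - G h)
      + (qform (\<lambda>h. V h - G h) (\<lambda>h. e + G h) + qform (\<lambda>h. V h - G h) (\<lambda>h. V h - G h))"
    unfolding energy_eq
    by (simp only: qform_add_left[OF C(3) WL L2_add[OF C(3) WL]] qform_add_right[OF C(3) WL C(3)]
        qform_add_right[OF C(3) WL WL])
  also have "qform (\<lambda>h. e + G h) (\<lambda>h. V h - G h) = 0" by (rule C(4)[OF W])
  also have "qform (\<lambda>h. V h - G h) (\<lambda>h. e + G h) = 0"
    using C(4)[OF W] by (simp add: qform_commute[of "\<lambda>h. V h - G h"])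
  finally show ?thesis by simp
qed

lemma energy_minimal: "corrector e G \<Longrightarrow> V \<in> L2pot P \<Longrightarrow> energy P e G \<le> energy P e V"
  using energy_expansion qform_nonneg by simp

lemma energy_minimiser_unique:
  assumes G: "corrector e G" and V: "V \<in> L2pot P" and eq: "energy P e V = energy P e G"
  shows "AE h in P. V h = G h"
proof -
  have "qform (\<lambda>h. V h - G h) (\<lambda>h. V h - G h) = 0" using energy_expansion[OF G V] eq by simp
  from qform_eq_0[OF L2_diff[OF L2pot_L2[OF V] correctorD(2)[OF G]] this] show ?thesis by simp
qed

text \<open>The equation is linear in e and G jointly. The effective tensor is built from the
  coordinate correctors alone, and this combination is what its quadratic form sees in direction
  e.\<close>

lemma corrector_sum:
  assumes G: "\<And>i. corrector (axis i 1) (G i)"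
  shows "corrector e (\<lambda>h. \<Sum>i\<in>UNIV. e $ i *\<^sub>R G i h)"
  unfolding corrector_def
proof (intro conjI ballI)
  show "(\<lambda>h. \<Sum>i\<in>UNIV. e $ i *\<^sub>R G i h) \<in> L2pot P" by (intro L2pot_sum correctorD(1)[OF G])
  fix V assume V: "V \<in> L2pot P"
  note VL = L2pot_L2[OF V]
  have e: "(\<Sum>i\<in>UNIV. e $ i *\<^sub>R axis i 1) = e"
    by (simp add: vec_eq_iff axis_def if_distrib cong: if_cong)
  have "qform (\<lambda>h. e + (\<Sum>i\<in>UNIV. e $ i *\<^sub>R G i h)) V
      = (\<integral>h. (\<Sum>i\<in>UNIV. e $ i * ((axis i 1 + G i h) \<bullet> flux h (V h))) \<partial>P)"
    unfolding qform_def
    by (subst (1) e[symmetric]) (simp add: inner_sum_left inner_add_left scaleR_add_right flip: sum.distrib distrib_left)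
  also have "\<dots> = (\<Sum>i\<in>UNIV. e $ i * qform (\<lambda>h. axis i 1 + G i h) V)"
    unfolding qform_def using qform_integrable[OF correctorD(3)[OF G] VL]
    by (simp add: Bochner_Integration.integral_sum)
  finally show "qform (\<lambda>h. e + (\<Sum>i\<in>UNIV. e $ i *\<^sub>R G i h)) V = 0"
    by (simp add: correctorD(4)[OF G V])
qed

subsection \<open>Bounds on the energy\<close>

lemma flux_metric: "flux h ((1 / vol 0 h) *\<^sub>R (metric_g 0 h *v x)) = x"
proof -
  have "slope h \<bullet> (metric_g 0 h *v x) = (slope h \<bullet> x) * (vol 0 h)\<^sup>2"
    by (simp add: metric_inner vol_sq algebra_simps)
  then show ?thesis
    using vol_pos[of h]
    by (simp add: flux_eq power2_eq_square)
      (simp add: metric_g_0 matrix_vector_mult_add_rdistrib outer_mult_vec)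
qed

text \<open>Legendre duality for the quadratic form \<open>w \<mapsto> w \<bullet> flux h w\<close>, whose inverse matrix is
  \<open>g / \<surd>\<bar>g\<bar>\<close>.\<close>

lemma flux_duality:
  "2 * (x \<bullet> w) - x \<bullet> (((1 / vol 0 h) *\<^sub>R metric_g 0 h) *v x) \<le> w \<bullet> flux h w"
proof -
  \<comment> \<open>The point w = z, where \<open>flux h z = x\<close>, is the one at which equality
    holds.\<close>
  define z where "z = (1 / vol 0 h) *\<^sub>R (metric_g 0 h *v x)"
  have fz: "flux h z = x" unfolding z_def by (rule flux_metric)
  have "0 \<le> (w - z) \<bullet> flux h (w - z)" by (rule inner_flux_nonneg)
  also have "\<dots> = w \<bullet> flux h w - w \<bullet> flux h z - z \<bullet> flux h w + z \<bullet> flux h z"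
    by (simp add: flux_diff inner_diff_left inner_diff_right)
  also have "z \<bullet> flux h w = w \<bullet> flux h z" by (rule inner_flux_commute)
  finally have "2 * (x \<bullet> w) - x \<bullet> z \<le> w \<bullet> flux h w" unfolding fz by (simp add: inner_commute)
  then show ?thesis by (simp add: z_def flip: scaleR_matrix_vector_assoc)
qed

text \<open>Its inverse is Z times the lower tensor.\<close>

definition dual_matrix :: "real^'n^'n" where
  "dual_matrix = (\<integral>h. (1 / vol 0 h) *\<^sub>R metric_g 0 h \<partial>P)"

lemma dual_integrable: "integrable P (\<lambda>h. (1 / vol 0 h) *\<^sub>R metric_g 0 h)"
proof (rule integrable_matrixI)
  fix i j
  have "smooth1 (\<lambda>h. inverse (vol 0 h) * (mat 1 $ i $ j + slope h $ i * slope h $ j))"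
    by (intro smooth1_mult smooth1_add smooth1_const smooth1_inverse_vol smooth1_slope)
  from L2_integrable[OF has_stoch_derivD(1)[OF smooth1_deriv[OF this, of i]]]
  show "integrable P (\<lambda>h. ((1 / vol 0 h) *\<^sub>R metric_g 0 h) $ i $ j)"
    by (simp add: metric_g_0 outer_def inverse_eq_divide)
qed

lemma dual_matrix_quadratic:
  "y \<bullet> (dual_matrix *v x) = (\<integral>h. y \<bullet> (((1 / vol 0 h) *\<^sub>R metric_g 0 h) *v x) \<partial>P)"
  "integrable P (\<lambda>h. y \<bullet> (((1 / vol 0 h) *\<^sub>R metric_g 0 h) *v x))"
proof -
  show "y \<bullet> (dual_matrix *v x) = (\<integral>h. y \<bullet> (((1 / vol 0 h) *\<^sub>R metric_g 0 h) *v x) \<partial>P)"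
    unfolding dual_matrix_def by (rule integral_quadratic[OF dual_integrable, symmetric])
  have "linear (\<lambda>B :: real^'n^'n. y \<bullet> (B *v x))"
    by (rule linearI)
      (simp_all add: matrix_vector_mult_add_rdistrib inner_add_right flip: scaleR_matrix_vector_assoc)
  then show "integrable P (\<lambda>h. y \<bullet> (((1 / vol 0 h) *\<^sub>R metric_g 0 h) *v x))"
    by (intro integrable_bounded_linear[OF _ dual_integrable]) (simp add: linear_conv_bounded_linear)
qed

text \<open>The duality inequality is integrated with a deterministic x, so the linear term loses G
  and x stays free. Optimising x exactly gives \<open>D_lower\<close>; optimising against
  \<open>dual_matrix_upper\<close> gives 1 / Z^2.\<close>

lemma energy_lower:
  assumes G: "corrector e G"
  shows "2 * (x \<bullet> e) - x \<bullet> (dual_matrix *v x) \<le> energy P e G"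
proof -
  note C = correctorD[OF G]
  have i: "integrable P (\<lambda>h. x \<bullet> G h)" by (intro L2_integrable_inner L2_const C(2))
  have "(\<integral>h. 2 * (x \<bullet> (e + G h)) - x \<bullet> (((1 / vol 0 h) *\<^sub>R metric_g 0 h) *v x) \<partial>P) \<le> energy P e G"
    unfolding energy_eq qform_def
  proof (rule integral_mono)
    show "integrable P (\<lambda>h. 2 * (x \<bullet> (e + G h)) - x \<bullet> (((1 / vol 0 h) *\<^sub>R metric_g 0 h) *v x))"
      by (intro Bochner_Integration.integrable_diff integrable_mult_right L2_integrable_inner L2_const C(3)
          dual_matrix_quadratic(2))
    show "integrable P (\<lambda>h. (e + G h) \<bullet> flux h (e + G h))" by (rule qform_integrable[OF C(3,3)])
  qed (rule flux_duality)
  moreover have "(\<integral>h. 2 * (x \<bullet> (e + G h)) - x \<bullet> (((1 / vol 0 h) *\<^sub>R metric_g 0 h) *v x) \<partial>P)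
      = 2 * (x \<bullet> e + (\<integral>h. x \<bullet> G h \<partial>P)) - x \<bullet> (dual_matrix *v x)"
    using i dual_matrix_quadratic[of x x] prob_space by (simp add: inner_add_right)
  ultimately show ?thesis using L2pot_mean[OF C(1)] by simp
qed

text \<open>No eigenvalue of g exceeds |g|, so g / sqrt|g| is at most sqrt|g|, whose mean is
  Z.\<close>

lemma dual_matrix_upper: "x \<bullet> (dual_matrix *v x) \<le> Znorm P * (x \<bullet> x)"
proof -
  have "x \<bullet> (dual_matrix *v x) \<le> (\<integral>h. vol 0 h * (x \<bullet> x) \<partial>P)"
    unfolding dual_matrix_quadratic(1)
  proof (rule integral_mono[OF dual_matrix_quadratic(2)])
    show "integrable P (\<lambda>h. vol 0 h * (x \<bullet> x))" by (intro integrable_mult_left L2_integrable vol_L2)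
    fix h
    have "x \<bullet> (metric_g 0 h *v x) \<le> (vol 0 h)\<^sup>2 * (x \<bullet> x)"
      using slope_inner_sq[of h x] by (simp add: metric_inner power2_eq_square algebra_simps)
    then show "x \<bullet> (((1 / vol 0 h) *\<^sub>R metric_g 0 h) *v x) \<le> vol 0 h * (x \<bullet> x)"
      using vol_pos[of h] by (simp add: divide_le_eq power2_eq_square mult_ac flip: scaleR_matrix_vector_assoc)
  qed
  then show ?thesis by (simp add: Znorm_def)
qed

text \<open>Since g \<ge> I and vol \<le> K almost surely, the form is at least |x|^2 / K and the
  kernel is trivial.\<close>

lemma dual_matrix_invertible: "dual_matrix ** matrix_inv dual_matrix = mat 1"
proof -
  obtain K where K: "1 \<le> K" "AE h in P. vol 0 h \<le> K" by (rule vol_bounded)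
  have "x = 0" if x: "dual_matrix *v x = 0" for x
  proof -
    have "(\<integral>h. (x \<bullet> x) / K \<partial>P) \<le> x \<bullet> (dual_matrix *v x)"
      unfolding dual_matrix_quadratic(1)
    proof (rule integral_mono_AE[OF _ dual_matrix_quadratic(2)])
      show "AE h in P. (x \<bullet> x) / K \<le> x \<bullet> (((1 / vol 0 h) *\<^sub>R metric_g 0 h) *v x)"
        using K(2)
      proof eventually_elim
        case (elim h)
        have "(x \<bullet> x) / K \<le> (x \<bullet> x) / vol 0 h"
          using elim vol_pos[of h] by (intro divide_left_mono) auto
        also have "\<dots> \<le> x \<bullet> (((1 / vol 0 h) *\<^sub>R metric_g 0 h) *v x)"
          using vol_pos[of h] by (simp add: metric_inner divide_right_mono flip: scaleR_matrix_vector_assoc)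
        finally show ?case .
      qed
    qed simp
    then have "(x \<bullet> x) / K \<le> 0" using x prob_space by simp
    then have "x \<bullet> x \<le> 0" using K(1) by (simp add: divide_le_0_iff)
    then show "x = 0" by (metis inner_eq_zero_iff inner_ge_zero order_antisym)
  qed
  then obtain B where "B ** dual_matrix = mat 1"
    using matrix_left_invertible_ker[of dual_matrix] by blast
  then have "dual_matrix ** B = mat 1" by (simp add: matrix_left_right_inverse)
  with matrix_inv_eqI[OF this] show ?thesis by simp
qed

subsection \<open>The effective tensor\<close>

definition tensor_density :: "('n C3 \<Rightarrow> real^'n^'n) \<Rightarrow> 'n C3 \<Rightarrow> real^'n^'n" where
  "tensor_density X h = vol 0 h *\<^sub>R ((mat 1 + X h) ** ginv 0 h ** transpose (mat 1 + X h))"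

lemma tensor_density_quadratic:
  "y \<bullet> (tensor_density X h *v x) = (transpose (mat 1 + X h) *v y) \<bullet> flux h (transpose (mat 1 + X h) *v x)"
proof -
  have "y \<bullet> (B *v z) = (transpose B *v y) \<bullet> z" for B :: "real^'n^'n" and z
    by (simp add: dot_lmul_matrix)
  then show ?thesis
    by (simp add: tensor_density_def flux_def flip: scaleR_matrix_vector_assoc matrix_vector_mul_assoc)
qed

text \<open>Row i of the gradient matrix belongs to direction i, so the transpose combines the rows
  with weights x.\<close>

lemma transpose_gradient_mult:
  "transpose (mat 1 + (\<chi> i j. G i $ j)) *v x = x + (\<Sum>i\<in>UNIV. x $ i *\<^sub>R G i)" for G :: "'n \<Rightarrow> real^'n"
proof -
  have "(transpose (mat 1 + (\<chi> i j. G i $ j)) *v x) $ k = (\<Sum>i\<in>UNIV. (if i = k then x $ i else 0) + x $ i * G i $ k)" for k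
    by (auto simp: matrix_vector_mult_def transpose_def mat_def algebra_simps intro!: sum.cong)
  then show ?thesis by (simp add: vec_eq_iff sum.distrib)
qed

context
  fixes G :: "'n \<Rightarrow> 'n C3 \<Rightarrow> real^'n" and T :: "real^'n^'n"
  assumes G: "\<And>i. corrector (axis i 1) (G i)"
    and T: "T = (1 / Znorm P) *\<^sub>R (\<integral>h. tensor_density (\<lambda>h. \<chi> i j. G i h $ j) h \<partial>P)"
begin

definition combined :: "real^'n \<Rightarrow> 'n C3 \<Rightarrow> real^'n" where
  "combined x h = (\<Sum>i\<in>UNIV. x $ i *\<^sub>R G i h)"

lemma corrector_combined: "corrector x (combined x)"
  unfolding combined_def[abs_def] by (rule corrector_sum[OF G])

lemma tensor_density_combined:
  "y \<bullet> (tensor_density (\<lambda>h. \<chi> i j. G i h $ j) h *v x) = (y + combined y h) \<bullet> flux h (x + combined x h)"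
  by (simp only: tensor_density_quadratic transpose_gradient_mult combined_def)

text \<open>The bilinear version is stated because coordinate vectors then give all entries of T,
  and symmetry follows from that of \<open>qform\<close>.\<close>

lemma tensor_quadratic: "y \<bullet> (T *v x) = qform (\<lambda>h. y + combined y h) (\<lambda>h. x + combined x h) / Znorm P"
proof -
  have "integrable P (tensor_density (\<lambda>h. \<chi> i j. G i h $ j))"
  proof (rule integrable_matrixI)
    show "integrable P (\<lambda>h. tensor_density (\<lambda>h. \<chi> i j. G i h $ j) h $ i $ j)" for i j
      unfolding matrix_nth_quadratic tensor_density_combined
      by (intro qform_integrable correctorD(3)[OF corrector_combined])
  qed
  from integral_quadratic[OF this, of y x] show ?thesis
    unfolding T tensor_density_combined qform_def by (simp flip: scaleR_matrix_vector_assoc)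
qed

lemma tensor_energy: "e \<bullet> (T *v e) = energy P e (combined e) / Znorm P"
  by (simp add: tensor_quadratic energy_eq)

lemma tensor_symmetric: "transpose T = T"
  by (simp add: vec_eq_iff transpose_def matrix_nth_quadratic tensor_quadratic qform_commute)

lemma tensor_lower: "(e \<bullet> e) / (Znorm P)\<^sup>2 \<le> e \<bullet> (T *v e)"
proof -
  have Z: "0 < Znorm P" using Znorm_ge_1 by simp
  \<comment> \<open>The maximiser of 2 x . e - Z |x|^2. Its value |e|^2 / Z and the division by Z in
    the tensor produce the square of Z.\<close>
  define x where "x = (1 / Znorm P) *\<^sub>R e"
  have "x \<bullet> (dual_matrix *v x) \<le> (e \<bullet> e) / Znorm P"
    using dual_matrix_upper[of x] Z by (simp add: x_def)
  moreover have "x \<bullet> e = (e \<bullet> e) / Znorm P" by (simp add: x_def)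
  ultimately have "(e \<bullet> e) / Znorm P \<le> energy P e (combined e)"
    using energy_lower[OF corrector_combined, of x e] by linarith
  then show ?thesis using Z by (simp add: tensor_energy field_simps power2_eq_square)
qed

lemma tensor_pos_def: "pos_def T"
  unfolding pos_def_def
proof (intro conjI allI impI tensor_symmetric)
  fix x :: "real^'n" assume "x \<noteq> 0"
  then have "0 < (x \<bullet> x) / (Znorm P)\<^sup>2" using Znorm_ge_1 by simp
  then show "0 < x \<bullet> (T *v x)" using tensor_lower[of x] by linarith
qed

lemma D_lower_le: "e \<bullet> (D_lower P *v e) \<le> e \<bullet> (T *v e)"
proof -
  \<comment> \<open>The exact maximiser over x of the bound in \<open>energy_lower\<close>, with
    value e . x.\<close>
  define x where "x = matrix_inv dual_matrix *v e"
  have "dual_matrix *v x = e"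
    unfolding x_def matrix_vector_mul_assoc dual_matrix_invertible by simp
  then have "e \<bullet> x \<le> energy P e (combined e)"
    using energy_lower[OF corrector_combined, of x e] by (simp add: inner_commute)
  then have "(e \<bullet> x) / Znorm P \<le> energy P e (combined e) / Znorm P"
    using Znorm_ge_1 by (intro divide_right_mono) auto
  then show ?thesis
    by (simp add: tensor_energy D_lower_def x_def flip: scaleR_matrix_vector_assoc dual_matrix_def)
qed

lemma D_upper_quadratic: "e \<bullet> (D_upper P *v e) = energy P e (\<lambda>_. 0) / Znorm P"
proof -
  have "integrable P (\<lambda>h. vol 0 h *\<^sub>R ginv 0 h)"
  proof (rule integrable_matrixI)
    show "integrable P (\<lambda>h. (vol 0 h *\<^sub>R ginv 0 h) $ i $ j)" for i j
      using L2_integrable[OF has_stoch_derivD(1)[OF smooth1_deriv[OF smooth1_coeff, of i i j]]]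
      by (simp add: coeff_def[abs_def])
  qed
  from integral_quadratic[OF this, of e e] show ?thesis
    unfolding D_upper_def energy_eq qform_def flux_def by (simp flip: scaleR_matrix_vector_assoc)
qed

lemma D_upper_ge: "e \<bullet> (T *v e) \<le> e \<bullet> (D_upper P *v e)"
  unfolding tensor_energy D_upper_quadratic
  using Znorm_ge_1 by (intro divide_right_mono energy_minimal[OF corrector_combined L2pot_zero]) simp

text \<open>For V = 0 the energy density is at most vol |e|^2, whose mean Z |e|^2 cancels the
  normalisation.\<close>

lemma tensor_upper: "e \<bullet> (T *v e) \<le> e \<bullet> e"
proof -
  have "energy P e (\<lambda>_. 0) \<le> (\<integral>h. vol 0 h * (e \<bullet> e) \<partial>P)"
    unfolding energy_eq qform_def
  proof (rule integral_mono)
    show "integrable P (\<lambda>h. (e + 0) \<bullet> flux h (e + 0))"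
      by (intro qform_integrable) simp_all
    show "integrable P (\<lambda>h. vol 0 h * (e \<bullet> e))" by (intro integrable_mult_left L2_integrable vol_L2)
  qed (simp add: inner_flux_upper)
  then have "energy P e (\<lambda>_. 0) / Znorm P \<le> e \<bullet> e"
    using Znorm_ge_1 by (simp add: Znorm_def[symmetric] divide_le_eq mult.commute)
  then show ?thesis using D_upper_ge[of e] unfolding D_upper_quadratic by linarith
qed

text \<open>Two correctors for the same e minimise the same functional, so the combination of
  coordinate correctors may be exchanged for the gradient of the corrector in direction e
  itself.\<close>

lemma tensor_corrector_energy:
  assumes "corrector e V"
  shows "e \<bullet> (T *v e) = (1 / Znorm P) * energy P e V"
  using energy_minimal[OF corrector_combined[of e] correctorD(1)[OF assms]]
    energy_minimal[OF assms correctorD(1)[OF corrector_combined[of e]]]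
  by (simp add: tensor_energy)

end

lemma energy_INF: "corrector e G \<Longrightarrow> (INF V\<in>L2pot P. energy P e V) = energy P e G"
  by (rule cInf_eq_minimum) (auto simp: energy_minimal correctorD(1))

end

theorem theorem5p2:
  fixes P :: "('n::finite) C3 measure"
    and L :: "(('n C3 \<Rightarrow> real) \<times> ('n C3 \<Rightarrow> real)) set"
    and \<chi>l :: "real^'n \<Rightarrow> real \<Rightarrow> 'n C3 \<Rightarrow> real"
    and \<chi>' :: "real^'n \<Rightarrow> (nat \<Rightarrow> 'n C3 \<Rightarrow> real) set"
  assumes adm: "admissible P"
    and L: "self_adjoint_ext P L"
    and \<chi>l: "\<And>e l. l > 0 \<Longrightarrow> solves_resolvent P L l e (\<chi>l e l)"
    and \<chi>': "\<And>e. converges1 P (\<chi>l e) (\<chi>' e)"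
  shows "pos_def (eff_tensor P \<chi>')
    \<and> (\<forall>e. e \<bullet> (eff_tensor P \<chi>' *v e) = (1 / Znorm P) * (INF V\<in>L2pot P. energy P e V)
         \<and> grad_H1 P (\<chi>' e) \<in> L2pot P
         \<and> (\<forall>V\<in>L2pot P. energy P e (grad_H1 P (\<chi>' e)) \<le> energy P e V)
         \<and> (\<forall>V\<in>L2pot P. energy P e V = energy P e (grad_H1 P (\<chi>' e)) \<longrightarrow>
              (AE h in P. V h = grad_H1 P (\<chi>' e) h)))
    \<and> (\<forall>e. e \<bullet> (D_lower P *v e) \<le> e \<bullet> (eff_tensor P \<chi>' *v e)
         \<and> e \<bullet> (eff_tensor P \<chi>' *v e) \<le> e \<bullet> (D_upper P *v e))
    \<and> (\<forall>e. norm e = 1 \<longrightarrow>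
         1 / (Znorm P)\<^sup>2 \<le> e \<bullet> (eff_tensor P \<chi>' *v e)
         \<and> e \<bullet> (eff_tensor P \<chi>' *v e) \<le> 1)"
proof -
  interpret admissible_measure P by unfold_locales (rule adm)
  define G where "G i = grad_H1 P (\<chi>' (axis i 1))" for i
  have C: "corrector e (grad_H1 P (\<chi>' e))" for e
    by (rule corrector_grad_H1[OF L \<chi>l \<chi>'])
  then have G: "corrector (axis i 1) (G i)" for i unfolding G_def .
  \<comment> \<open>The gradient matrix has the coordinate correctors as its rows.\<close>
  have T: "eff_tensor P \<chi>' = (1 / Znorm P) *\<^sub>R (\<integral>h. tensor_density (\<lambda>h. \<chi> i j. G i h $ j) h \<partial>P)"
    by (simp add: eff_tensor_def tensor_density_def grad_chi_def G_def)
  have unit: "e \<bullet> e = 1" if "norm e = 1" for e :: "real^'n"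
    using that by (simp add: dot_square_norm)
  show ?thesis
    using tensor_pos_def[OF G T] tensor_corrector_energy[OF G T C] energy_INF[OF C] correctorD(1)[OF C]
      energy_minimal[OF C] energy_minimiser_unique[OF C] D_lower_le[OF G T] D_upper_ge[OF G T]
      tensor_lower[OF G T] tensor_upper[OF G T] unit
    by (intro conjI allI ballI impI) (simp_all, metis+)
qed

end
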